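(* Let $n \geq 1$, let $\mathcal{B}$ be a unital $C^*$-algebra, and let $\phi : M_n \to \mathcal{B}$ be a linear map. The following conditions are equivalent: 1. For any unital $C^*$-algebra $\mathcal{A}$ and any unital $C^*$-algebra $\mathcal{C}$ containing the algebraic tensor product $\mathcal{A} \otimes_{alg} \mathcal{B}$ (as a $*$-subalgebra), the map $\phi_{\mathcal{A}} := \mathrm{id}_{\mathcal{A}} \otimes \phi : \mathcal{A} \otimes M_n \to \mathcal{C}$ is a positive map. 2. The map $\phi$ is completely positive. 3. $[\phi(E_{ij})] \in M_n(\mathcal{B})^+$.
   Context: $M_n = M_n(\mathbb{C})$, and $\{E_{ij} : 1 \leq i,j \leq n\}$ is the usual system of matrix units in $M_n$. All $C^*$-algebras are assumed unital. For a $C^*$-algebra $\mathcal{D}$, $\mathcal{D}^+$ denotes its set of positive elements and $M_n(\mathcal{D})$ is the $C^*$-algebra of $n \times n$ matrices over $\mathcal{D}$. $[\phi(E_{ij})]$ denotes the $n \times n$ matrix over $\mathcal{B}$ with $(i,j)$ entry $\phi(E_{ij})$. The $C^*$-algebra $\mathcal{A} \otimes M_n$ is identified with $M_n(\mathcal{A})$, with $a \otimes E_{ij}$ corresponding to the matrix with $a$ in position $(i,j)$ and zeros elsewhere. The map $\phi_{\mathcal{A}} = \mathrm{id}_{\mathcal{A}} \otimes \phi$ is the linear map $\mathcal{A} \otimes M_n \to \mathcal{A} \otimes_{alg} \mathcal{B} \subseteq \mathcal{C}$ given by $\phi_{\mathcal{A}}(\sum_{i,j} r_{ij} \otimes E_{ij})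 = \sum_{i,j} r_{ij} \otimes \phi(E_{ij})$. A linear map between $C^*$-algebras is positive if it maps positive elements to positive elements, and completely positive if for every $k \geq 1$ its entrywise application to $k\times k$ matrices is a positive map. *)

theory Defs
  imports
    Complex_Main
    "HOL-Algebra.Module"
    "HOL-Library.Nonpos_Ints"
    "HOL-Library.Poly_Mapping"
    "Jordan_Normal_Form.Matrix"
begin

section \<open>Unital C*-algebras\<close>

record 'a star_alg = "(complex, 'a) module" +
  adj :: "'a \<Rightarrow> 'a"

record 'a normed_star_alg = "'a star_alg" +
  nrm :: "'a \<Rightarrow> real"

definition complex_alg :: "complex normed_star_alg" where
  "complex_alg =
     \<lparr>carrier = UNIV, monoid.mult = (*), one = 1, ring.zero = 0, add = (+),
      smult = (*), adj = cnj, nrm = cmod\<rparr>"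

text \<open>
  The locale \<open>algebra\<close> of HOL-Algebra is restricted to commutative algebras, hence the
  combination of \<open>ring\<close> and \<open>module\<close>. The zero algebra is not excluded.
\<close>

locale unital_cstar_algebra = ring A + scal: module complex_alg A
  for A :: "'a normed_star_alg" (structure) +
  assumes smult_mult_left:
      "\<And>c x y. \<lbrakk>x \<in> carrier A; y \<in> carrier A\<rbrakk> \<Longrightarrow> (c \<odot>\<^bsub>A\<^esub> x) \<otimes> y = c \<odot>\<^bsub>A\<^esub> (x \<otimes> y)"
    and smult_mult_right:
      "\<And>c x y. \<lbrakk>x \<in> carrier A; y \<in> carrier A\<rbrakk> \<Longrightarrow> x \<otimes> (c \<odot>\<^bsub>A\<^esub> y) = c \<odot>\<^bsub>A\<^esub> (x \<otimes> y)"
    and adj_closed: "\<And>x. x \<in> carrier A \<Longrightarrow> adj A x \<in> carrier A"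
    and adj_adj: "\<And>x. x \<in> carrier A \<Longrightarrow> adj A (adj A x) = x"
    and adj_add:
      "\<And>x y. \<lbrakk>x \<in> carrier A; y \<in> carrier A\<rbrakk> \<Longrightarrow> adj A (x \<oplus> y) = adj A x \<oplus> adj A y"
    and adj_smult: "\<And>c x. x \<in> carrier A \<Longrightarrow> adj A (c \<odot>\<^bsub>A\<^esub> x) = cnj c \<odot>\<^bsub>A\<^esub> adj A x"
    and adj_mult:
      "\<And>x y. \<lbrakk>x \<in> carrier A; y \<in> carrier A\<rbrakk> \<Longrightarrow> adj A (x \<otimes> y) = adj A y \<otimes> adj A x"
    and nrm_nonneg: "\<And>x. x \<in> carrier A \<Longrightarrow> 0 \<le> nrm A x"
    and nrm_eq_0: "\<And>x. x \<in> carrier A \<Longrightarrow> nrm A x = 0 \<longleftrightarrow> x = \<zero>"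
    and nrm_triangle:
      "\<And>x y. \<lbrakk>x \<in> carrier A; y \<in> carrier A\<rbrakk> \<Longrightarrow> nrm A (x \<oplus> y) \<le> nrm A x + nrm A y"
    and nrm_smult: "\<And>c x. x \<in> carrier A \<Longrightarrow> nrm A (c \<odot>\<^bsub>A\<^esub> x) = cmod c * nrm A x"
    and nrm_mult:
      "\<And>x y. \<lbrakk>x \<in> carrier A; y \<in> carrier A\<rbrakk> \<Longrightarrow> nrm A (x \<otimes> y) \<le> nrm A x * nrm A y"
    and cstar_identity: "\<And>x. x \<in> carrier A \<Longrightarrow> nrm A (adj A x \<otimes> x) = (nrm A x)\<^sup>2"
    and complete:
      "\<And>x :: nat \<Rightarrow> 'a. \<lbrakk>\<And>i. x i \<in> carrier A;
          \<And>e. e > 0 \<Longrightarrow> \<exists>N. \<forall>i\<ge>N. \<forall>j\<ge>N. nrm A (x i \<ominus> x j) < e\<rbrakk>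
        \<Longrightarrow> \<exists>l\<in>carrier A. (\<lambda>i. nrm A (x i \<ominus> l)) \<longlonglongrightarrow> 0"


section \<open>Positivity\<close>

definition spectrum_of :: "('a, 'x) star_alg_scheme \<Rightarrow> 'a \<Rightarrow> complex set" where
  "spectrum_of A x = {c. (c \<odot>\<^bsub>A\<^esub> \<one>\<^bsub>A\<^esub>) \<ominus>\<^bsub>A\<^esub> x \<notin> Units A}"

definition positive_elt :: "('a, 'x) star_alg_scheme \<Rightarrow> 'a \<Rightarrow> bool" where
  "positive_elt A x \<longleftrightarrow> x \<in> carrier A \<and> adj A x = x \<and> spectrum_of A x \<subseteq> \<real>\<^sub>\<ge>\<^sub>0"

definition linear_on ::
  "('a, 'x) star_alg_scheme \<Rightarrow> ('b, 'y) star_alg_scheme \<Rightarrow> ('a \<Rightarrow> 'b) \<Rightarrow> bool" where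
  "linear_on A B f \<longleftrightarrow>
     f \<in> carrier A \<rightarrow> carrier B \<and>
     (\<forall>x\<in>carrier A. \<forall>y\<in>carrier A. f (x \<oplus>\<^bsub>A\<^esub> y) = f x \<oplus>\<^bsub>B\<^esub> f y) \<and>
     (\<forall>c. \<forall>x\<in>carrier A. f (c \<odot>\<^bsub>A\<^esub> x) = c \<odot>\<^bsub>B\<^esub> f x)"

definition positive_map ::
  "('a, 'x) star_alg_scheme \<Rightarrow> ('b, 'y) star_alg_scheme \<Rightarrow> ('a \<Rightarrow> 'b) \<Rightarrow> bool" where
  "positive_map A B f \<longleftrightarrow>
     linear_on A B f \<and> (\<forall>x. positive_elt A x \<longrightarrow> positive_elt B (f x))"


section \<open>Matrices over a *-algebra and complete positivity\<close>

text \<open>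
  Positivity in a C*-algebra depends only on the unital *-algebra structure, so the
  (unique) C*-norm of \<open>M\<^sub>k(D)\<close> is not part of the structure below.
\<close>

definition mat_alg :: "nat \<Rightarrow> ('a, 'x) star_alg_scheme \<Rightarrow> 'a mat star_alg" where
  "mat_alg k D =
     \<lparr>carrier = {X \<in> carrier_mat k k. elements_mat X \<subseteq> carrier D},
      monoid.mult = (\<lambda>X Y. mat k k (\<lambda>(i, j).
         finsum D (\<lambda>l. X $$ (i, l) \<otimes>\<^bsub>D\<^esub> Y $$ (l, j)) {..<k})),
      one = mat k k (\<lambda>(i, j). if i = j then \<one>\<^bsub>D\<^esub> else \<zero>\<^bsub>D\<^esub>),
      ring.zero = mat k k (\<lambda>_. \<zero>\<^bsub>D\<^esub>),
      add = (\<lambda>X Y. mat k k (\<lambda>p. X $$ p \<oplus>\<^bsub>D\<^esub> Y $$ p)),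
      smult = (\<lambda>c X. mat k k (\<lambda>p. c \<odot>\<^bsub>D\<^esub> X $$ p)),
      adj = (\<lambda>X. mat k k (\<lambda>(i, j). adj D (X $$ (j, i))))\<rparr>"

abbreviation cmat_alg :: "nat \<Rightarrow> complex mat star_alg" where
  "cmat_alg n \<equiv> mat_alg n complex_alg"

definition matrix_unit :: "nat \<Rightarrow> nat \<Rightarrow> nat \<Rightarrow> complex mat" where
  "matrix_unit n i j = mat n n (\<lambda>p. if p = (i, j) then 1 else 0)"

definition completely_positive ::
  "('a, 'x) star_alg_scheme \<Rightarrow> ('b, 'y) star_alg_scheme \<Rightarrow> ('a \<Rightarrow> 'b) \<Rightarrow> bool" where
  "completely_positive A B f \<longleftrightarrow>
     (\<forall>k\<ge>1. positive_map (mat_alg k A) (mat_alg k B) (map_mat f))"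


section \<open>The algebraic tensor product\<close>

text \<open>
  The algebraic tensor product is the free complex vector space on
  \<open>carrier A \<times> carrier B\<close>, realised by finitely supported functions, modulo the subspace
  generated by the bilinearity relations. Its elements are the resulting classes.
\<close>

definition tensor_free ::
  "('a, 'x) star_alg_scheme \<Rightarrow> ('b, 'y) star_alg_scheme \<Rightarrow> ('a \<times> 'b \<Rightarrow>\<^sub>0 complex) set" where
  "tensor_free A B = {f. Poly_Mapping.keys f \<subseteq> carrier A \<times> carrier B}"

definition free_scale :: "complex \<Rightarrow> ('i \<Rightarrow>\<^sub>0 complex) \<Rightarrow> ('i \<Rightarrow>\<^sub>0 complex)" where
  "free_scale c f = Poly_Mapping.map (\<lambda>z. c * z) f"

inductive_set tensor_null ::
  "('a, 'x) star_alg_scheme \<Rightarrow> ('b, 'y) star_alg_scheme \<Rightarrow> ('a \<times> 'b \<Rightarrow>\<^sub>0 complex) set"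
  for A B where
    zero: "0 \<in> tensor_null A B"
  | plus: "\<lbrakk>f \<in> tensor_null A B; g \<in> tensor_null A B\<rbrakk> \<Longrightarrow> f + g \<in> tensor_null A B"
  | scale: "f \<in> tensor_null A B \<Longrightarrow> free_scale c f \<in> tensor_null A B"
  | add_left: "\<lbrakk>a \<in> carrier A; a' \<in> carrier A; b \<in> carrier B\<rbrakk> \<Longrightarrow>
      Poly_Mapping.single (a \<oplus>\<^bsub>A\<^esub> a', b) 1 - Poly_Mapping.single (a, b) 1
        - Poly_Mapping.single (a', b) 1 \<in> tensor_null A B"
  | add_right: "\<lbrakk>a \<in> carrier A; b \<in> carrier B; b' \<in> carrier B\<rbrakk> \<Longrightarrow>
      Poly_Mapping.single (a, b \<oplus>\<^bsub>B\<^esub> b') 1 - Poly_Mapping.single (a, b) 1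
        - Poly_Mapping.single (a, b') 1 \<in> tensor_null A B"
  | smult_left: "\<lbrakk>a \<in> carrier A; b \<in> carrier B\<rbrakk> \<Longrightarrow>
      Poly_Mapping.single (c \<odot>\<^bsub>A\<^esub> a, b) 1 - Poly_Mapping.single (a, b) c \<in> tensor_null A B"
  | smult_right: "\<lbrakk>a \<in> carrier A; b \<in> carrier B\<rbrakk> \<Longrightarrow>
      Poly_Mapping.single (a, c \<odot>\<^bsub>B\<^esub> b) 1 - Poly_Mapping.single (a, b) c \<in> tensor_null A B"

definition tensor_class ::
  "('a, 'x) star_alg_scheme \<Rightarrow> ('b, 'y) star_alg_scheme \<Rightarrow>
   ('a \<times> 'b \<Rightarrow>\<^sub>0 complex) \<Rightarrow> ('a \<times> 'b \<Rightarrow>\<^sub>0 complex) set" where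
  "tensor_class A B f = {g \<in> tensor_free A B. g - f \<in> tensor_null A B}"

definition pure_tensor ::
  "('a, 'x) star_alg_scheme \<Rightarrow> ('b, 'y) star_alg_scheme \<Rightarrow> 'a \<Rightarrow> 'b \<Rightarrow>
   ('a \<times> 'b \<Rightarrow>\<^sub>0 complex) set" where
  "pure_tensor A B a b = tensor_class A B (Poly_Mapping.single (a, b) 1)"

text \<open>
  Linear extension of \<open>(a, b) (a', b') = (a a', b b')\<close> and of \<open>(a, b)\<^sup>* = (a\<^sup>*, b\<^sup>*)\<close>
  (the latter conjugate linear) to the free vector space.
\<close>

definition free_mult ::
  "('a, 'x) star_alg_scheme \<Rightarrow> ('b, 'y) star_alg_scheme \<Rightarrow>
   ('a \<times> 'b \<Rightarrow>\<^sub>0 complex) \<Rightarrow> ('a \<times> 'b \<Rightarrow>\<^sub>0 complex) \<Rightarrow> ('a \<times> 'b \<Rightarrow>\<^sub>0 complex)" where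
  "free_mult A B f g =
     (\<Sum>s\<in>Poly_Mapping.keys f. \<Sum>t\<in>Poly_Mapping.keys g.
        Poly_Mapping.single (fst s \<otimes>\<^bsub>A\<^esub> fst t, snd s \<otimes>\<^bsub>B\<^esub> snd t)
          (Poly_Mapping.lookup f s * Poly_Mapping.lookup g t))"

definition free_adj ::
  "('a, 'x) star_alg_scheme \<Rightarrow> ('b, 'y) star_alg_scheme \<Rightarrow>
   ('a \<times> 'b \<Rightarrow>\<^sub>0 complex) \<Rightarrow> ('a \<times> 'b \<Rightarrow>\<^sub>0 complex)" where
  "free_adj A B f =
     (\<Sum>s\<in>Poly_Mapping.keys f. Poly_Mapping.single (adj A (fst s), adj B (snd s)) (cnj (Poly_Mapping.lookup f s)))"

text \<open>
  The operations on classes are induced by those on representatives: each union below is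
  over copies of one and the same class, as in \<open>HOL.Equiv_Relations\<close>.
\<close>

definition tensor_alg ::
  "('a, 'x) star_alg_scheme \<Rightarrow> ('b, 'y) star_alg_scheme \<Rightarrow>
   ('a \<times> 'b \<Rightarrow>\<^sub>0 complex) set star_alg" where
  "tensor_alg A B =
     \<lparr>carrier = tensor_class A B ` tensor_free A B,
      monoid.mult = (\<lambda>X Y. \<Union>f\<in>X. \<Union>g\<in>Y. tensor_class A B (free_mult A B f g)),
      one = pure_tensor A B \<one>\<^bsub>A\<^esub> \<one>\<^bsub>B\<^esub>,
      ring.zero = tensor_class A B 0,
      add = (\<lambda>X Y. \<Union>f\<in>X. \<Union>g\<in>Y. tensor_class A B (f + g)),
      smult = (\<lambda>c X. \<Union>f\<in>X. tensor_class A B (free_scale c f)),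
      adj = (\<lambda>X. \<Union>f\<in>X. tensor_class A B (free_adj A B f))\<rparr>"

text \<open>
  Containment as a *-subalgebra is expressed by an injective *-homomorphism, which is not
  required to preserve the unit.
\<close>

definition star_embedding ::
  "('a, 'x) star_alg_scheme \<Rightarrow> ('b, 'y) star_alg_scheme \<Rightarrow> ('a \<Rightarrow> 'b) \<Rightarrow> bool" where
  "star_embedding T C \<iota> \<longleftrightarrow>
     linear_on T C \<iota> \<and> inj_on \<iota> (carrier T) \<and>
     (\<forall>x\<in>carrier T. \<forall>y\<in>carrier T. \<iota> (x \<otimes>\<^bsub>T\<^esub> y) = \<iota> x \<otimes>\<^bsub>C\<^esub> \<iota> y) \<and>
     (\<forall>x\<in>carrier T. \<iota> (adj T x) = adj C (\<iota> x))"

text \<open>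
  The map \<open>id\<^sub>A \<otimes> \<phi>\<close> with \<open>A \<otimes> M\<^sub>n\<close> identified with \<open>M\<^sub>n(A)\<close>, so that
  \<open>\<Sum>\<^sub>i\<^sub>j r\<^sub>i\<^sub>j \<otimes> E\<^sub>i\<^sub>j\<close> is the matrix \<open>R\<close> with entries \<open>r\<^sub>i\<^sub>j\<close>.
\<close>

definition id_tensor ::
  "('a, 'x) star_alg_scheme \<Rightarrow> ('b, 'y) star_alg_scheme \<Rightarrow> nat \<Rightarrow> (complex mat \<Rightarrow> 'b) \<Rightarrow>
   'a mat \<Rightarrow> ('a \<times> 'b \<Rightarrow>\<^sub>0 complex) set" where
  "id_tensor A B n \<phi> R =
     finsum (tensor_alg A B)
       (\<lambda>(i, j). pure_tensor A B (R $$ (i, j)) (\<phi> (matrix_unit n i j)))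
       ({..<n} \<times> {..<n})"

text \<open>
  The type arguments are the universes over which the algebras \<open>A\<close> and \<open>C\<close> range, since HOL
  cannot quantify over types within a formula. A theorem with this condition as conclusion
  covers all algebras by polymorphism. As a premise, the condition has content only if the
  universes are large enough, e.g. if \<open>'a\<close> has room for \<open>M\<^sub>n\<close> and \<open>'c\<close> for \<open>M\<^sub>n(B)\<close>.
\<close>

definition positive_on_tensors ::
  "'a itself \<Rightarrow> 'c itself \<Rightarrow> nat \<Rightarrow> 'b normed_star_alg \<Rightarrow> (complex mat \<Rightarrow> 'b) \<Rightarrow> bool" where
  "positive_on_tensors _ _ n B \<phi> \<longleftrightarrow>
     (\<forall>(A :: 'a normed_star_alg) (C :: 'c normed_star_alg) \<iota>.
        unital_cstar_algebra A \<longrightarrow> unital_cstar_algebra C \<longrightarrow>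
        star_embedding (tensor_alg A B) C \<iota> \<longrightarrow>
        positive_map (mat_alg n A) C (\<iota> \<circ> id_tensor A B n \<phi>))"

end

theory Submission
  imports Defs
begin

text \<open>
  Everything passes through the Choi matrix \<open>P = [\<phi>(E\<^sub>i\<^sub>j)]\<close>.

  Positivity of \<open>P\<close> implies both other conditions for the same reason. Let \<open>\<beta> : A \<times> B \<rightarrow> C\<close> be
  bilinear, multiplicative and *-preserving. If \<open>R = S\<^sup>* S\<close> in \<open>M\<^sub>n(A)\<close> and \<open>P = T\<^sup>* T\<close> in \<open>M\<^sub>n(B)\<close>,
  then \<open>\<Sum>\<^sub>i\<^sub>j \<beta>(R\<^sub>i\<^sub>j, P\<^sub>i\<^sub>j) = \<Sum>\<^sub>k\<^sub>l w\<^sub>k\<^sub>l\<^sup>* w\<^sub>k\<^sub>l\<close> with \<open>w\<^sub>k\<^sub>l = \<Sum>\<^sub>i \<beta>(S\<^sub>k\<^sub>i, T\<^sub>l\<^sub>i)\<close>, which is positive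
  (\<open>contract_positive\<close>). With \<open>\<beta>(a, b) = a \<otimes> b\<close>, embedded into \<open>C\<close>, the sum is \<open>(id \<otimes> \<phi>)(R)\<close>. With
  \<open>A = M\<^sub>k\<close>, \<open>C = M\<^sub>k(B)\<close> and \<open>\<beta>(a, b) = [a\<^sub>p\<^sub>q b]\<close> it is the \<open>k\<close>-th amplification of \<open>\<phi>\<close>, once
  \<open>M\<^sub>k(M\<^sub>n)\<close> is identified with \<open>M\<^sub>n(M\<^sub>k)\<close> (\<open>flip_mat_star_square\<close>).

  For the converses, \<open>[E\<^sub>i\<^sub>j]\<close> is positive because it is \<open>S\<^sup>* S\<close> for the matrix \<open>S\<close> with first row
  \<open>E\<^sub>0\<^sub>j\<close> and zeros elsewhere. The \<open>n\<close>-th amplification of \<open>\<phi>\<close> maps it to \<open>P\<close>. So does \<open>id \<otimes> \<phi>\<close> for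
  \<open>A = M\<^sub>n\<close> and \<open>C = M\<^sub>n(B)\<close>, the pairing \<open>[a\<^sub>p\<^sub>q b]\<close> inducing an embedding of \<open>M\<^sub>n \<otimes> B\<close> into \<open>M\<^sub>n(B)\<close>.

  The argument needs two facts about a C*-algebra: an element is positive in the spectral sense
  iff it is some \<open>x\<^sup>* x\<close>, and sums of positive elements are positive. They are proved here by
  elementary means, with positivity of a self-adjoint \<open>a\<close> measured by \<open>\<parallel>t - a\<parallel> \<le> t\<close> for some \<open>t\<close>
  (\<open>npos\<close>). This condition is obviously additive; the iteration \<open>y \<mapsto> (z + y\<^sup>2)/2\<close> gives square roots;
  and if \<open>h\<^sup>2 + s\<^sup>2 = T\<close> with \<open>h\<close>, \<open>s\<close> self-adjoint and commuting, then \<open>\<parallel>h\<parallel>\<^sup>2 \<le> T\<close>, since \<open>h\<close> is the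
  real part of \<open>u = h + is\<close> and \<open>u\<^sup>* u = T\<close>. These tools replace the spectral radius formula and the
  continuous functional calculus.

  The two facts are also needed in \<open>M\<^sub>n(B)\<close>, which therefore must be given a C*-norm. The norm used
  is the infimum of all \<open>t \<ge> 0\<close> for which \<open>t\<^sup>2 - x\<^sup>* x\<close> is a sum of squares; the norm axioms and the
  C*-identity then reduce to identities between sums of squares. Comparison with the norms of the
  entries shows that it is finite, definite and complete (\<open>cstar_norm_mat_alg\<close>).
\<close>

section \<open>Complex *-algebras\<close>

lemma complex_alg_simps [simp]:
  "carrier complex_alg = UNIV" "x \<otimes>\<^bsub>complex_alg\<^esub> y = x * y" "\<one>\<^bsub>complex_alg\<^esub> = 1"
  "\<zero>\<^bsub>complex_alg\<^esub> = 0" "x \<oplus>\<^bsub>complex_alg\<^esub> y = x + y" "c \<odot>\<^bsub>complex_alg\<^esub> x = c * x"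
  "adj complex_alg x = cnj x" "nrm complex_alg x = cmod x"
  by (simp_all add: complex_alg_def)

lemma cring_complex_alg: "cring complex_alg"
proof (rule cringI)
  show "abelian_group complex_alg"
  proof (rule abelian_groupI)
    fix x assume "x \<in> carrier complex_alg"
    show "\<exists>y\<in>carrier complex_alg. y \<oplus>\<^bsub>complex_alg\<^esub> x = \<zero>\<^bsub>complex_alg\<^esub>"
      by (rule bexI[of _ "- x"]) simp_all
  qed (simp_all add: algebra_simps)
  show "Group.comm_monoid complex_alg"
    by (rule comm_monoidI) (simp_all add: algebra_simps)
qed (simp_all add: algebra_simps)

text \<open>
  The purely algebraic part of the axioms of a C*-algebra. It is separated from the norm because
  matrix algebras and tensor products come as *-algebras without a norm.
\<close>

locale star_algebra = ring A + scal: module complex_alg A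
  for A :: "('a, 'x) star_alg_scheme" (structure) +
  assumes smult_mult_left:
      "\<And>c x y. \<lbrakk>x \<in> carrier A; y \<in> carrier A\<rbrakk> \<Longrightarrow> (c \<odot>\<^bsub>A\<^esub> x) \<otimes> y = c \<odot>\<^bsub>A\<^esub> (x \<otimes> y)"
    and smult_mult_right:
      "\<And>c x y. \<lbrakk>x \<in> carrier A; y \<in> carrier A\<rbrakk> \<Longrightarrow> x \<otimes> (c \<odot>\<^bsub>A\<^esub> y) = c \<odot>\<^bsub>A\<^esub> (x \<otimes> y)"
    and adj_closed: "\<And>x. x \<in> carrier A \<Longrightarrow> adj A x \<in> carrier A"
    and adj_adj: "\<And>x. x \<in> carrier A \<Longrightarrow> adj A (adj A x) = x"
    and adj_add:
      "\<And>x y. \<lbrakk>x \<in> carrier A; y \<in> carrier A\<rbrakk> \<Longrightarrow> adj A (x \<oplus> y) = adj A x \<oplus> adj A y"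
    and adj_smult: "\<And>c x. x \<in> carrier A \<Longrightarrow> adj A (c \<odot>\<^bsub>A\<^esub> x) = cnj c \<odot>\<^bsub>A\<^esub> adj A x"
    and adj_mult:
      "\<And>x y. \<lbrakk>x \<in> carrier A; y \<in> carrier A\<rbrakk> \<Longrightarrow> adj A (x \<otimes> y) = adj A y \<otimes> adj A x"
begin

lemma scale_closed [simp]: "x \<in> carrier A \<Longrightarrow> c \<odot> x \<in> carrier A"
  by (rule scal.smult_closed) simp_all

lemma smult_add_left: "x \<in> carrier A \<Longrightarrow> (c + d) \<odot> x = c \<odot> x \<oplus> d \<odot> x"
  using scal.smult_l_distr[of c d x] by simp

lemma smult_add_right: "x \<in> carrier A \<Longrightarrow> y \<in> carrier A \<Longrightarrow> c \<odot> (x \<oplus> y) = c \<odot> x \<oplus> c \<odot> y"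
  using scal.smult_r_distr[of c x y] by simp

lemma smult_smult: "x \<in> carrier A \<Longrightarrow> c \<odot> (d \<odot> x) = (c * d) \<odot> x"
  using scal.smult_assoc1[of c d x] by simp

lemma scale_one [simp]: "x \<in> carrier A \<Longrightarrow> 1 \<odot> x = x"
  using scal.smult_one[of x] by simp

lemma smult_zero_left [simp]: "x \<in> carrier A \<Longrightarrow> 0 \<odot> x = \<zero>"
  using scal.smult_l_null[of x] by simp

lemma smult_zero_right [simp]: "c \<odot> \<zero> = \<zero>"
  using scal.smult_r_null[of c] by simp

lemma a_inv_smult: "x \<in> carrier A \<Longrightarrow> \<ominus> x = (-1) \<odot> x"
proof -
  assume x: "x \<in> carrier A"
  have "(-1) \<odot> x \<oplus> x = (-1 + 1) \<odot> x"
    using x by (simp only: smult_add_left scale_one)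
  also have "\<dots> = \<zero>" using x by simp
  finally show ?thesis using x by (intro minus_equality) auto
qed

lemma a_minus_smult: "x \<in> carrier A \<Longrightarrow> y \<in> carrier A \<Longrightarrow> x \<ominus> y = x \<oplus> (-1) \<odot> y"
  by (simp add: a_minus_def a_inv_smult)

lemma eq_if_minus_zero: "x \<in> carrier A \<Longrightarrow> y \<in> carrier A \<Longrightarrow> x \<ominus> y = \<zero> \<Longrightarrow> x = y"
  using minus_equality[of x "\<ominus> y"] by (simp add: a_minus_def)

lemma adj_one [simp]: "adj A \<one> = \<one>"
proof -
  have u: "adj A \<one> \<in> carrier A" by (simp add: adj_closed)
  have "\<one> = adj A (adj A \<one>)" by (simp add: adj_adj)
  also have "\<dots> = adj A (adj A \<one> \<otimes> \<one>)" using u by simp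
  also have "\<dots> = adj A \<one> \<otimes> adj A (adj A \<one>)" using u by (intro adj_mult) simp_all
  also have "\<dots> = adj A \<one>" using u by (simp add: adj_adj)
  finally show ?thesis by simp
qed

lemma adj_zero [simp]: "adj A \<zero> = \<zero>"
  using adj_smult[of \<zero> 0] adj_closed[OF zero_closed] by simp

lemma adj_minus: "x \<in> carrier A \<Longrightarrow> y \<in> carrier A \<Longrightarrow> adj A (x \<ominus> y) = adj A x \<ominus> adj A y"
  by (simp add: a_minus_smult adj_add adj_smult adj_closed)

lemma adj_uminus: "x \<in> carrier A \<Longrightarrow> adj A (\<ominus> x) = \<ominus> adj A x"
  by (simp add: a_inv_smult adj_smult adj_closed)

lemmas adj_simps = adj_closed adj_adj adj_add adj_smult adj_mult adj_minus adj_uminus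

end

section \<open>Deciding identities of a noncommutative algebra\<close>

text \<open>
  An identity between expressions in \<open>\<oplus>\<close>, \<open>\<ominus>\<close>, \<open>\<otimes>\<close> and \<open>\<odot>\<close> holds in every algebra if it holds for
  noncommuting indeterminates. Both sides are therefore translated into lists of words with complex
  coefficients, an index standing for each indeterminate; the words of the difference are collected,
  and what remains is that each collected coefficient is zero. The translation is found by resolution
  with \<open>nc_rules\<close>, which follow the syntax of the expression.
\<close>

type_synonym nc_poly = "(nat list \<times> complex) list"

definition nc_scale :: "complex \<Rightarrow> nat list \<Rightarrow> nc_poly \<Rightarrow> nc_poly" where
  "nc_scale c u p = map (\<lambda>(w, d). (u @ w, c * d)) p"

primrec nc_mult :: "nc_poly \<Rightarrow> nc_poly \<Rightarrow> nc_poly" where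
  "nc_mult [] q = []"
| "nc_mult (t # p) q = nc_scale (snd t) (fst t) q @ nc_mult p q"

primrec nc_insert :: "nat list \<Rightarrow> complex \<Rightarrow> nc_poly \<Rightarrow> nc_poly" where
  "nc_insert w c [] = [(w, c)]"
| "nc_insert w c (t # p) = (if fst t = w then (w, c + snd t) # p else t # nc_insert w c p)"

primrec nc_collect :: "nc_poly \<Rightarrow> nc_poly" where
  "nc_collect [] = []"
| "nc_collect (t # p) = nc_insert (fst t) (snd t) (nc_collect p)"

inductive list_at :: "'a list \<Rightarrow> 'a \<Rightarrow> nat \<Rightarrow> bool" where
  here: "list_at (x # xs) x 0"
| there: "list_at xs x i \<Longrightarrow> list_at (y # xs) x (Suc i)"

lemma list_at_nth: "list_at xs x i \<Longrightarrow> i < length xs \<and> xs ! i = x"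
  by (induction rule: list_at.induct) simp_all

context star_algebra
begin

primrec word_val :: "'a list \<Rightarrow> nat list \<Rightarrow> 'a" where
  "word_val vs [] = \<one>"
| "word_val vs (i # w) = vs ! i \<otimes> word_val vs w"

primrec poly_val :: "'a list \<Rightarrow> nc_poly \<Rightarrow> 'a" where
  "poly_val vs [] = \<zero>"
| "poly_val vs (t # p) = snd t \<odot> word_val vs (fst t) \<oplus> poly_val vs p"

abbreviation word_in :: "nat \<Rightarrow> nat list \<Rightarrow> bool" where
  "word_in n w \<equiv> list_all (\<lambda>i. i < n) w"

abbreviation words_in :: "nat \<Rightarrow> nc_poly \<Rightarrow> bool" where
  "words_in n p \<equiv> list_all (\<lambda>t. word_in n (fst t)) p"

lemma word_val_closed [simp]:
  "set vs \<subseteq> carrier A \<Longrightarrow> word_in (length vs) w \<Longrightarrow> word_val vs w \<in> carrier A"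
  by (induction w) (auto simp: subset_iff)

lemma word_val_append:
  "set vs \<subseteq> carrier A \<Longrightarrow> word_in (length vs) u \<Longrightarrow> word_in (length vs) w
   \<Longrightarrow> word_val vs (u @ w) = word_val vs u \<otimes> word_val vs w"
  by (induction u) (simp_all add: m_assoc subset_iff)

lemma poly_val_closed [simp]:
  "set vs \<subseteq> carrier A \<Longrightarrow> words_in (length vs) p \<Longrightarrow> poly_val vs p \<in> carrier A"
  by (induction p) simp_all

lemma poly_val_append:
  "set vs \<subseteq> carrier A \<Longrightarrow> words_in (length vs) p \<Longrightarrow> words_in (length vs) q
   \<Longrightarrow> poly_val vs (p @ q) = poly_val vs p \<oplus> poly_val vs q"
  by (induction p) (simp_all add: a_assoc)

lemma words_in_scale: "words_in n p \<Longrightarrow> word_in n u \<Longrightarrow> words_in n (nc_scale c u p)"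
  by (induction p) (auto simp: nc_scale_def)

lemma words_in_mult: "words_in n p \<Longrightarrow> words_in n q \<Longrightarrow> words_in n (nc_mult p q)"
  by (induction p) (simp_all add: words_in_scale)

lemma words_in_insert: "words_in n p \<Longrightarrow> word_in n w \<Longrightarrow> words_in n (nc_insert w c p)"
  by (induction p) simp_all

lemma words_in_collect: "words_in n p \<Longrightarrow> words_in n (nc_collect p)"
  by (induction p) (simp_all add: words_in_insert)

lemma poly_val_scale:
  assumes "set vs \<subseteq> carrier A" "word_in (length vs) u"
  shows "words_in (length vs) p
    \<Longrightarrow> poly_val vs (nc_scale c u p) = c \<odot> (word_val vs u \<otimes> poly_val vs p)"
proof (induction p)
  case Nil then show ?case using assms by (simp add: nc_scale_def)
next
  case (Cons t p)
  obtain w d where t: "t = (w, d)" by force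
  show ?case using Cons assms
    by (simp add: t nc_scale_def word_val_append r_distr smult_add_right smult_smult
        smult_mult_right)
qed

lemma poly_val_mult:
  assumes "set vs \<subseteq> carrier A" "words_in (length vs) q"
  shows "words_in (length vs) p
    \<Longrightarrow> poly_val vs (nc_mult p q) = poly_val vs p \<otimes> poly_val vs q"
  using assms by (induction p) (simp_all add: poly_val_append poly_val_scale words_in_scale
      words_in_mult l_distr smult_mult_left)

lemma poly_val_insert:
  assumes "set vs \<subseteq> carrier A" "word_in (length vs) w"
  shows "words_in (length vs) p
    \<Longrightarrow> poly_val vs (nc_insert w c p) = c \<odot> word_val vs w \<oplus> poly_val vs p"
proof (induction p)
  case Nil then show ?case using assms by simp
next
  case (Cons t p)
  then have "word_val vs (fst t) \<in> carrier A" "poly_val vs p \<in> carrier A"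
    "word_val vs w \<in> carrier A" using assms by simp_all
  with Cons show ?case by (auto simp: a_assoc smult_add_left intro: a_lcomm)
qed

lemma poly_val_collect:
  assumes "set vs \<subseteq> carrier A"
  shows "words_in (length vs) p \<Longrightarrow> poly_val vs (nc_collect p) = poly_val vs p"
  using assms by (induction p) (simp_all add: poly_val_insert words_in_collect)

lemma poly_val_zero:
  assumes "set vs \<subseteq> carrier A"
  shows "words_in (length vs) p \<Longrightarrow> list_all (\<lambda>t. snd t = 0) p \<Longrightarrow> poly_val vs p = \<zero>"
  using assms by (induction p) simp_all

definition represents :: "'a list \<Rightarrow> nc_poly \<Rightarrow> 'a \<Rightarrow> bool" where
  "represents vs p x \<longleftrightarrow>
     (set vs \<subseteq> carrier A \<longrightarrow> words_in (length vs) p \<and> poly_val vs p = x \<and> x \<in> carrier A)"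

lemma represents_add: "represents vs p x \<Longrightarrow> represents vs q y \<Longrightarrow> represents vs (p @ q) (x \<oplus> y)"
  by (auto simp: represents_def poly_val_append)

lemma represents_minus:
  "represents vs p x \<Longrightarrow> represents vs q y \<Longrightarrow> represents vs (p @ nc_scale (-1) [] q) (x \<ominus> y)"
  by (auto simp: represents_def poly_val_append poly_val_scale words_in_scale a_minus_smult)

lemma represents_uminus: "represents vs p x \<Longrightarrow> represents vs (nc_scale (-1) [] p) (\<ominus> x)"
  by (auto simp: represents_def poly_val_scale words_in_scale a_inv_smult)

lemma represents_mult:
  "represents vs p x \<Longrightarrow> represents vs q y \<Longrightarrow> represents vs (nc_mult p q) (x \<otimes> y)"
  by (auto simp: represents_def poly_val_mult words_in_mult)

lemma represents_smult: "represents vs p x \<Longrightarrow> represents vs (nc_scale c [] p) (c \<odot> x)"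
  by (auto simp: represents_def poly_val_scale words_in_scale)

lemma represents_one: "represents vs [([], 1)] \<one>"
  by (simp add: represents_def)

lemma represents_zero: "represents vs [] \<zero>"
  by (simp add: represents_def)

lemma represents_var: "list_at vs x i \<Longrightarrow> represents vs [([i], 1)] x"
  by (drule list_at_nth) (auto simp: represents_def subset_iff)

lemmas nc_rules = represents_add represents_minus represents_uminus represents_mult
  represents_smult represents_one represents_zero represents_var list_at.intros

theorem nc_identity:
  assumes "represents vs p x" "represents vs q y" "set vs \<subseteq> carrier A"
    and "list_all (\<lambda>t. snd t = 0) (nc_collect (p @ nc_scale (-1) [] q))"
  shows "x = y"
proof -
  let ?r = "p @ nc_scale (-1) [] q"
  have r: "represents vs ?r (x \<ominus> y)" by (rule represents_minus[OF assms(1,2)])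
  then have w: "words_in (length vs) ?r" using assms(3) unfolding represents_def by blast
  have "x \<ominus> y = poly_val vs (nc_collect ?r)"
    using r assms(3) poly_val_collect[OF assms(3) w] by (simp add: represents_def)
  also have "\<dots> = \<zero>"
    by (rule poly_val_zero[OF assms(3) words_in_collect[OF w] assms(4)])
  finally show ?thesis
    using assms(1-3) by (auto simp: represents_def intro: eq_if_minus_zero)
qed

declare nc_scale_def [simp]

text \<open>
  The same decision modulo a hypothesis \<open>u = v\<close>, usually a commutation relation multiplied by
  what the identity at hand requires.
\<close>

lemma nc_identity_mod:
  assumes "u = v" "represents vs r u" "represents vs s v" "represents vs p x" "represents vs q y"
    and "set vs \<subseteq> carrier A"
    and "list_all (\<lambda>t. snd t = 0)
      (nc_collect ((p @ nc_scale (-1) [] r) @ nc_scale (-1) [] (q @ nc_scale (-1) [] s)))"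
  shows "x = y"
proof -
  have "x \<ominus> u = y \<ominus> v"
    using nc_identity[OF represents_minus[OF assms(4,2)] represents_minus[OF assms(5,3)] assms(6,7)] .
  moreover have "x \<in> carrier A" "y \<in> carrier A" "u \<in> carrier A" "v \<in> carrier A"
    using assms by (auto simp: represents_def)
  ultimately show ?thesis using assms(1) by (simp add: a_minus_def)
qed

abbreviation rsc :: "real \<Rightarrow> 'a" where
  "rsc t \<equiv> complex_of_real t \<odot> \<one>"

lemma adj_rsc [simp]: "adj A (rsc t) = rsc t"
  by (simp add: adj_smult)

end

section \<open>Norms and limits\<close>

text \<open>
  The norm is a parameter rather than a record field so that the theory applies to matrix algebras
  as they stand.
\<close>

locale cstar_norm = star_algebra A for A :: "('a, 'x) star_alg_scheme" (structure) +
  fixes N :: "'a \<Rightarrow> real"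
  assumes nrm_nonneg: "\<And>x. x \<in> carrier A \<Longrightarrow> 0 \<le> N x"
    and nrm_eq_0: "\<And>x. x \<in> carrier A \<Longrightarrow> N x = 0 \<longleftrightarrow> x = \<zero>"
    and nrm_triangle: "\<And>x y. \<lbrakk>x \<in> carrier A; y \<in> carrier A\<rbrakk> \<Longrightarrow> N (x \<oplus> y) \<le> N x + N y"
    and nrm_smult: "\<And>c x. x \<in> carrier A \<Longrightarrow> N (c \<odot>\<^bsub>A\<^esub> x) = cmod c * N x"
    and nrm_mult: "\<And>x y. \<lbrakk>x \<in> carrier A; y \<in> carrier A\<rbrakk> \<Longrightarrow> N (x \<otimes> y) \<le> N x * N y"
    and cstar_identity: "\<And>x. x \<in> carrier A \<Longrightarrow> N (adj A x \<otimes> x) = (N x)\<^sup>2"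
    and complete:
      "\<And>x :: nat \<Rightarrow> 'a. \<lbrakk>\<And>i. x i \<in> carrier A;
          \<And>e. e > 0 \<Longrightarrow> \<exists>M. \<forall>i\<ge>M. \<forall>j\<ge>M. N (x i \<ominus> x j) < e\<rbrakk>
        \<Longrightarrow> \<exists>l\<in>carrier A. (\<lambda>i. N (x i \<ominus> l)) \<longlonglongrightarrow> 0"
begin


lemma nrm_zero [simp]: "N \<zero> = 0"
  by (simp add: nrm_eq_0)

lemma nrm_uminus: "x \<in> carrier A \<Longrightarrow> N (\<ominus> x) = N x"
  by (simp add: a_inv_smult nrm_smult)

lemma nrm_minus_le: "x \<in> carrier A \<Longrightarrow> y \<in> carrier A \<Longrightarrow> N (x \<ominus> y) \<le> N x + N y"
  using nrm_triangle[of x "\<ominus> y"] by (simp add: a_minus_def nrm_uminus)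

lemma nrm_minus_commute:
  assumes "x \<in> carrier A" "y \<in> carrier A"
  shows "N (x \<ominus> y) = N (y \<ominus> x)"
proof -
  have "x \<ominus> y = \<ominus> (y \<ominus> x)"
    by (rule nc_identity[where vs="[x,y]"], (rule nc_rules)+) (simp_all add: assms)
  then show ?thesis using assms by (simp add: nrm_uminus)
qed

lemma nrm_adj [simp]:
  assumes x: "x \<in> carrier A"
  shows "N (adj A x) = N x"
proof -
  have *: "N y \<le> N (adj A y)" if y: "y \<in> carrier A" for y
  proof -
    have "N y * N y \<le> N (adj A y) * N y"
      using cstar_identity[OF y] nrm_mult[OF adj_closed[OF y] y] by (simp add: power2_eq_square)
    then show ?thesis
      using nrm_nonneg[OF y] nrm_nonneg[OF adj_closed[OF y]] mult_right_le_imp_le by fastforce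
  qed
  show ?thesis using *[OF x] *[OF adj_closed[OF x]] x by (simp add: adj_adj)
qed

lemma nrm_square_sa: "x \<in> carrier A \<Longrightarrow> adj A x = x \<Longrightarrow> N (x \<otimes> x) = (N x)\<^sup>2"
  using cstar_identity[of x] by simp

lemma nrm_one_le: "N \<one> \<le> 1"
proof -
  have "N \<one> = (N \<one>)\<^sup>2" using nrm_square_sa[of \<one>] by simp
  then show ?thesis by (auto simp: power2_eq_square)
qed

lemma nrm_smult_one_le: "N (c \<odot> \<one>) \<le> cmod c"
  using nrm_one_le by (simp add: nrm_smult mult_left_le)

lemma limit_exists:
  assumes x: "\<And>i. x i \<in> carrier A"
    and step: "\<And>k. N (x (Suc k) \<ominus> x k) \<le> t (Suc k) - t k"
    and t: "convergent (t :: nat \<Rightarrow> real)"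
  shows "\<exists>l\<in>carrier A. (\<lambda>i. N (x i \<ominus> l)) \<longlonglongrightarrow> 0"
proof (rule complete[OF x])
  have mono: "N (x j \<ominus> x i) \<le> t j - t i" if "i \<le> j" for i j
    using that
  proof (induction rule: dec_induct)
    case base
    have "x i \<ominus> x i = \<zero>" using x by (simp add: a_minus_def r_neg)
    then show ?case by simp
  next
    case (step n)
    have "x (Suc n) \<ominus> x i = (x (Suc n) \<ominus> x n) \<oplus> (x n \<ominus> x i)"
      by (rule nc_identity[where vs="[x (Suc n), x n, x i]"], (rule nc_rules)+)
        (simp_all add: x)
    then show ?case
      using nrm_triangle[of "x (Suc n) \<ominus> x n" "x n \<ominus> x i"] assms(2)[of n] step x by simp
  qed
  fix e :: real assume "e > 0"
  moreover have "Cauchy t" using t by (simp add: Cauchy_convergent_iff)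
  ultimately obtain M where M: "\<And>i j. i \<ge> M \<Longrightarrow> j \<ge> M \<Longrightarrow> \<bar>t i - t j\<bar> < e"
    unfolding Cauchy_def dist_real_def by blast
  show "\<exists>M. \<forall>i\<ge>M. \<forall>j\<ge>M. N (x i \<ominus> x j) < e"
  proof (intro exI allI impI)
    fix i j assume ij: "i \<ge> M" "j \<ge> M"
    show "N (x i \<ominus> x j) < e"
    proof (cases "i \<le> j")
      case True
      then show ?thesis using mono[OF True] M[OF ij] nrm_minus_commute[OF x x, of i j] by simp
    next
      case False
      then show ?thesis using mono[of j i] M[OF ij] by simp
    qed
  qed
qed

text \<open>
  The two consecutive terms \<open>d k\<close> and \<open>d (Suc k)\<close> fit limits of iterations, where \<open>u\<close> and \<open>v\<close> are
  compared by means of \<open>x k\<close> and \<open>x (Suc k)\<close>.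
\<close>

lemma eq_by_limit:
  assumes "u \<in> carrier A" "v \<in> carrier A" and d: "d \<longlonglongrightarrow> (0::real)"
    and le: "\<And>k. N (u \<ominus> v) \<le> C * (d k + d (Suc k))"
  shows "u = v"
proof -
  have "(\<lambda>k. C * (d k + d (Suc k))) \<longlonglongrightarrow> C * (0 + 0)"
    by (intro tendsto_intros d LIMSEQ_Suc)
  then have "N (u \<ominus> v) \<le> C * (0 + 0)"
    using le by (intro LIMSEQ_le_const) auto
  then have "N (u \<ominus> v) = 0"
    using nrm_nonneg[of "u \<ominus> v"] assms by simp
  then show ?thesis using assms by (simp add: nrm_eq_0 eq_if_minus_zero)
qed

lemma limit_commute:
  assumes x: "\<And>i. x i \<in> carrier A" and l: "l \<in> carrier A"
    and lim: "(\<lambda>i. N (x i \<ominus> l)) \<longlonglongrightarrow> 0"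
    and w: "w \<in> carrier A" and comm: "\<And>i. w \<otimes> x i = x i \<otimes> w"
  shows "w \<otimes> l = l \<otimes> w"
proof (rule eq_by_limit[where d="\<lambda>i. N (x i \<ominus> l)" and C="2 * N w"])
  fix k
  have "w \<otimes> l \<ominus> l \<otimes> w = (x k \<ominus> l) \<otimes> w \<ominus> w \<otimes> (x k \<ominus> l)"
    by (rule nc_identity_mod[where vs="[x k,l,w]", OF comm[of k]], (rule nc_rules)+)
      (simp_all add: x l w)
  then have "N (w \<otimes> l \<ominus> l \<otimes> w) \<le> N ((x k \<ominus> l) \<otimes> w) + N (w \<otimes> (x k \<ominus> l))"
    using nrm_minus_le[of "(x k \<ominus> l) \<otimes> w" "w \<otimes> (x k \<ominus> l)"] x l w by simp
  also have "\<dots> \<le> N (x k \<ominus> l) * N w + N w * N (x k \<ominus> l)"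
    using x l w by (intro add_mono nrm_mult) simp_all
  also have "\<dots> \<le> 2 * N w * (N (x k \<ominus> l) + N (x (Suc k) \<ominus> l))"
    using x l w nrm_nonneg by (simp add: algebra_simps)
  finally show "N (w \<otimes> l \<ominus> l \<otimes> w) \<le> 2 * N w * (N (x k \<ominus> l) + N (x (Suc k) \<ominus> l))" .
qed (use assms in simp_all)

section \<open>Neumann series\<close>

lemma one_minus_Units:
  assumes z: "z \<in> carrier A" and less: "N z < 1"
  shows "\<one> \<ominus> z \<in> Units A"
proof -
  define q where "q = N z"
  \<comment> \<open>The partial sums of the Neumann series, written as the orbit of \<open>s \<mapsto> 1 + z s\<close>.\<close>
  define s where "s = rec_nat \<zero> (\<lambda>_ s. \<one> \<oplus> z \<otimes> s)"
  have s0: "s 0 = \<zero>" and sS: "s (Suc k) = \<one> \<oplus> z \<otimes> s k" for k by (simp_all add: s_def)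
  have s: "s k \<in> carrier A" for k by (induction k) (simp_all add: s0 sS z)
  have comm: "z \<otimes> s k = s k \<otimes> z" for k
  proof (induction k)
    case (Suc k)
    show ?case unfolding sS
      by (rule nc_identity_mod[where vs="[z, s k]", OF arg_cong[OF Suc, of "\<lambda>u. z \<otimes> u"]],
          (rule nc_rules)+) (simp_all add: z s)
  qed (simp add: s0 z)
  have q: "0 \<le> q" "q < 1" using less nrm_nonneg[OF z] by (simp_all add: q_def)
  have "N (s (Suc k) \<ominus> s k) \<le> q ^ k" for k
  proof (induction k)
    case 0
    then show ?case using z nrm_one_le by (simp add: s0 sS a_minus_def)
  next
    case (Suc k)
    have "s (Suc (Suc k)) \<ominus> s (Suc k) = z \<otimes> (s (Suc k) \<ominus> s k)"
      unfolding sS by (rule nc_identity[where vs="[z, s k]"], (rule nc_rules)+)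
        (simp_all add: s z)
    then have "N (s (Suc (Suc k)) \<ominus> s (Suc k)) \<le> q * N (s (Suc k) \<ominus> s k)"
      using nrm_mult[of z "s (Suc k) \<ominus> s k"] s z by (simp add: q_def)
    also have "\<dots> \<le> q * q ^ k" using Suc q by (intro mult_left_mono) simp_all
    finally show ?case by simp
  qed
  then have "\<exists>l\<in>carrier A. (\<lambda>i. N (s i \<ominus> l)) \<longlonglongrightarrow> 0"
  proof (intro limit_exists[where t="\<lambda>k. \<Sum>i<k. q ^ i"] s)
    show "convergent (\<lambda>k. \<Sum>i<k. q ^ i)"
      using q summable_geometric[of q] by (simp add: summable_iff_convergent)
  qed simp
  then obtain l where l: "l \<in> carrier A" and lim: "(\<lambda>i. N (s i \<ominus> l)) \<longlonglongrightarrow> 0" by blast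
  have lz: "z \<otimes> l = l \<otimes> z" by (rule limit_commute[OF s l lim z comm])
  have fixpoint: "l = \<one> \<oplus> z \<otimes> l"
  proof (rule eq_by_limit[where d="\<lambda>i. N (s i \<ominus> l)" and C="1"])
    fix k
    have "l \<ominus> (\<one> \<oplus> z \<otimes> l) = z \<otimes> (s k \<ominus> l) \<ominus> (s (Suc k) \<ominus> l)"
      unfolding sS by (rule nc_identity[where vs="[z, s k, l]"], (rule nc_rules)+)
        (simp_all add: s z l)
    then have "N (l \<ominus> (\<one> \<oplus> z \<otimes> l)) \<le> N (z \<otimes> (s k \<ominus> l)) + N (s (Suc k) \<ominus> l)"
      using nrm_minus_le s z l by simp
    also have "N (z \<otimes> (s k \<ominus> l)) \<le> 1 * N (s k \<ominus> l)"
      using nrm_mult[of z "s k \<ominus> l"] s z l q nrm_nonneg[of "s k \<ominus> l"]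
        mult_right_mono[of q 1 "N (s k \<ominus> l)"] by (simp add: q_def)
    finally show "N (l \<ominus> (\<one> \<oplus> z \<otimes> l)) \<le> 1 * (N (s k \<ominus> l) + N (s (Suc k) \<ominus> l))"
      by simp
  qed (use l z lim in simp_all)
  have "(\<one> \<ominus> z) \<otimes> l = \<one>"
    by (rule nc_identity_mod[where vs="[z, l]", OF fixpoint], (rule nc_rules)+) (simp_all add: z l)
  moreover have "l \<otimes> (\<one> \<ominus> z) = (\<one> \<ominus> z) \<otimes> l"
    by (rule nc_identity_mod[where vs="[z, l]", OF lz], (rule nc_rules)+)
      (simp_all add: z l)
  ultimately show ?thesis using l z unfolding Units_def by auto
qed

section \<open>Square roots\<close>

text \<open>
  The Riesz-Nagy iteration: a fixed point of \<open>y \<mapsto> (z + y\<^sup>2)/2\<close> satisfies \<open>(1 - y)\<^sup>2 = 1 - z\<close>. The iterates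
  commute with each other, so
  \<open>y\<^sub>k\<^sub>+\<^sub>2 - y\<^sub>k\<^sub>+\<^sub>1 = (y\<^sub>k\<^sub>+\<^sub>1 - y\<^sub>k)(y\<^sub>k\<^sub>+\<^sub>1 + y\<^sub>k)/2\<close>, and by induction the increments are
  bounded in norm by those of the scalar sequence \<open>t\<close> that starts at \<open>0\<close> and iterates
  \<open>t \<mapsto> (1 + t\<^sup>2)/2\<close>. That sequence is increasing and bounded by \<open>1\<close>, hence convergent.
\<close>

lemma sqrt_iteration:
  assumes z: "z \<in> carrier A" and sa: "adj A z = z" and le: "N z \<le> 1"
  shows "\<exists>y\<in>carrier A. adj A y = y \<and> N y \<le> 1 \<and> y = (1/2) \<odot> (z \<oplus> y \<otimes> y) \<and>
    (\<forall>w\<in>carrier A. w \<otimes> z = z \<otimes> w \<longrightarrow> w \<otimes> y = y \<otimes> w)"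
proof -
  define y where "y = rec_nat \<zero> (\<lambda>_ y. (1/2) \<odot> (z \<oplus> y \<otimes> y))"
  define t where "t = rec_nat (0::real) (\<lambda>_ t. (1 + t\<^sup>2) / 2)"
  have y0: "y 0 = \<zero>" and yS: "y (Suc k) = (1/2) \<odot> (z \<oplus> y k \<otimes> y k)" for k
    by (simp_all add: y_def)
  have t0: "t 0 = 0" and tS: "t (Suc k) = (1 + (t k)\<^sup>2) / 2" for k by (simp_all add: t_def)
  have y: "y k \<in> carrier A" for k by (induction k) (simp_all add: y0 yS z)
  have y_sa: "adj A (y k) = y k" for k
    by (induction k) (simp_all add: y0 yS z y adj_simps sa)
  have comm: "w \<otimes> y k = y k \<otimes> w" if w: "w \<in> carrier A" "w \<otimes> z = z \<otimes> w" for w k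
  proof (induction k)
    case (Suc k)
    have "w \<otimes> (y k \<otimes> y k) = (y k \<otimes> y k) \<otimes> w"
      using Suc w y by (metis m_assoc)
    then show ?case using w y z
      by (simp add: yS smult_mult_left smult_mult_right l_distr r_distr)
  qed (use w in \<open>simp add: y0\<close>)
  have t1: "0 \<le> t k \<and> t k \<le> 1" for k
  proof (induction k)
    case (Suc k)
    then have "(t k)\<^sup>2 \<le> 1" by (simp add: power_le_one)
    then show ?case by (simp add: tS)
  qed (simp add: t0)
  have y_le: "N (y k) \<le> t k" for k
  proof (induction k)
    case (Suc k)
    have "N (y (Suc k)) \<le> (N z + N (y k \<otimes> y k)) / 2"
      using nrm_triangle[of z "y k \<otimes> y k"] y z by (simp add: yS nrm_smult)
    also have "\<dots> \<le> (1 + (t k)\<^sup>2) / 2"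
      using le nrm_mult[OF y y, of k k] power_mono[OF Suc nrm_nonneg[OF y], of 2]
      by (simp add: power2_eq_square)
    finally show ?case by (simp add: tS)
  qed (simp add: y0 t0)
  have step: "N (y (Suc k) \<ominus> y k) \<le> t (Suc k) - t k" for k
  proof (induction k)
    case 0
    then show ?case using le z by (simp add: y0 yS t0 tS a_minus_def nrm_smult)
  next
    case (Suc k)
    have c: "y (Suc k) \<otimes> y k = y k \<otimes> y (Suc k)"
      using comm[OF y, of "Suc k" k] comm[OF z, of "Suc k"] by simp
    have "(1/2) \<odot> (z \<oplus> y (Suc k) \<otimes> y (Suc k)) \<ominus> (1/2) \<odot> (z \<oplus> y k \<otimes> y k)
      = (1/2) \<odot> ((y (Suc k) \<ominus> y k) \<otimes> (y (Suc k) \<oplus> y k))"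
      by (rule nc_identity_mod[where vs="[z, y k, y (Suc k)]", OF arg_cong[OF c, of "\<lambda>u. (-1/2) \<odot> u"]],
          (rule nc_rules)+) (simp_all add: z y)
    then have "N (y (Suc (Suc k)) \<ominus> y (Suc k))
      = N ((y (Suc k) \<ominus> y k) \<otimes> (y (Suc k) \<oplus> y k)) / 2"
      using y by (simp add: yS[symmetric] nrm_smult)
    also have "\<dots> \<le> (N (y (Suc k) \<ominus> y k) * N (y (Suc k) \<oplus> y k)) / 2"
      using nrm_mult y by simp
    also have "\<dots> \<le> ((t (Suc k) - t k) * (t (Suc k) + t k)) / 2"
    proof -
      have "N (y (Suc k) \<oplus> y k) \<le> t (Suc k) + t k"
        using nrm_triangle[OF y y, of "Suc k" k] y_le[of k] y_le[of "Suc k"] by simp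
      then show ?thesis using Suc nrm_nonneg y by (intro divide_right_mono mult_mono') simp_all
    qed
    also have "\<dots> = t (Suc (Suc k)) - t (Suc k)"
      by (simp add: tS[of "Suc k"] tS[of k] power2_eq_square algebra_simps add_divide_distrib diff_divide_distrib)
    finally show ?case .
  qed
  have conv: "convergent t"
  proof (rule Bseq_mono_convergent)
    show "Bseq t" by (rule BseqI'[where K=1]) (use t1 in simp)
    have "t k \<le> t (Suc k)" for k
      using step[of k] nrm_nonneg[of "y (Suc k) \<ominus> y k"] y by simp
    then show "\<forall>m n. m \<le> n \<longrightarrow> t m \<le> t n" using lift_Suc_mono_le by blast
  qed
  obtain l where l: "l \<in> carrier A" and lim: "(\<lambda>i. N (y i \<ominus> l)) \<longlonglongrightarrow> 0"
    using limit_exists[OF y step conv] by blast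
  have fixpoint: "l = (1/2) \<odot> (z \<oplus> l \<otimes> l)"
  proof (rule eq_by_limit[where d="\<lambda>i. N (y i \<ominus> l)" and C="1 + N l"])
    fix k
    have "l \<ominus> (1/2) \<odot> (z \<oplus> l \<otimes> l)
      = (1/2) \<odot> ((y k \<ominus> l) \<otimes> y k \<oplus> l \<otimes> (y k \<ominus> l)) \<ominus> (y (Suc k) \<ominus> l)"
      unfolding yS by (rule nc_identity[where vs="[z, y k, l]"], (rule nc_rules)+)
        (simp_all add: z y l)
    then have "N (l \<ominus> (1/2) \<odot> (z \<oplus> l \<otimes> l))
      \<le> N ((1/2) \<odot> ((y k \<ominus> l) \<otimes> y k \<oplus> l \<otimes> (y k \<ominus> l))) + N (y (Suc k) \<ominus> l)"
      using nrm_minus_le y z l by simp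
    also have "N ((1/2) \<odot> ((y k \<ominus> l) \<otimes> y k \<oplus> l \<otimes> (y k \<ominus> l)))
      \<le> (N ((y k \<ominus> l) \<otimes> y k) + N (l \<otimes> (y k \<ominus> l))) / 2"
      using nrm_triangle[of "(y k \<ominus> l) \<otimes> y k" "l \<otimes> (y k \<ominus> l)"] y l by (simp add: nrm_smult)
    also have "\<dots> \<le> (N (y k \<ominus> l) * 1 + N l * N (y k \<ominus> l)) / 2"
    proof -
      have "N ((y k \<ominus> l) \<otimes> y k) \<le> N (y k \<ominus> l) * N (y k)"
        using nrm_mult y l by simp
      also have "\<dots> \<le> N (y k \<ominus> l) * 1"
        using y_le[of k] t1[of k] nrm_nonneg y l by (intro mult_left_mono) auto
      finally show ?thesis using nrm_mult[of l "y k \<ominus> l"] y l by simp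
    qed
    also have "\<dots> + N (y (Suc k) \<ominus> l)
       \<le> (1 + N l) * (N (y k \<ominus> l) + N (y (Suc k) \<ominus> l))"
    proof -
      have "0 \<le> N l * N (y k \<ominus> l)" "0 \<le> N l * N (y (Suc k) \<ominus> l)"
        "0 \<le> N (y k \<ominus> l)"
        using nrm_nonneg y l by simp_all
      then show ?thesis by (simp add: algebra_simps)
    qed
    finally show "N (l \<ominus> (1/2) \<odot> (z \<oplus> l \<otimes> l))
      \<le> (1 + N l) * (N (y k \<ominus> l) + N (y (Suc k) \<ominus> l))" by simp
  qed (use l z lim in simp_all)
  have "adj A l = l"
  proof (rule eq_by_limit[where d="\<lambda>i. N (y i \<ominus> l)" and C="2"])
    fix k
    have "adj A l \<ominus> l = (y k \<ominus> l) \<ominus> adj A (y k \<ominus> l)"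
      unfolding adj_minus[OF y l] y_sa
      by (rule nc_identity[where vs="[y k, l, adj A l]"], (rule nc_rules)+)
        (simp_all add: y l adj_closed)
    then have "N (adj A l \<ominus> l) \<le> 2 * N (y k \<ominus> l)"
      using nrm_minus_le[of "y k \<ominus> l" "adj A (y k \<ominus> l)"] y l by (simp add: adj_closed)
    then show "N (adj A l \<ominus> l) \<le> 2 * (N (y k \<ominus> l) + N (y (Suc k) \<ominus> l))"
      using nrm_nonneg[of "y (Suc k) \<ominus> l"] y l by simp
  qed (use l lim in \<open>simp_all add: adj_closed\<close>)
  moreover have "N l \<le> 1"
  proof -
    have "(\<lambda>k. 1 + N (y k \<ominus> l)) \<longlonglongrightarrow> 1 + 0" by (intro tendsto_intros lim)
    moreover have "N l \<le> 1 + N (y k \<ominus> l)" for k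
    proof -
      have "l = y k \<ominus> (y k \<ominus> l)"
        by (rule nc_identity[where vs="[y k, l]"], (rule nc_rules)+) (simp_all add: y l)
      then have "N l \<le> N (y k) + N (y k \<ominus> l)"
        using nrm_minus_le[of "y k" "y k \<ominus> l"] y l by simp
      then show ?thesis using y_le[of k] t1[of k] by simp
    qed
    ultimately have "N l \<le> 1 + 0" by (intro LIMSEQ_le_const) auto
    then show ?thesis by simp
  qed
  moreover have "w \<otimes> l = l \<otimes> w" if "w \<in> carrier A" "w \<otimes> z = z \<otimes> w" for w
    by (rule limit_commute[OF y l lim that(1) comm[OF that]])
  ultimately show ?thesis using l fixpoint by blast
qed

section \<open>Positivity measured by the norm\<close>

text \<open>
  In the commutative picture: \<open>a\<close> takes values in the ball of radius \<open>t\<close> around \<open>t\<close>, so in the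
  nonnegative reals. The condition then also holds for every larger \<open>t\<close>.
\<close>

definition npos :: "'a \<Rightarrow> bool" where
  "npos a \<longleftrightarrow> a \<in> carrier A \<and> adj A a = a \<and> (\<exists>t. N (rsc t \<ominus> a) \<le> t)"

lemma npos_closed [simp]: "npos a \<Longrightarrow> a \<in> carrier A"
  and npos_sa: "npos a \<Longrightarrow> adj A a = a"
  by (simp_all add: npos_def)

lemma npos_add:
  assumes "npos a" "npos b"
  shows "npos (a \<oplus> b)"
proof -
  have ab: "a \<in> carrier A" "b \<in> carrier A" "adj A a = a" "adj A b = b"
    using assms by (simp_all add: npos_def)
  obtain s t where st: "N (rsc s \<ominus> a) \<le> s" "N (rsc t \<ominus> b) \<le> t"
    using assms by (auto simp: npos_def)
  have "rsc (s + t) \<ominus> (a \<oplus> b) = (rsc s \<ominus> a) \<oplus> (rsc t \<ominus> b)"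
    by (rule nc_identity[where vs="[a, b]"], (rule nc_rules)+) (simp_all add: ab)
  then have "N (rsc (s + t) \<ominus> (a \<oplus> b)) \<le> s + t"
    using nrm_triangle[of "rsc s \<ominus> a" "rsc t \<ominus> b"] st ab by simp
  then have "\<exists>t. N (rsc t \<ominus> (a \<oplus> b)) \<le> t" by (rule exI)
  then show ?thesis using ab by (simp add: npos_def adj_add)
qed

lemma npos_smult:
  assumes "npos a" "0 \<le> c"
  shows "npos (complex_of_real c \<odot> a)"
proof -
  have a: "a \<in> carrier A" "adj A a = a" using assms by (simp_all add: npos_def)
  obtain t where t: "N (rsc t \<ominus> a) \<le> t" using assms by (auto simp: npos_def)
  have "rsc (c * t) \<ominus> complex_of_real c \<odot> a = complex_of_real c \<odot> (rsc t \<ominus> a)"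
    by (rule nc_identity[where vs="[a]"], (rule nc_rules)+) (simp_all add: a)
  then have "N (rsc (c * t) \<ominus> complex_of_real c \<odot> a) \<le> c * t"
    using t a assms(2) by (simp add: nrm_smult mult_left_mono)
  then have "\<exists>t. N (rsc t \<ominus> complex_of_real c \<odot> a) \<le> t" by (rule exI)
  then show ?thesis using a by (simp add: npos_def adj_smult)
qed

lemma npos_rsc_minus:
  assumes "a \<in> carrier A" "adj A a = a" "N a \<le> t"
  shows "npos (rsc t \<ominus> a)"
proof -
  have "rsc t \<ominus> (rsc t \<ominus> a) = a"
    by (rule nc_identity[where vs="[a]"], (rule nc_rules)+) (simp_all add: assms)
  then have "N (rsc t \<ominus> (rsc t \<ominus> a)) \<le> t" using assms by simp
  then show ?thesis using assms unfolding npos_def by (auto simp: adj_minus)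
qed

lemma npos_zero [simp]: "npos \<zero>"
  unfolding npos_def by (auto simp: a_minus_def intro: exI[of _ 0])

text \<open>
  \<open>a = t(1 - z)\<close> with \<open>\<parallel>z\<parallel> \<le> 1\<close>, so the root is \<open>\<surd>t (1 - y)\<close> with \<open>y\<close> from the iteration; \<open>\<parallel>y\<parallel> \<le> 1\<close> says that
  the root is again \<open>npos\<close>. It is a limit of polynomials in \<open>a\<close>, hence commutes with whatever commutes
  with \<open>a\<close>.
\<close>

lemma npos_sqrt:
  assumes "npos a"
  shows "\<exists>s. npos s \<and> s \<otimes> s = a \<and> (\<forall>w\<in>carrier A. w \<otimes> a = a \<otimes> w \<longrightarrow> w \<otimes> s = s \<otimes> w)"
proof -
  have a: "a \<in> carrier A" "adj A a = a" using assms by (simp_all add: npos_def)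
  obtain t where t: "N (rsc t \<ominus> a) \<le> t" using assms by (auto simp: npos_def)
  have t0: "0 \<le> t" using t nrm_nonneg[of "rsc t \<ominus> a"] a by simp
  show ?thesis
  proof (cases "t = 0")
    case True
    then have "N (\<zero> \<ominus> a) = 0" using t nrm_nonneg[of "\<zero> \<ominus> a"] a by simp
    then have "a = \<zero>" using a eq_if_minus_zero[of \<zero> a] by (simp add: nrm_eq_0)
    then show ?thesis by (intro exI[of _ \<zero>]) simp
  next
    case False
    define z where "z = complex_of_real (1 / t) \<odot> (rsc t \<ominus> a)"
    have z: "z \<in> carrier A" "adj A z = z" using a by (simp_all add: z_def adj_smult adj_minus)
    have "N z \<le> 1" using t t0 False a by (simp add: z_def nrm_smult norm_divide divide_simps)
    then obtain y where y: "y \<in> carrier A" "adj A y = y" "N y \<le> 1"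
      and fixpoint: "y = (1/2) \<odot> (z \<oplus> y \<otimes> y)"
      and comm: "\<forall>w\<in>carrier A. w \<otimes> z = z \<otimes> w \<longrightarrow> w \<otimes> y = y \<otimes> w"
      using sqrt_iteration[OF z] by blast
    define s where "s = complex_of_real (sqrt t) \<odot> (\<one> \<ominus> y)"
    have s: "s \<in> carrier A" "adj A s = s"
      using y by (simp_all add: s_def adj_smult adj_minus)
    have "rsc (sqrt t) \<ominus> s = complex_of_real (sqrt t) \<odot> y" unfolding s_def
      by (rule nc_identity[where vs="[y]"], (rule nc_rules)+) (simp_all add: y)
    then have "N (rsc (sqrt t) \<ominus> s) \<le> sqrt t"
      using y t0 by (simp add: nrm_smult mult_left_le)
    then have "npos s" using s by (auto simp: npos_def)
    moreover have "s \<otimes> s = a"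
    proof -
      have "s \<otimes> s = complex_of_real t \<odot> ((\<one> \<ominus> y) \<otimes> (\<one> \<ominus> y))"
        using y t0 by (simp add: s_def smult_mult_left smult_mult_right smult_smult
            flip: of_real_mult)
      also have "(\<one> \<ominus> y) \<otimes> (\<one> \<ominus> y) = \<one> \<ominus> z"
        by (rule nc_identity_mod[where vs="[y, z]", OF arg_cong[OF fixpoint, of "\<lambda>u. (-2) \<odot> u"]],
            (rule nc_rules)+) (simp_all add: y z)
      also have "complex_of_real t \<odot> (\<one> \<ominus> z) = a"
      proof -
        have tz: "complex_of_real t \<odot> z = rsc t \<ominus> a"
          using a False by (simp add: z_def smult_smult)
        show ?thesis
          by (rule nc_identity_mod[where vs="[a, z]", OF arg_cong[OF tz, of "\<lambda>u. (-1) \<odot> u"]],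
              (rule nc_rules)+) (simp_all add: a z)
      qed
      finally show ?thesis .
    qed
    moreover have "w \<otimes> s = s \<otimes> w" if w: "w \<in> carrier A" "w \<otimes> a = a \<otimes> w" for w
    proof -
      have "w \<otimes> z = z \<otimes> w" unfolding z_def
        by (rule nc_identity_mod[where vs="[a, w]",
              OF arg_cong[OF w(2), of "\<lambda>u. complex_of_real (- (1 / t)) \<odot> u"]],
            (rule nc_rules)+) (simp_all add: a w)
      then have wy: "w \<otimes> y = y \<otimes> w" using comm w by blast
      show ?thesis unfolding s_def
        by (rule nc_identity_mod[where vs="[y, w]",
              OF arg_cong[OF wy, of "\<lambda>u. complex_of_real (- sqrt t) \<odot> u"]],
            (rule nc_rules)+) (simp_all add: y w)
    qed
    ultimately show ?thesis by blast
  qed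
qed

text \<open>
  For \<open>u = h + is\<close> the hypotheses give \<open>u\<^sup>* u = T\<close>, hence \<open>\<parallel>u\<parallel>\<^sup>2 \<le> \<bar>T\<bar>\<close>, and \<open>h\<close> is the mean of \<open>u\<close> and \<open>u\<^sup>*\<close>.
\<close>

lemma nrm_of_square_sum:
  assumes h: "h \<in> carrier A" "adj A h = h" and s: "s \<in> carrier A" "adj A s = s"
    and comm: "h \<otimes> s = s \<otimes> h" and sum: "h \<otimes> h \<oplus> s \<otimes> s = rsc T"
  shows "(N h)\<^sup>2 \<le> \<bar>T\<bar>"
proof -
  define u where "u = h \<oplus> \<i> \<odot> s"
  have u: "u \<in> carrier A" using h s by (simp add: u_def)
  have adj_u: "adj A u = h \<oplus> (- \<i>) \<odot> s" using h s by (simp add: u_def adj_add adj_smult)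
  have "adj A u \<otimes> u = h \<otimes> h \<oplus> s \<otimes> s" unfolding adj_u unfolding u_def
    by (rule nc_identity_mod[where vs="[h, s]", OF arg_cong[OF comm, of "\<lambda>u. \<i> \<odot> u"]],
        (rule nc_rules)+) (simp_all add: h s)
  then have "(N u)\<^sup>2 \<le> \<bar>T\<bar>"
    using cstar_identity[OF u] nrm_smult_one_le[of "complex_of_real T"] sum by simp
  moreover have "N h \<le> N u"
  proof -
    have "h = (1/2) \<odot> (u \<oplus> adj A u)" unfolding adj_u unfolding u_def
      by (rule nc_identity[where vs="[h, s]"], (rule nc_rules)+) (simp_all add: h s)
    then have "N h = N ((1/2) \<odot> (u \<oplus> adj A u))" by (rule arg_cong)
    also have "\<dots> = N (u \<oplus> adj A u) / 2" using u by (simp add: nrm_smult adj_closed)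
    finally have "N h = N (u \<oplus> adj A u) / 2" .
    then show ?thesis using nrm_triangle[of u "adj A u"] u by (simp add: adj_closed)
  qed
  then have "(N h)\<^sup>2 \<le> (N u)\<^sup>2" using nrm_nonneg[of h] h by (intro power_mono)
  ultimately show ?thesis by linarith
qed

text \<open>
  Let \<open>T = \<parallel>h\<parallel>\<^sup>2\<close> and let \<open>q\<close> be a root of \<open>T - h\<^sup>2\<close> that commutes with \<open>h\<close>. Then \<open>q\<^sup>2 + h\<^sup>2 = T\<close>, so
  \<open>\<parallel>T - h\<^sup>2\<parallel> = \<parallel>q\<parallel>\<^sup>2 \<le> T\<close>.
\<close>

lemma npos_square:
  assumes h: "h \<in> carrier A" "adj A h = h"
  shows "npos (h \<otimes> h)"
proof -
  define T where "T = (N h)\<^sup>2"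
  have T0: "0 \<le> T" by (simp add: T_def)
  have hh: "h \<otimes> h \<in> carrier A" "adj A (h \<otimes> h) = h \<otimes> h" using h by (simp_all add: adj_mult)
  define a where "a = rsc T \<ominus> h \<otimes> h"
  have "npos a" unfolding a_def
    by (rule npos_rsc_minus) (use h hh in \<open>simp_all add: T_def nrm_square_sa\<close>)
  moreover have "h \<otimes> a = a \<otimes> h" unfolding a_def
    by (rule nc_identity[where vs="[h]"], (rule nc_rules)+) (simp_all add: h)
  ultimately obtain q where q: "npos q" "q \<otimes> q = a" "h \<otimes> q = q \<otimes> h"
    using npos_sqrt[of a] h(1) by blast
  have "q \<otimes> q \<oplus> h \<otimes> h = rsc T" unfolding q(2) a_def
    by (rule nc_identity[where vs="[h]"], (rule nc_rules)+) (simp_all add: h)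
  then have "(N q)\<^sup>2 \<le> \<bar>T\<bar>"
    by (intro nrm_of_square_sum[of q h]) (use q h in \<open>simp_all add: npos_sa\<close>)
  then have "N (rsc T \<ominus> h \<otimes> h) \<le> T"
    using nrm_square_sa[of q] q T0 by (simp add: npos_sa a_def[symmetric])
  then show ?thesis using hh by (auto simp: npos_def)
qed

text \<open>
  Norm estimate from order bounds: if \<open>a = h\<^sup>2\<close> and \<open>T - a = q\<^sup>2\<close> with commuting roots, then \<open>h\<^sup>2 + q\<^sup>2 = T\<close>.
\<close>

lemma npos_nrm_le:
  assumes a: "npos a" and Ta: "npos (rsc T \<ominus> a)"
  shows "N a \<le> \<bar>T\<bar>"
proof -
  obtain h where h: "npos h" "h \<otimes> h = a" using npos_sqrt[OF a] by blast
  have "h \<otimes> (rsc T \<ominus> a) = (rsc T \<ominus> a) \<otimes> h" unfolding h(2)[symmetric]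
    by (rule nc_identity[where vs="[h]"], (rule nc_rules)+) (simp_all add: h)
  then obtain q where q: "npos q" "q \<otimes> q = rsc T \<ominus> a" "h \<otimes> q = q \<otimes> h"
    using npos_sqrt[OF Ta] npos_closed[OF h(1)] by blast
  have "h \<otimes> h \<oplus> q \<otimes> q = rsc T" unfolding q(2) h(2)
    by (rule nc_identity[where vs="[a]"], (rule nc_rules)+) (simp_all add: a)
  then have "(N h)\<^sup>2 \<le> \<bar>T\<bar>"
    by (intro nrm_of_square_sum[of h q]) (use q h in \<open>simp_all add: npos_sa\<close>)
  then show ?thesis using nrm_square_sa[of h] h by (simp add: npos_sa)
qed

lemma npos_antisym:
  assumes a: "npos a" and ma: "npos (\<ominus> a)"
  shows "a = \<zero>"
proof -
  have "N a \<le> \<bar>0\<bar>"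
    using ma a by (intro npos_nrm_le) (simp_all add: a_minus_def)
  then show ?thesis using nrm_nonneg[of a] a nrm_eq_0[of a] by simp
qed

section \<open>Invertibility and the spectrum\<close>

lemma Units_smult:
  assumes "x \<in> Units A" "c \<noteq> 0"
  shows "c \<odot> x \<in> Units A"
proof -
  obtain y where "x \<in> carrier A" "y \<in> carrier A" "y \<otimes> x = \<one>" "x \<otimes> y = \<one>"
    using assms(1) by (auto simp: Units_def)
  then have "(inverse c \<odot> y) \<otimes> (c \<odot> x) = \<one>" "(c \<odot> x) \<otimes> (inverse c \<odot> y) = \<one>"
    "c \<odot> x \<in> carrier A" "inverse c \<odot> y \<in> carrier A"
    using assms(2) by (simp_all add: smult_mult_left smult_mult_right smult_smult)
  then show ?thesis by (auto simp: Units_def)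
qed

lemma Units_factor:
  assumes xy: "x \<otimes> y \<in> Units A" and "x \<in> carrier A" "y \<in> carrier A" "x \<otimes> y = y \<otimes> x"
  shows "x \<in> Units A"
proof -
  obtain v where v: "v \<in> carrier A" "v \<otimes> (x \<otimes> y) = \<one>" "(x \<otimes> y) \<otimes> v = \<one>"
    using xy by (auto simp: Units_def)
  have r: "x \<otimes> (y \<otimes> v) = \<one>" using v assms(2,3) by (simp add: m_assoc)
  have l: "(v \<otimes> y) \<otimes> x = \<one>" using v assms by (simp add: m_assoc)
  have "y \<otimes> v = ((v \<otimes> y) \<otimes> x) \<otimes> (y \<otimes> v)" using l v assms by simp
  also have "\<dots> = (v \<otimes> y) \<otimes> (x \<otimes> (y \<otimes> v))" using v assms(2,3) by (simp add: m_assoc)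
  also have "\<dots> = v \<otimes> y" using r v assms by simp
  finally show ?thesis using r l v assms unfolding Units_def by auto
qed

lemma rsc_minus_Units:
  assumes a: "a \<in> carrier A" and less: "N a < t"
  shows "rsc t \<ominus> a \<in> Units A"
proof -
  have t: "0 < t" using less nrm_nonneg[OF a] by simp
  have "N (complex_of_real (1 / t) \<odot> a) < 1"
    using t less a by (simp add: nrm_smult norm_divide)
  then have "complex_of_real t \<odot> (\<one> \<ominus> complex_of_real (1 / t) \<odot> a) \<in> Units A"
    using t a by (intro Units_smult one_minus_Units) simp_all
  moreover have "complex_of_real t \<odot> (\<one> \<ominus> complex_of_real (1 / t) \<odot> a) = rsc t \<ominus> a"
    by (rule nc_identity[where vs="[a]"], (rule nc_rules)+) (use t in \<open>simp_all add: a\<close>)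
  ultimately show ?thesis by simp
qed

lemma npos_plus_rsc_Units:
  assumes "npos a" "0 < e"
  shows "rsc e \<oplus> a \<in> Units A"
proof -
  have a: "a \<in> carrier A" using assms by simp
  obtain t where t: "N (rsc t \<ominus> a) \<le> t" using assms by (auto simp: npos_def)
  have "rsc (t + e) \<ominus> (rsc t \<ominus> a) \<in> Units A"
    using t assms(2) a by (intro rsc_minus_Units) simp_all
  moreover have "rsc (t + e) \<ominus> (rsc t \<ominus> a) = rsc e \<oplus> a"
    by (rule nc_identity[where vs="[a]"], (rule nc_rules)+) (simp_all add: a)
  ultimately show ?thesis by simp
qed

text \<open>
  For \<open>c\<close> outside the nonnegative reals \<open>c - a\<close> is invertible: if \<open>c < 0\<close>, because \<open>\<bar>c\<bar> + a\<close> is; if \<open>c\<close> is not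
  real, because it divides \<open>(c - a)(c\<^sup>* - a) = (Im c)\<^sup>2 + (Re c - a)\<^sup>2\<close>, where \<open>c\<^sup>*\<close> is the conjugate.
\<close>

lemma npos_imp_positive_elt:
  assumes a: "npos a"
  shows "positive_elt A a"
proof -
  have ac: "a \<in> carrier A" using a by simp
  have "c \<odot> \<one> \<ominus> a \<in> Units A" if c: "c \<notin> \<real>\<^sub>\<ge>\<^sub>0" for c
  proof (cases "Im c = 0")
    case True
    then have "0 < - Re c" using c by (simp add: complex_nonneg_Reals_iff)
    then have "(-1) \<odot> (rsc (- Re c) \<oplus> a) \<in> Units A"
      by (intro Units_smult npos_plus_rsc_Units a) simp_all
    also have "(-1) \<odot> (rsc (- Re c) \<oplus> a) = c \<odot> \<one> \<ominus> a"
      by (rule nc_identity[where vs="[a]"], (rule nc_rules)+)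
        (use True in \<open>simp_all add: ac complex_eq_iff\<close>)
    finally show ?thesis .
  next
    case False
    define m where "m = rsc (Re c) \<ominus> a"
    have m: "m \<in> carrier A" "adj A m = m" using a by (simp_all add: m_def adj_minus npos_sa)
    have "rsc ((Im c)\<^sup>2) \<oplus> m \<otimes> m = (c \<odot> \<one> \<ominus> a) \<otimes> (cnj c \<odot> \<one> \<ominus> a)"
      unfolding m_def by (rule nc_identity[where vs="[a]"], (rule nc_rules)+)
        (simp_all add: ac complex_eq_iff power2_eq_square)
    moreover have "rsc ((Im c)\<^sup>2) \<oplus> m \<otimes> m \<in> Units A"
      using False m by (intro npos_plus_rsc_Units npos_square) simp_all
    ultimately have u: "(c \<odot> \<one> \<ominus> a) \<otimes> (cnj c \<odot> \<one> \<ominus> a) \<in> Units A" by simp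
    have comm: "(c \<odot> \<one> \<ominus> a) \<otimes> (cnj c \<odot> \<one> \<ominus> a) = (cnj c \<odot> \<one> \<ominus> a) \<otimes> (c \<odot> \<one> \<ominus> a)"
      by (rule nc_identity[where vs="[a]"], (rule nc_rules)+)
        (simp_all add: ac algebra_simps)
    show ?thesis by (rule Units_factor[OF u _ _ comm]) (use ac in simp_all)
  qed
  then have "spectrum_of A a \<subseteq> \<real>\<^sub>\<ge>\<^sub>0" unfolding spectrum_of_def by blast
  then show ?thesis using a by (simp add: positive_elt_def npos_sa)
qed

text \<open>
  One of \<open>\<plusminus>r\<close> lies in the spectrum of \<open>b\<close>; this takes the place of the spectral radius formula.
  Otherwise \<open>g = r\<^sup>2 - b\<^sup>2\<close> is invertible. Since \<open>g = q\<^sup>2\<close> and \<open>K - g\<^sup>-\<^sup>1 = p\<^sup>2\<close> for large \<open>K\<close>, with \<open>p\<close> and \<open>q\<close>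
  commuting, \<open>K g - 1 = (p q)\<^sup>2\<close> is \<open>npos\<close>. Hence so is \<open>(r\<^sup>2 - 1/K) - b\<^sup>2\<close>, and
  \<open>r\<^sup>2 = \<parallel>b\<^sup>2\<parallel> \<le> r\<^sup>2 - 1/K\<close>, a contradiction.
\<close>

lemma nrm_in_spectrum:
  assumes b: "b \<in> carrier A" "adj A b = b" and r: "N b = r" "0 < r"
  shows "rsc r \<ominus> b \<notin> Units A \<or> rsc r \<oplus> b \<notin> Units A"
proof (rule ccontr)
  assume "\<not> ?thesis"
  then have "(rsc r \<ominus> b) \<otimes> (rsc r \<oplus> b) \<in> Units A" by simp
  moreover have "(rsc r \<ominus> b) \<otimes> (rsc r \<oplus> b) = rsc (r\<^sup>2) \<ominus> b \<otimes> b"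
    by (rule nc_identity[where vs="[b]"], (rule nc_rules)+)
      (simp_all add: b power2_eq_square)
  ultimately have gU: "rsc (r\<^sup>2) \<ominus> b \<otimes> b \<in> Units A" by simp
  define g where "g = rsc (r\<^sup>2) \<ominus> b \<otimes> b"
  have nbb: "N (b \<otimes> b) = r\<^sup>2" using b r by (simp add: nrm_square_sa)
  have "npos g" unfolding g_def
    using b nbb by (intro npos_rsc_minus) (simp_all add: adj_mult)
  then obtain q where q: "npos q" "q \<otimes> q = g" using npos_sqrt by blast
  have qc: "q \<in> carrier A" "adj A q = q" using q by (simp_all add: npos_sa)
  have g: "g \<in> carrier A" "adj A g = g" using \<open>npos g\<close> by (simp_all add: npos_sa)
  obtain v where v: "v \<in> carrier A" "v \<otimes> g = \<one>" "g \<otimes> v = \<one>"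
    using gU unfolding g_def[symmetric] by (auto simp: Units_def)
  have v_sa: "adj A v = v"
  proof -
    have "adj A v \<otimes> g = \<one>" using v g by (metis adj_mult adj_one)
    then have "adj A v \<otimes> g \<otimes> v = v" using v by simp
    then show ?thesis using v g by (simp add: m_assoc adj_closed)
  qed
  have qg: "q \<otimes> g = g \<otimes> q" using qc unfolding q(2)[symmetric] by (simp add: m_assoc)
  have qv: "q \<otimes> v = v \<otimes> q"
  proof -
    have "q \<otimes> v = (v \<otimes> g) \<otimes> q \<otimes> v" using v qc by simp
    also have "\<dots> = v \<otimes> (g \<otimes> q) \<otimes> v" using v(1) qc g by (simp add: m_assoc)
    also have "\<dots> = v \<otimes> (q \<otimes> g) \<otimes> v" using qg by simp
    also have "\<dots> = v \<otimes> q \<otimes> (g \<otimes> v)" using v(1) qc g by (simp add: m_assoc)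
    finally show ?thesis using v qc by simp
  qed
  \<comment> \<open>The second summand ensures \<open>r\<^sup>2 - 1/K \<ge> 0\<close>.\<close>
  define K where "K = N v + 1 / r\<^sup>2"
  have K: "0 < K" "1 / K \<le> r\<^sup>2" "N v \<le> K"
  proof -
    have "1 / r\<^sup>2 \<le> K" using nrm_nonneg[OF v(1)] by (simp add: K_def)
    moreover have "0 < 1 / r\<^sup>2" using r(2) by simp
    ultimately show "0 < K" by linarith
    with \<open>1 / r\<^sup>2 \<le> K\<close> show "1 / K \<le> r\<^sup>2" using r(2) by (simp add: field_simps)
    show "N v \<le> K" by (simp add: K_def)
  qed
  have kv: "q \<otimes> (rsc K \<ominus> v) = (rsc K \<ominus> v) \<otimes> q"
    by (rule nc_identity_mod[where vs="[q, v]", OF arg_cong[OF qv, of "\<lambda>u. (-1) \<odot> u"]],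
        (rule nc_rules)+) (simp_all add: qc v)
  obtain p where p: "npos p" "p \<otimes> p = rsc K \<ominus> v" "q \<otimes> p = p \<otimes> q"
    using npos_sqrt[OF npos_rsc_minus[OF v(1) v_sa K(3)]] kv qc(1) by blast
  have pc: "p \<in> carrier A" "adj A p = p" using p by (simp_all add: npos_sa)
  have "(p \<otimes> q) \<otimes> (p \<otimes> q) = (p \<otimes> p) \<otimes> (q \<otimes> q)"
    by (rule nc_identity_mod[where vs="[p, q]", OF arg_cong[OF p(3), of "\<lambda>u. p \<otimes> u \<otimes> q"]],
        (rule nc_rules)+) (simp_all add: qc pc)
  also have "\<dots> = complex_of_real K \<odot> g \<ominus> v \<otimes> g" unfolding p(2) q(2)
    by (rule nc_identity[where vs="[g, v]"], (rule nc_rules)+) (simp_all add: g v)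
  finally have sq: "(p \<otimes> q) \<otimes> (p \<otimes> q) = complex_of_real K \<odot> g \<ominus> \<one>" using v(2) by simp
  have "npos ((p \<otimes> q) \<otimes> (p \<otimes> q))"
    using pc qc p(3) by (intro npos_square) (simp_all add: adj_mult)
  then have "npos (complex_of_real (1 / K) \<odot> (complex_of_real K \<odot> g \<ominus> \<one>))"
    unfolding sq using K by (intro npos_smult) simp_all
  moreover have "complex_of_real (1 / K) \<odot> (complex_of_real K \<odot> g \<ominus> \<one>)
      = rsc (r\<^sup>2 - 1 / K) \<ominus> b \<otimes> b" unfolding g_def
    by (rule nc_identity[where vs="[b]"], (rule nc_rules)+) (use K in \<open>simp_all add: b\<close>)
  ultimately have "N (b \<otimes> b) \<le> \<bar>r\<^sup>2 - 1 / K\<bar>"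
    using b by (intro npos_nrm_le npos_square) simp_all
  moreover have "0 < 1 / K" using K by simp
  ultimately show False using nbb K by linarith
qed

text \<open>
  Let \<open>t = \<parallel>a\<parallel>\<close>. If \<open>\<parallel>t - a\<parallel> = r > t\<close>, then \<open>r\<close> or \<open>-r\<close> is in the spectrum of \<open>t - a\<close>, that is, \<open>t - r < 0\<close> or
  \<open>t + r > \<parallel>a\<parallel>\<close> is in the spectrum of \<open>a\<close>; neither is possible.
\<close>

lemma positive_elt_imp_npos:
  assumes a: "positive_elt A a"
  shows "npos a"
proof -
  have ac: "a \<in> carrier A" "adj A a = a" and spec: "\<And>c. c \<notin> \<real>\<^sub>\<ge>\<^sub>0 \<Longrightarrow> c \<odot> \<one> \<ominus> a \<in> Units A"
    using a by (auto simp: positive_elt_def spectrum_of_def)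
  define t where "t = N a"
  define b where "b = rsc t \<ominus> a"
  have b: "b \<in> carrier A" "adj A b = b" using ac by (simp_all add: b_def adj_minus)
  have t: "0 \<le> t" using ac nrm_nonneg by (simp add: t_def)
  have "N b \<le> t"
  proof (rule ccontr)
    assume "\<not> N b \<le> t"
    then have r: "t < N b" by simp
    define r where "r = N b"
    have "(-1) \<odot> (complex_of_real (t - r) \<odot> \<one> \<ominus> a) \<in> Units A"
      using r by (intro Units_smult spec) (simp_all add: r_def complex_nonneg_Reals_iff)
    moreover have "(-1) \<odot> (complex_of_real (t - r) \<odot> \<one> \<ominus> a) = rsc r \<ominus> b" unfolding b_def
      by (rule nc_identity[where vs="[a]"], (rule nc_rules)+) (simp_all add: ac)
    moreover have "rsc (r + t) \<ominus> a \<in> Units A"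
      using r t ac by (intro rsc_minus_Units) (simp_all add: r_def t_def)
    moreover have "rsc (r + t) \<ominus> a = rsc r \<oplus> b" unfolding b_def
      by (rule nc_identity[where vs="[a]"], (rule nc_rules)+) (simp_all add: ac)
    ultimately show False using nrm_in_spectrum[OF b r_def[symmetric]] r t by (simp add: r_def)
  qed
  then show ?thesis using ac unfolding npos_def b_def by blast
qed

lemma positive_elt_iff_npos: "positive_elt A a \<longleftrightarrow> npos a"
  using npos_imp_positive_elt positive_elt_imp_npos by blast

section \<open>Elements of the form x* x are positive\<close>

text \<open>
  If \<open>v\<close> inverts \<open>c + xy\<close>, then \<open>(1 - y v x)/c\<close> inverts \<open>c + yx\<close>.
\<close>

lemma Units_swap:
  assumes xy: "x \<in> carrier A" "y \<in> carrier A" and c: "c \<noteq> 0"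
    and U: "c \<odot> \<one> \<oplus> x \<otimes> y \<in> Units A"
  shows "c \<odot> \<one> \<oplus> y \<otimes> x \<in> Units A"
proof -
  obtain v where v: "v \<in> carrier A" "v \<otimes> (c \<odot> \<one> \<oplus> x \<otimes> y) = \<one>" "(c \<odot> \<one> \<oplus> x \<otimes> y) \<otimes> v = \<one>"
    using U by (auto simp: Units_def)
  define w where "w = \<one> \<ominus> y \<otimes> v \<otimes> x"
  have w: "w \<in> carrier A" using xy v by (simp add: w_def)
  have 1: "(c \<odot> \<one> \<oplus> y \<otimes> x) \<otimes> w = c \<odot> \<one>" unfolding w_def
    by (rule nc_identity_mod[where vs="[x, y, v]",
          OF arg_cong[OF v(3), of "\<lambda>u. (-1) \<odot> (y \<otimes> u \<otimes> x)"]], (rule nc_rules)+)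
      (simp_all add: xy v)
  have 2: "w \<otimes> (c \<odot> \<one> \<oplus> y \<otimes> x) = c \<odot> \<one>" unfolding w_def
    by (rule nc_identity_mod[where vs="[x, y, v]",
          OF arg_cong[OF v(2), of "\<lambda>u. (-1) \<odot> (y \<otimes> u \<otimes> x)"]], (rule nc_rules)+)
      (simp_all add: xy v)
  have "(inverse c \<odot> w) \<otimes> (c \<odot> \<one> \<oplus> y \<otimes> x) = \<one>" "(c \<odot> \<one> \<oplus> y \<otimes> x) \<otimes> (inverse c \<odot> w) = \<one>"
    using 1 2 c w xy by (simp_all add: smult_mult_left smult_mult_right smult_smult)
  then show ?thesis using w xy unfolding Units_def by auto
qed

lemma npos_uminus_swap:
  assumes y: "y \<in> carrier A" and pos: "npos (\<ominus> (adj A y \<otimes> y))"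
  shows "npos (\<ominus> (y \<otimes> adj A y))"
proof -
  have ay: "adj A y \<in> carrier A" using y by (rule adj_closed)
  have "c \<odot> \<one> \<oplus> y \<otimes> adj A y \<in> Units A" if c: "c \<notin> \<real>\<^sub>\<ge>\<^sub>0" for c
  proof (rule Units_swap[OF ay y])
    show "c \<noteq> 0" using c by auto
    have "c \<odot> \<one> \<ominus> \<ominus> (adj A y \<otimes> y) \<in> Units A"
      using npos_imp_positive_elt[OF pos] c by (auto simp: positive_elt_def spectrum_of_def)
    then show "c \<odot> \<one> \<oplus> adj A y \<otimes> y \<in> Units A" using y ay by (simp add: a_minus_def)
  qed
  then have "spectrum_of A (\<ominus> (y \<otimes> adj A y)) \<subseteq> \<real>\<^sub>\<ge>\<^sub>0"
    using y ay unfolding spectrum_of_def by (auto simp: a_minus_def)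
  then have "positive_elt A (\<ominus> (y \<otimes> adj A y))"
    using y ay by (simp add: positive_elt_def adj_uminus adj_mult adj_adj)
  then show ?thesis by (rule positive_elt_imp_npos)
qed

text \<open>
  If \<open>-y\<^sup>* y\<close> is positive, so is \<open>-y y\<^sup>*\<close>, the two spectra agreeing up to zero. With \<open>h = y + y\<^sup>*\<close> and
  \<open>k = i(y - y\<^sup>*)\<close> one has \<open>2 y\<^sup>* y = h\<^sup>2 + k\<^sup>2 - 2 y y\<^sup>*\<close>, so \<open>y\<^sup>* y\<close> is positive as well. Only
  \<open>0\<close> is positive together with its negative.
\<close>

lemma uminus_star_square_zero:
  assumes y: "y \<in> carrier A" and neg: "npos (\<ominus> (adj A y \<otimes> y))"
  shows "adj A y \<otimes> y = \<zero>"
proof -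
  have ay: "adj A y \<in> carrier A" using y by (rule adj_closed)
  define h where "h = y \<oplus> adj A y"
  define k where "k = \<i> \<odot> (y \<ominus> adj A y)"
  have k_sa: "adj A k = k"
  proof -
    have "adj A k = (- \<i>) \<odot> (adj A y \<ominus> y)"
      using y ay by (simp add: k_def adj_smult adj_minus adj_adj)
    also have "\<dots> = k" unfolding k_def
      by (rule nc_identity[where vs="[y, adj A y]"], (rule nc_rules)+)
        (simp_all add: y ay)
    finally show ?thesis .
  qed
  have hk: "h \<in> carrier A" "adj A h = h" "k \<in> carrier A" "adj A k = k"
    using y ay k_sa by (simp_all add: h_def k_def adj_add adj_adj a_comm)
  have "npos ((h \<otimes> h \<oplus> k \<otimes> k) \<oplus> complex_of_real 2 \<odot> (\<ominus> (y \<otimes> adj A y)))"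
    using hk npos_uminus_swap[OF y neg] by (intro npos_add npos_square npos_smult) simp_all
  then have "npos (complex_of_real (1/2) \<odot>
      ((h \<otimes> h \<oplus> k \<otimes> k) \<oplus> complex_of_real 2 \<odot> (\<ominus> (y \<otimes> adj A y))))"
    by (intro npos_smult) simp_all
  moreover have "complex_of_real (1/2) \<odot>
      ((h \<otimes> h \<oplus> k \<otimes> k) \<oplus> complex_of_real 2 \<odot> (\<ominus> (y \<otimes> adj A y))) = adj A y \<otimes> y"
    unfolding h_def k_def
    by (rule nc_identity[where vs="[y, adj A y]"], (rule nc_rules)+) (simp_all add: y ay)
  ultimately show ?thesis using neg by (intro npos_antisym) simp_all
qed

text \<open>
  Let \<open>a = x\<^sup>* x\<close>, \<open>m = \<surd>(a\<^sup>2)\<close> and \<open>b = m - a\<close>; in the commutative picture \<open>m = \<bar>a\<bar>\<close> and \<open>b\<close> is twice the negative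
  part of \<open>a\<close>. Since \<open>a b = -m b\<close>, for \<open>y = x b\<close> and a root \<open>c\<close> of \<open>m\<close> one gets \<open>y\<^sup>* y = b a b = -(c b)\<^sup>2\<close>. So
  \<open>-y\<^sup>* y\<close> is positive, which forces \<open>c b = 0\<close>, then \<open>m b = a b = 0\<close>, \<open>b\<^sup>2 = 0\<close> and \<open>a = m\<close>.
\<close>

theorem npos_star_square:
  assumes x: "x \<in> carrier A"
  shows "npos (adj A x \<otimes> x)"
proof -
  define a where "a = adj A x \<otimes> x"
  have a: "a \<in> carrier A" "adj A a = a"
    using x by (simp_all add: a_def adj_mult adj_closed adj_adj)
  have "a \<otimes> (a \<otimes> a) = (a \<otimes> a) \<otimes> a" using a by (simp add: m_assoc)
  then obtain m where m: "npos m" "m \<otimes> m = a \<otimes> a" "a \<otimes> m = m \<otimes> a"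
    using npos_sqrt[OF npos_square[OF a]] a by blast
  obtain c where c: "npos c" "c \<otimes> c = m" "a \<otimes> c = c \<otimes> a"
    using npos_sqrt[OF m(1)] a(1) m(3) by blast
  have mc: "m \<in> carrier A" "adj A m = m" "c \<in> carrier A" "adj A c = c"
    using m c by (simp_all add: npos_sa)
  define b where "b = m \<ominus> a"
  have b: "b \<in> carrier A" "adj A b = b" using a mc by (simp_all add: b_def adj_minus)
  have cm: "c \<otimes> m = m \<otimes> c" using mc unfolding c(2)[symmetric] by (simp add: m_assoc)
  have cb: "c \<otimes> b = b \<otimes> c" unfolding b_def using cm c(3) a mc by (simp add: a_minus_def l_distr r_distr l_minus r_minus)
  have ab: "a \<otimes> b = \<ominus> (m \<otimes> b)"
  proof -
    have "a \<otimes> b = a \<otimes> m \<ominus> a \<otimes> a" unfolding b_def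
      by (rule nc_identity[where vs="[a, m]"], (rule nc_rules)+) (simp_all add: a mc)
    also have "\<dots> = m \<otimes> a \<ominus> m \<otimes> m" using m by simp
    also have "\<dots> = \<ominus> (m \<otimes> b)" unfolding b_def
      by (rule nc_identity[where vs="[a, m]"], (rule nc_rules)+) (simp_all add: a mc)
    finally show ?thesis .
  qed
  define y where "y = x \<otimes> b"
  have y: "y \<in> carrier A" using x b by (simp add: y_def)
  have sq: "(c \<otimes> b) \<otimes> (c \<otimes> b) = b \<otimes> (m \<otimes> b)"
  proof -
    have "(c \<otimes> b) \<otimes> (c \<otimes> b) = (b \<otimes> c) \<otimes> (c \<otimes> b)" by (simp only: cb)
    also have "\<dots> = b \<otimes> ((c \<otimes> c) \<otimes> b)" using b mc by (simp add: m_assoc)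
    finally show ?thesis by (simp only: c(2))
  qed
  have "adj A y \<otimes> y = b \<otimes> (a \<otimes> b)"
    using x b by (simp add: y_def a_def adj_mult adj_closed m_assoc)
  then have yy: "adj A y \<otimes> y = \<ominus> ((c \<otimes> b) \<otimes> (c \<otimes> b))"
    unfolding ab sq using b mc by (simp add: r_minus)
  have cb_sa: "c \<otimes> b \<in> carrier A" "adj A (c \<otimes> b) = c \<otimes> b"
    using b mc cb by (simp_all add: adj_mult)
  have "npos ((c \<otimes> b) \<otimes> (c \<otimes> b))" using cb_sa by (rule npos_square)
  then have "npos (\<ominus> (adj A y \<otimes> y))" unfolding yy using cb_sa by simp
  then have "(c \<otimes> b) \<otimes> (c \<otimes> b) = \<zero>"
    using uminus_star_square_zero[OF y] cb_sa unfolding yy by (metis minus_minus minus_zero m_closed)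
  then have "(N (c \<otimes> b))\<^sup>2 = 0" using nrm_square_sa[OF cb_sa] by simp
  then have cb0: "c \<otimes> b = \<zero>" using cb_sa nrm_eq_0 by simp
  have "m \<otimes> b = c \<otimes> (c \<otimes> b)" using mc b unfolding c(2)[symmetric] by (simp add: m_assoc)
  then have mb0: "m \<otimes> b = \<zero>" using cb0 mc by simp
  have "b \<otimes> b = m \<otimes> b \<ominus> a \<otimes> b" unfolding b_def
    by (rule nc_identity[where vs="[a, m]"], (rule nc_rules)+) (simp_all add: a mc)
  then have "b \<otimes> b = \<zero>" using mb0 unfolding ab by (simp add: a_minus_def)
  then have "(N b)\<^sup>2 = 0" using nrm_square_sa[OF b] by simp
  then have "b = \<zero>" using b nrm_eq_0 by simp
  then have "m = a" using a mc eq_if_minus_zero unfolding b_def by blast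
  then show ?thesis using m(1) by (simp add: a_def)
qed

theorem positive_elt_iff_star_square:
  "positive_elt A a \<longleftrightarrow> (\<exists>x\<in>carrier A. a = adj A x \<otimes> x)"
proof
  assume "positive_elt A a"
  then have "npos a" by (rule positive_elt_imp_npos)
  then obtain s where "npos s" "s \<otimes> s = a" using npos_sqrt by blast
  then show "\<exists>x\<in>carrier A. a = adj A x \<otimes> x" by (intro bexI[of _ s]) (simp_all add: npos_sa)
next
  assume "\<exists>x\<in>carrier A. a = adj A x \<otimes> x"
  then show "positive_elt A a" using npos_star_square npos_imp_positive_elt by blast
qed

end

section \<open>Bounds from sums of squares\<close>

lemma star_algebraI:
  fixes A :: "('a, 'x) star_alg_scheme" (structure)
  assumes "\<And>x y. \<lbrakk>x \<in> carrier A; y \<in> carrier A\<rbrakk> \<Longrightarrow> x \<oplus> y \<in> carrier A"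
    and "\<zero> \<in> carrier A"
    and "\<And>x y z. \<lbrakk>x \<in> carrier A; y \<in> carrier A; z \<in> carrier A\<rbrakk> \<Longrightarrow> (x \<oplus> y) \<oplus> z = x \<oplus> (y \<oplus> z)"
    and "\<And>x y. \<lbrakk>x \<in> carrier A; y \<in> carrier A\<rbrakk> \<Longrightarrow> x \<oplus> y = y \<oplus> x"
    and "\<And>x. x \<in> carrier A \<Longrightarrow> \<zero> \<oplus> x = x"
    and "\<And>x y. \<lbrakk>x \<in> carrier A; y \<in> carrier A\<rbrakk> \<Longrightarrow> x \<otimes> y \<in> carrier A"
    and "\<one> \<in> carrier A"
    and "\<And>x y z. \<lbrakk>x \<in> carrier A; y \<in> carrier A; z \<in> carrier A\<rbrakk> \<Longrightarrow> (x \<otimes> y) \<otimes> z = x \<otimes> (y \<otimes> z)"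
    and "\<And>x. x \<in> carrier A \<Longrightarrow> \<one> \<otimes> x = x"
    and "\<And>x. x \<in> carrier A \<Longrightarrow> x \<otimes> \<one> = x"
    and "\<And>x y z. \<lbrakk>x \<in> carrier A; y \<in> carrier A; z \<in> carrier A\<rbrakk> \<Longrightarrow> (x \<oplus> y) \<otimes> z = x \<otimes> z \<oplus> y \<otimes> z"
    and "\<And>x y z. \<lbrakk>x \<in> carrier A; y \<in> carrier A; z \<in> carrier A\<rbrakk> \<Longrightarrow> z \<otimes> (x \<oplus> y) = z \<otimes> x \<oplus> z \<otimes> y"
    and smult: "\<And>c x. x \<in> carrier A \<Longrightarrow> c \<odot> x \<in> carrier A"
    and "\<And>c d x. x \<in> carrier A \<Longrightarrow> (c + d) \<odot> x = c \<odot> x \<oplus> d \<odot> x"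
    and "\<And>c x y. \<lbrakk>x \<in> carrier A; y \<in> carrier A\<rbrakk> \<Longrightarrow> c \<odot> (x \<oplus> y) = c \<odot> x \<oplus> c \<odot> y"
    and "\<And>c d x. x \<in> carrier A \<Longrightarrow> (c * d) \<odot> x = c \<odot> (d \<odot> x)"
    and "\<And>x. x \<in> carrier A \<Longrightarrow> 1 \<odot> x = x"
    and "\<And>x. x \<in> carrier A \<Longrightarrow> 0 \<odot> x = \<zero>"
    and "\<And>c x y. \<lbrakk>x \<in> carrier A; y \<in> carrier A\<rbrakk> \<Longrightarrow> (c \<odot> x) \<otimes> y = c \<odot> (x \<otimes> y)"
    and "\<And>c x y. \<lbrakk>x \<in> carrier A; y \<in> carrier A\<rbrakk> \<Longrightarrow> x \<otimes> (c \<odot> y) = c \<odot> (x \<otimes> y)"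
    and "\<And>x. x \<in> carrier A \<Longrightarrow> adj A x \<in> carrier A"
    and "\<And>x. x \<in> carrier A \<Longrightarrow> adj A (adj A x) = x"
    and "\<And>x y. \<lbrakk>x \<in> carrier A; y \<in> carrier A\<rbrakk> \<Longrightarrow> adj A (x \<oplus> y) = adj A x \<oplus> adj A y"
    and "\<And>c x. x \<in> carrier A \<Longrightarrow> adj A (c \<odot> x) = cnj c \<odot> adj A x"
    and "\<And>x y. \<lbrakk>x \<in> carrier A; y \<in> carrier A\<rbrakk> \<Longrightarrow> adj A (x \<otimes> y) = adj A y \<otimes> adj A x"
  shows "star_algebra A"
proof -
  have ab: "abelian_group A"
  proof (rule abelian_groupI)
    fix x assume x: "x \<in> carrier A"
    have "(-1) \<odot> x \<oplus> x = (-1) \<odot> x \<oplus> 1 \<odot> x" using assms(17) x by simp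
    also have "\<dots> = (-1 + 1) \<odot> x" using assms(14) x by (simp only:)
    also have "\<dots> = \<zero>" using assms(18) x by simp
    finally show "\<exists>y\<in>carrier A. y \<oplus> x = \<zero>" using smult x by blast
  qed (use assms in auto)
  have "monoid A" by (rule monoidI) (use assms in auto)
  then have "ring A" by (rule ringI[OF ab]) (use assms in auto)
  moreover have "module complex_alg A"
    by (rule moduleI[OF cring_complex_alg ab]) (use assms in auto)
  ultimately show ?thesis
    by (rule star_algebra.intro) (unfold_locales, use assms in auto)
qed

lemma unital_cstar_algebra_iff:
  "unital_cstar_algebra A \<longleftrightarrow> cstar_norm A (nrm A)"
proof
  assume "unital_cstar_algebra A"
  then interpret unital_cstar_algebra A .
  show "cstar_norm A (nrm A)"
    by unfold_locales
      (simp_all add: smult_mult_left smult_mult_right adj_closed adj_adj adj_add adj_smult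
        adj_mult nrm_nonneg nrm_eq_0 nrm_triangle nrm_smult nrm_mult cstar_identity complete)
next
  assume "cstar_norm A (nrm A)"
  then interpret cstar_norm A "nrm A" .
  show "unital_cstar_algebra A"
    by unfold_locales
      (simp_all add: smult_mult_left smult_mult_right adj_closed adj_adj adj_add adj_smult
        adj_mult nrm_nonneg nrm_eq_0 nrm_triangle nrm_smult nrm_mult cstar_identity complete)
qed

context star_algebra
begin

inductive_set sos :: "'a set" where
  sos_zero: "\<zero> \<in> sos"
| sos_step: "x \<in> carrier A \<Longrightarrow> s \<in> sos \<Longrightarrow> adj A x \<otimes> x \<oplus> s \<in> sos"

lemma sos_closed: "s \<in> sos \<Longrightarrow> s \<in> carrier A"
  by (induction rule: sos.induct) (simp_all add: adj_closed)

lemma sos_square: "x \<in> carrier A \<Longrightarrow> adj A x \<otimes> x \<in> sos"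
  using sos_step[OF _ sos_zero] by (simp add: adj_closed)

lemma sos_add: "s \<in> sos \<Longrightarrow> t \<in> sos \<Longrightarrow> s \<oplus> t \<in> sos"
  by (induction rule: sos.induct) (simp_all add: sos_closed a_assoc adj_closed sos_step)

lemma sos_smult:
  assumes "0 \<le> c"
  shows "s \<in> sos \<Longrightarrow> complex_of_real c \<odot> s \<in> sos"
proof (induction rule: sos.induct)
  case (sos_step x s)
  let ?y = "complex_of_real (sqrt c) \<odot> x"
  have "adj A ?y \<otimes> ?y = complex_of_real c \<odot> (adj A x \<otimes> x)"
    using sos_step assms by (simp add: adj_smult smult_mult_left smult_mult_right smult_smult
        adj_closed flip: of_real_mult)
  then have "complex_of_real c \<odot> (adj A x \<otimes> x \<oplus> s) = adj A ?y \<otimes> ?y \<oplus> complex_of_real c \<odot> s"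
    using sos_step assms by (simp add: smult_add_right sos_closed adj_closed)
  then show ?case using sos.sos_step[of ?y] sos_step by simp
qed (simp add: sos_zero)

lemma sos_conj:
  assumes y: "y \<in> carrier A"
  shows "s \<in> sos \<Longrightarrow> adj A y \<otimes> s \<otimes> y \<in> sos"
proof (induction rule: sos.induct)
  case sos_zero
  then show ?case using y by (simp add: sos.sos_zero adj_closed)
next
  case (sos_step x s)
  have "adj A y \<otimes> (adj A x \<otimes> x \<oplus> s) \<otimes> y = adj A (x \<otimes> y) \<otimes> (x \<otimes> y) \<oplus> adj A y \<otimes> s \<otimes> y"
    unfolding adj_mult[OF sos_step(1) y]
    by (rule nc_identity[where vs="[x, y, s, adj A x, adj A y]"], (rule nc_rules)+)
      (simp_all add: y sos_step adj_closed sos_closed)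
  then show ?case using sos.sos_step[of "x \<otimes> y"] sos_step y by simp
qed

lemma sos_rsc: "0 \<le> c \<Longrightarrow> rsc c \<in> sos"
  using sos_smult[OF _ sos_square[of \<one>]] by simp

text \<open>
  If \<open>t\<^sup>2 - x\<^sup>* x\<close> is a sum of squares, then \<open>t\<close> bounds the norm of \<open>x\<close> in every *-representation on a Hilbert
  space. So the infimum below is the natural candidate for a C*-norm.
\<close>

definition bounds :: "'a \<Rightarrow> real set" where
  "bounds x = {t. 0 \<le> t \<and> rsc (t\<^sup>2) \<ominus> adj A x \<otimes> x \<in> sos}"

definition sos_norm :: "'a \<Rightarrow> real" where
  "sos_norm x = Inf (bounds x)"

lemma bounds_mono:
  assumes x: "x \<in> carrier A" and s: "s \<in> bounds x" and st: "s \<le> t"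
  shows "t \<in> bounds x"
proof -
  have "s\<^sup>2 \<le> t\<^sup>2" using s st by (intro power_mono) (simp_all add: bounds_def)
  then have "rsc (t\<^sup>2 - s\<^sup>2) \<oplus> (rsc (s\<^sup>2) \<ominus> adj A x \<otimes> x) \<in> sos"
    using s by (intro sos_add sos_rsc) (simp_all add: bounds_def)
  moreover have "rsc (t\<^sup>2 - s\<^sup>2) \<oplus> (rsc (s\<^sup>2) \<ominus> adj A x \<otimes> x) = rsc (t\<^sup>2) \<ominus> adj A x \<otimes> x"
    by (rule nc_identity[where vs="[x, adj A x]"], (rule nc_rules)+)
      (simp_all add: x adj_closed)
  ultimately show ?thesis using s st by (simp add: bounds_def)
qed

text \<open>
  For \<open>d = t x - s y\<close>,
  \<open>s t ((s + t)\<^sup>2 - (x + y)\<^sup>*(x + y)) = t (s + t)(s\<^sup>2 - x\<^sup>* x) + s (s + t)(t\<^sup>2 - y\<^sup>* y) + d\<^sup>* d\<close>.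
\<close>

lemma bounds_add:
  assumes x: "x \<in> carrier A" and y: "y \<in> carrier A"
    and s: "s \<in> bounds x" "0 < s" and t: "t \<in> bounds y" "0 < t"
  shows "s + t \<in> bounds (x \<oplus> y)"
proof -
  let ?x' = "adj A x" and ?y' = "adj A y"
  let ?s = "complex_of_real s" and ?t = "complex_of_real t"
  have c: "?x' \<in> carrier A" "?y' \<in> carrier A" using x y by (simp_all add: adj_closed)
  define d where "d = ?t \<odot> x \<ominus> ?s \<odot> y"
  have d: "d \<in> carrier A" "adj A d = ?t \<odot> ?x' \<ominus> ?s \<odot> ?y'"
    using x y by (simp_all add: d_def adj_minus adj_smult)
  have "complex_of_real (t * (s + t)) \<odot> (rsc (s\<^sup>2) \<ominus> ?x' \<otimes> x)
      \<oplus> (complex_of_real (s * (s + t)) \<odot> (rsc (t\<^sup>2) \<ominus> ?y' \<otimes> y) \<oplus> adj A d \<otimes> d) \<in> sos"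
    using s t d by (intro sos_add sos_smult sos_square) (simp_all add: bounds_def)
  then have "complex_of_real (1 / (s * t)) \<odot>
     (complex_of_real (t * (s + t)) \<odot> (rsc (s\<^sup>2) \<ominus> ?x' \<otimes> x)
      \<oplus> (complex_of_real (s * (s + t)) \<odot> (rsc (t\<^sup>2) \<ominus> ?y' \<otimes> y) \<oplus> adj A d \<otimes> d)) \<in> sos"
    using s t by (intro sos_smult) simp_all
  also have "complex_of_real (t * (s + t)) \<odot> (rsc (s\<^sup>2) \<ominus> ?x' \<otimes> x)
      \<oplus> (complex_of_real (s * (s + t)) \<odot> (rsc (t\<^sup>2) \<ominus> ?y' \<otimes> y) \<oplus> adj A d \<otimes> d)
     = complex_of_real (s * t) \<odot> (rsc ((s + t)\<^sup>2) \<ominus> (?x' \<oplus> ?y') \<otimes> (x \<oplus> y))"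
    unfolding d(2) unfolding d_def
    by (rule nc_identity[where vs="[x, y, adj A x, adj A y]"], (rule nc_rules)+)
      (simp_all add: x y c power2_eq_square algebra_simps)
  also have "complex_of_real (1 / (s * t)) \<odot>
      (complex_of_real (s * t) \<odot> (rsc ((s + t)\<^sup>2) \<ominus> (?x' \<oplus> ?y') \<otimes> (x \<oplus> y)))
     = rsc ((s + t)\<^sup>2) \<ominus> (?x' \<oplus> ?y') \<otimes> (x \<oplus> y)"
    using s t x y c by (simp add: smult_smult del: of_real_add)
  finally show ?thesis using s t x y by (simp add: bounds_def adj_add)
qed

text \<open>
  \<open>(s t)\<^sup>2 - (x y)\<^sup>*(x y) = s\<^sup>2 (t\<^sup>2 - y\<^sup>* y) + y\<^sup>*(s\<^sup>2 - x\<^sup>* x) y\<close>.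
\<close>

lemma bounds_mult:
  assumes x: "x \<in> carrier A" and y: "y \<in> carrier A" and s: "s \<in> bounds x" and t: "t \<in> bounds y"
  shows "s * t \<in> bounds (x \<otimes> y)"
proof -
  have c: "adj A x \<in> carrier A" "adj A y \<in> carrier A" using x y by (simp_all add: adj_closed)
  have "complex_of_real (s\<^sup>2) \<odot> (rsc (t\<^sup>2) \<ominus> adj A y \<otimes> y)
      \<oplus> adj A y \<otimes> (rsc (s\<^sup>2) \<ominus> adj A x \<otimes> x) \<otimes> y \<in> sos"
    using s t y by (intro sos_add sos_smult sos_conj) (simp_all add: bounds_def)
  moreover have "complex_of_real (s\<^sup>2) \<odot> (rsc (t\<^sup>2) \<ominus> adj A y \<otimes> y)
      \<oplus> adj A y \<otimes> (rsc (s\<^sup>2) \<ominus> adj A x \<otimes> x) \<otimes> y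
      = rsc ((s * t)\<^sup>2) \<ominus> (adj A y \<otimes> adj A x) \<otimes> (x \<otimes> y)"
    by (rule nc_identity[where vs="[x, y, adj A x, adj A y]"], (rule nc_rules)+)
      (simp_all add: x y c power_mult_distrib)
  ultimately show ?thesis using s t x y by (simp add: bounds_def adj_mult)
qed

lemma bounds_smult:
  assumes x: "x \<in> carrier A" and t: "t \<in> bounds x"
  shows "cmod c * t \<in> bounds (c \<odot> x)"
proof -
  have ax: "adj A x \<in> carrier A" using x by (rule adj_closed)
  have cc: "cnj c * c = complex_of_real ((cmod c)\<^sup>2)"
    by (metis complex_norm_square mult.commute)
  have "complex_of_real ((cmod c)\<^sup>2) \<odot> (rsc (t\<^sup>2) \<ominus> adj A x \<otimes> x) \<in> sos"
    using t by (intro sos_smult) (simp_all add: bounds_def)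
  moreover have "complex_of_real ((cmod c)\<^sup>2) \<odot> (rsc (t\<^sup>2) \<ominus> adj A x \<otimes> x)
      = rsc ((cmod c * t)\<^sup>2) \<ominus> complex_of_real ((cmod c)\<^sup>2) \<odot> (adj A x \<otimes> x)"
    by (rule nc_identity[where vs="[x, adj A x]"], (rule nc_rules)+)
      (simp_all add: x ax power_mult_distrib)
  moreover have "complex_of_real ((cmod c)\<^sup>2) \<odot> (adj A x \<otimes> x) = adj A (c \<odot> x) \<otimes> (c \<odot> x)"
    using x ax cc by (simp add: adj_smult smult_mult_left smult_mult_right smult_smult mult.commute)
  ultimately show ?thesis using t by (simp add: bounds_def)
qed

text \<open>
  First \<open>t\<close> is also a bound of \<open>x\<^sup>*\<close>: with \<open>k = t\<^sup>2 - x x\<^sup>*\<close> one has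
  \<open>t\<^sup>2 k = k\<^sup>2 + x (t\<^sup>2 - x\<^sup>* x) x\<^sup>*\<close>. Then \<open>t\<^sup>4 - (x\<^sup>* x)\<^sup>2 = t\<^sup>2 (t\<^sup>2 - x\<^sup>* x) + x\<^sup>* k x\<close>.
\<close>

lemma bounds_star_square:
  assumes x: "x \<in> carrier A" and t: "t \<in> bounds x" "0 < t"
  shows "t\<^sup>2 \<in> bounds (adj A x \<otimes> x)"
proof -
  let ?x' = "adj A x"
  have x': "?x' \<in> carrier A" using x by (rule adj_closed)
  define k where "k = rsc (t\<^sup>2) \<ominus> x \<otimes> ?x'"
  have k: "k \<in> carrier A" "adj A k = k"
    using x x' by (simp_all add: k_def adj_minus adj_mult adj_adj adj_smult)
  have b: "rsc (t\<^sup>2) \<ominus> ?x' \<otimes> x \<in> sos" using t by (simp add: bounds_def)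
  have "adj A k \<otimes> k \<oplus> adj A ?x' \<otimes> (rsc (t\<^sup>2) \<ominus> ?x' \<otimes> x) \<otimes> ?x' \<in> sos"
    using b k x' by (intro sos_add sos_square sos_conj)
  then have "complex_of_real (1 / t\<^sup>2) \<odot> (k \<otimes> k \<oplus> x \<otimes> (rsc (t\<^sup>2) \<ominus> ?x' \<otimes> x) \<otimes> ?x') \<in> sos"
    using k x by (intro sos_smult) (simp_all add: adj_adj)
  also have "k \<otimes> k \<oplus> x \<otimes> (rsc (t\<^sup>2) \<ominus> ?x' \<otimes> x) \<otimes> ?x' = complex_of_real (t\<^sup>2) \<odot> k"
    unfolding k_def by (rule nc_identity[where vs="[x, adj A x]"], (rule nc_rules)+)
      (simp_all add: x x')
  also have "complex_of_real (1 / t\<^sup>2) \<odot> (complex_of_real (t\<^sup>2) \<odot> k) = k"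
    using t k by (simp add: smult_smult)
  finally have "k \<in> sos" .
  then have "complex_of_real (t\<^sup>2) \<odot> (rsc (t\<^sup>2) \<ominus> ?x' \<otimes> x) \<oplus> ?x' \<otimes> k \<otimes> x \<in> sos"
    using b x by (intro sos_add sos_smult sos_conj) simp_all
  also have "complex_of_real (t\<^sup>2) \<odot> (rsc (t\<^sup>2) \<ominus> ?x' \<otimes> x) \<oplus> ?x' \<otimes> k \<otimes> x
    = rsc ((t\<^sup>2)\<^sup>2) \<ominus> (?x' \<otimes> x) \<otimes> (?x' \<otimes> x)"
    unfolding k_def by (rule nc_identity[where vs="[x, adj A x]"], (rule nc_rules)+)
      (simp_all add: x x' power2_eq_square)
  finally show ?thesis using x x' by (simp add: bounds_def adj_mult adj_adj)
qed

text \<open>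
  For \<open>a = x\<^sup>* x\<close>: \<open>2 t (t - a) = (t\<^sup>2 - a\<^sup>2) + (t - a)\<^sup>2\<close>.
\<close>

lemma bounds_star_square_sqrt:
  assumes x: "x \<in> carrier A" and t: "t \<in> bounds (adj A x \<otimes> x)" "0 < t"
  shows "sqrt t \<in> bounds x"
proof -
  define a where "a = adj A x \<otimes> x"
  have a: "a \<in> carrier A" "adj A a = a" using x by (simp_all add: a_def adj_mult adj_adj adj_closed)
  have "rsc (t\<^sup>2) \<ominus> a \<otimes> a \<in> sos" using t a by (simp add: bounds_def a_def[symmetric])
  moreover have "adj A (rsc t \<ominus> a) \<otimes> (rsc t \<ominus> a) \<in> sos" using a by (intro sos_square) simp
  ultimately have "complex_of_real (1 / (2 * t)) \<odot>
      ((rsc (t\<^sup>2) \<ominus> a \<otimes> a) \<oplus> (rsc t \<ominus> a) \<otimes> (rsc t \<ominus> a)) \<in> sos"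
    using a t by (intro sos_smult sos_add) (simp_all add: adj_minus)
  also have "(rsc (t\<^sup>2) \<ominus> a \<otimes> a) \<oplus> (rsc t \<ominus> a) \<otimes> (rsc t \<ominus> a)
      = complex_of_real (2 * t) \<odot> (rsc t \<ominus> a)"
    by (rule nc_identity[where vs="[a]"], (rule nc_rules)+) (simp_all add: a power2_eq_square)
  also have "complex_of_real (1 / (2 * t)) \<odot> (complex_of_real (2 * t) \<odot> (rsc t \<ominus> a)) = rsc t \<ominus> a"
    using t a by (simp add: smult_smult)
  finally have "rsc ((sqrt t)\<^sup>2) \<ominus> a \<in> sos" using t by (simp del: of_real_power)
  moreover have "0 \<le> sqrt t" using t by simp
  ultimately show ?thesis unfolding bounds_def a_def by blast
qed

end

text \<open>
  What a *-algebra needs for \<open>sos_norm\<close> to be a norm with the C*-identity; completeness remains a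
  separate matter.
\<close>

locale archimedean_star_algebra = star_algebra +
  assumes bounded: "x \<in> carrier A \<Longrightarrow> bounds x \<noteq> {}"
    and separated: "x \<in> carrier A \<Longrightarrow> (\<And>t. 0 < t \<Longrightarrow> t \<in> bounds x) \<Longrightarrow> x = \<zero>"
begin

lemma bdd_below_bounds: "bdd_below (bounds x)"
  by (rule bdd_belowI[of _ 0]) (simp add: bounds_def)

lemma sos_norm_nonneg: "x \<in> carrier A \<Longrightarrow> 0 \<le> sos_norm x"
  unfolding sos_norm_def by (rule cInf_greatest[OF bounded]) (simp_all add: bounds_def)

lemma sos_norm_le: "t \<in> bounds x \<Longrightarrow> sos_norm x \<le> t"
  unfolding sos_norm_def by (rule cInf_lower[OF _ bdd_below_bounds])

lemma bounds_if_sos_norm_less: "x \<in> carrier A \<Longrightarrow> sos_norm x < t \<Longrightarrow> t \<in> bounds x"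
  unfolding sos_norm_def using cInf_lessD[OF bounded] bounds_mono by (metis less_imp_le)

lemma sos_norm_leI:
  assumes "\<And>t. c < t \<Longrightarrow> t \<in> bounds x"
  shows "sos_norm x \<le> c"
  by (rule dense_ge) (use assms sos_norm_le in blast)

lemma sos_norm_triangle:
  assumes x: "x \<in> carrier A" and y: "y \<in> carrier A"
  shows "sos_norm (x \<oplus> y) \<le> sos_norm x + sos_norm y"
proof (rule sos_norm_leI)
  fix t assume t: "sos_norm x + sos_norm y < t"
  define e where "e = (t - (sos_norm x + sos_norm y)) / 2"
  have e: "0 < e" and t_eq: "t = (sos_norm x + e) + (sos_norm y + e)"
    using t by (simp_all add: e_def field_simps)
  show "t \<in> bounds (x \<oplus> y)" unfolding t_eq
    using e sos_norm_nonneg[OF x] sos_norm_nonneg[OF y]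
    by (intro bounds_add x y bounds_if_sos_norm_less) simp_all
qed

lemma sos_norm_mult:
  assumes x: "x \<in> carrier A" and y: "y \<in> carrier A"
  shows "sos_norm (x \<otimes> y) \<le> sos_norm x * sos_norm y"
proof -
  have "(\<lambda>n. (sos_norm x + inverse (real (Suc n))) * (sos_norm y + inverse (real (Suc n))))
      \<longlonglongrightarrow> (sos_norm x + 0) * (sos_norm y + 0)"
    by (intro tendsto_intros LIMSEQ_inverse_real_of_nat)
  moreover have "sos_norm (x \<otimes> y)
      \<le> (sos_norm x + inverse (real (Suc n))) * (sos_norm y + inverse (real (Suc n)))" for n
    by (intro sos_norm_le bounds_mult bounds_if_sos_norm_less x y) simp_all
  ultimately have "sos_norm (x \<otimes> y) \<le> (sos_norm x + 0) * (sos_norm y + 0)"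
    by (intro LIMSEQ_le_const) blast+
  then show ?thesis by simp
qed

lemma sos_norm_eq_0:
  assumes x: "x \<in> carrier A"
  shows "sos_norm x = 0 \<longleftrightarrow> x = \<zero>"
proof
  assume "sos_norm x = 0"
  then show "x = \<zero>" using x by (intro separated bounds_if_sos_norm_less) simp_all
next
  assume "x = \<zero>"
  then have "0 \<in> bounds x" by (simp add: bounds_def sos_zero a_minus_def)
  then show "sos_norm x = 0" using sos_norm_le sos_norm_nonneg[OF x] by force
qed

lemma sos_norm_smult:
  assumes x: "x \<in> carrier A"
  shows "sos_norm (c \<odot> x) = cmod c * sos_norm x"
proof -
  have le: "sos_norm (c \<odot> x) \<le> cmod c * sos_norm x" if x: "x \<in> carrier A" for c x
  proof -
    have "(\<lambda>n. cmod c * (sos_norm x + inverse (real (Suc n)))) \<longlonglongrightarrow> cmod c * (sos_norm x + 0)"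
      by (intro tendsto_intros LIMSEQ_inverse_real_of_nat)
    moreover have "sos_norm (c \<odot> x) \<le> cmod c * (sos_norm x + inverse (real (Suc n)))" for n
      by (intro sos_norm_le bounds_smult bounds_if_sos_norm_less x) simp_all
    ultimately have "sos_norm (c \<odot> x) \<le> cmod c * (sos_norm x + 0)"
      by (intro LIMSEQ_le_const) blast+
    then show ?thesis by simp
  qed
  show ?thesis
  proof (cases "c = 0")
    case True
    then show ?thesis using x sos_norm_eq_0[of \<zero>] by simp
  next
    case False
    have "sos_norm x = sos_norm (inverse c \<odot> (c \<odot> x))" using False x by (simp add: smult_smult)
    also have "\<dots> \<le> cmod (inverse c) * sos_norm (c \<odot> x)" using x by (intro le) simp
    finally have "cmod c * sos_norm x \<le> sos_norm (c \<odot> x)"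
      using False by (simp add: norm_divide divide_simps mult.commute)
    then show ?thesis using le[OF x, of c] by simp
  qed
qed

lemma sos_norm_cstar:
  assumes x: "x \<in> carrier A"
  shows "sos_norm (adj A x \<otimes> x) = (sos_norm x)\<^sup>2"
proof (rule antisym)
  have a: "adj A x \<otimes> x \<in> carrier A" using x by (simp add: adj_closed)
  have nonneg: "0 \<le> sos_norm x" by (rule sos_norm_nonneg[OF x])
  have "(\<lambda>n. (sos_norm x + inverse (real (Suc n)))\<^sup>2) \<longlonglongrightarrow> (sos_norm x + 0)\<^sup>2"
    by (intro tendsto_intros LIMSEQ_inverse_real_of_nat)
  moreover have "sos_norm (adj A x \<otimes> x) \<le> (sos_norm x + inverse (real (Suc n)))\<^sup>2" for n
    using nonneg
    by (intro sos_norm_le bounds_star_square bounds_if_sos_norm_less x add_nonneg_pos) simp_all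
  ultimately have "sos_norm (adj A x \<otimes> x) \<le> (sos_norm x + 0)\<^sup>2"
    by (intro LIMSEQ_le_const) blast+
  then show "sos_norm (adj A x \<otimes> x) \<le> (sos_norm x)\<^sup>2" by simp
  show "(sos_norm x)\<^sup>2 \<le> sos_norm (adj A x \<otimes> x)"
  proof (rule dense_ge)
    fix t assume t: "sos_norm (adj A x \<otimes> x) < t"
    then have t0: "0 < t" using sos_norm_nonneg[OF a] by simp
    have "sqrt t \<in> bounds x"
      using t t0 by (intro bounds_star_square_sqrt[OF x] bounds_if_sos_norm_less a)
    then have "(sos_norm x)\<^sup>2 \<le> (sqrt t)\<^sup>2" using nonneg by (intro power_mono sos_norm_le)
    then show "(sos_norm x)\<^sup>2 \<le> t" using t0 by simp
  qed
qed

lemma cstar_norm_sos_norm: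
  assumes "\<And>x :: nat \<Rightarrow> 'a. \<lbrakk>\<And>i. x i \<in> carrier A;
      \<And>e. e > 0 \<Longrightarrow> \<exists>M. \<forall>i\<ge>M. \<forall>j\<ge>M. sos_norm (x i \<ominus> x j) < e\<rbrakk>
    \<Longrightarrow> \<exists>l\<in>carrier A. (\<lambda>i. sos_norm (x i \<ominus> l)) \<longlonglongrightarrow> 0"
  shows "cstar_norm A sos_norm"
  by unfold_locales (use assms in \<open>auto simp: sos_norm_nonneg sos_norm_eq_0 sos_norm_triangle
    sos_norm_smult sos_norm_mult sos_norm_cstar\<close>)

end

section \<open>Finite sums\<close>

lemma finsum_hom:
  assumes A: "abelian_monoid A" and B: "abelian_monoid B"
    and f: "f \<in> carrier A \<rightarrow> carrier B" "f \<zero>\<^bsub>A\<^esub> = \<zero>\<^bsub>B\<^esub>"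
      "\<And>x y. x \<in> carrier A \<Longrightarrow> y \<in> carrier A \<Longrightarrow> f (x \<oplus>\<^bsub>A\<^esub> y) = f x \<oplus>\<^bsub>B\<^esub> f y"
    and fin: "finite S" and g: "g \<in> S \<rightarrow> carrier A"
  shows "f (finsum A g S) = finsum B (\<lambda>i. f (g i)) S"
proof -
  interpret A: abelian_monoid A by (rule A)
  interpret B: abelian_monoid B by (rule B)
  show ?thesis using fin g
  proof (induction S rule: finite_induct)
    case empty
    then show ?case using f by simp
  next
    case (insert i S)
    then have "g \<in> S \<rightarrow> carrier A" "g i \<in> carrier A" by auto
    moreover from this have "(\<lambda>i. f (g i)) \<in> S \<rightarrow> carrier B" "f (g i) \<in> carrier B"
      using f(1) by auto
    ultimately show ?case using insert f(3) by simp
  qed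
qed

lemma (in abelian_monoid) finsum_swap:
  assumes "finite S" "finite T" "\<And>i j. i \<in> S \<Longrightarrow> j \<in> T \<Longrightarrow> f i j \<in> carrier G"
  shows "finsum G (\<lambda>i. finsum G (f i) T) S = finsum G (\<lambda>j. finsum G (\<lambda>i. f i j) S) T"
  using assms(1,3)
proof (induction S rule: finite_induct)
  case empty
  then show ?case by simp
next
  case (insert a S)
  have 1: "(\<lambda>i. finsum G (f i) T) \<in> S \<rightarrow> carrier G" "finsum G (f a) T \<in> carrier G"
    "f a \<in> T \<rightarrow> carrier G" "(\<lambda>j. finsum G (\<lambda>i. f i j) S) \<in> T \<rightarrow> carrier G"
    using insert.prems by (auto intro!: finsum_closed)
  have "finsum G (\<lambda>i. finsum G (f i) T) (insert a S)
      = finsum G (f a) T \<oplus> finsum G (\<lambda>j. finsum G (\<lambda>i. f i j) S) T"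
    using insert 1 by simp
  also have "\<dots> = finsum G (\<lambda>j. f a j \<oplus> finsum G (\<lambda>i. f i j) S) T"
    using 1 by (simp add: finsum_addf)
  also have "\<dots> = finsum G (\<lambda>j. finsum G (\<lambda>i. f i j) (insert a S)) T"
  proof (rule finsum_cong')
    fix j assume j: "j \<in> T"
    then have "(\<lambda>i. f i j) \<in> S \<rightarrow> carrier G" "f a j \<in> carrier G" using insert.prems by auto
    then show "f a j \<oplus> finsum G (\<lambda>i. f i j) S = finsum G (\<lambda>i. f i j) (insert a S)"
      using insert.hyps by simp
  qed (use insert.prems in \<open>auto intro!: finsum_closed\<close>)
  finally show ?case .
qed

lemma (in abelian_monoid) finsum_single:
  assumes "finite S" "i \<in> S" "f i \<in> carrier G" "\<And>j. j \<in> S \<Longrightarrow> j \<noteq> i \<Longrightarrow> f j = \<zero>"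
  shows "finsum G f S = f i"
proof -
  have "finsum G f S = finsum G f (insert i (S - {i}))" using assms(2) by (simp add: insert_absorb)
  also have "\<dots> = f i \<oplus> finsum G f (S - {i})"
    using assms by (intro finsum_insert) (auto simp: Pi_iff)
  also have "finsum G f (S - {i}) = \<zero>"
    using assms finsum_cong'[of "S - {i}" "S - {i}" "\<lambda>_. \<zero>" f] by (auto simp: finsum_zero)
  finally show ?thesis using assms by simp
qed

context star_algebra
begin

lemma abelian_monoid_A: "abelian_monoid A"
  by (rule abelian_monoid_axioms)

lemma finsum_adj:
  "finite S \<Longrightarrow> g \<in> S \<rightarrow> carrier A \<Longrightarrow> adj A (finsum A g S) = finsum A (\<lambda>i. adj A (g i)) S"
  by (rule finsum_hom[OF abelian_monoid_A abelian_monoid_A]) (auto simp: adj_add adj_closed)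

lemma finsum_smult:
  "finite S \<Longrightarrow> g \<in> S \<rightarrow> carrier A \<Longrightarrow> c \<odot> finsum A g S = finsum A (\<lambda>i. c \<odot> g i) S"
  by (rule finsum_hom[OF abelian_monoid_A abelian_monoid_A]) (auto simp: smult_add_right)

end

section \<open>The *-algebra of matrices\<close>

lemma mat_alg_carrier:
  "X \<in> carrier (mat_alg k A) \<longleftrightarrow>
     X \<in> carrier_mat k k \<and> (\<forall>i<k. \<forall>j<k. X $$ (i, j) \<in> carrier A)"
  unfolding mat_alg_def by (auto dest!: elements_matD intro: elements_matI)

lemma mat_alg_carrierI:
  "X \<in> carrier_mat k k \<Longrightarrow> (\<And>i j. i < k \<Longrightarrow> j < k \<Longrightarrow> X $$ (i, j) \<in> carrier A)
   \<Longrightarrow> X \<in> carrier (mat_alg k A)"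
  by (simp add: mat_alg_carrier)

lemma mat_alg_dims [simp]:
  "X \<in> carrier (mat_alg k A) \<Longrightarrow> dim_row X = k"
  "X \<in> carrier (mat_alg k A) \<Longrightarrow> dim_col X = k"
  by (auto simp: mat_alg_carrier)

lemma mat_alg_entry:
  "X \<in> carrier (mat_alg k A) \<Longrightarrow> i < k \<Longrightarrow> j < k \<Longrightarrow> X $$ (i, j) \<in> carrier A"
  by (auto simp: mat_alg_carrier)

lemma mat_alg_eqI:
  "X \<in> carrier (mat_alg k A) \<Longrightarrow> Y \<in> carrier (mat_alg k A) \<Longrightarrow>
   (\<And>i j. i < k \<Longrightarrow> j < k \<Longrightarrow> X $$ (i, j) = Y $$ (i, j)) \<Longrightarrow> X = Y"
  by (rule eq_matI) (auto simp: mat_alg_carrier)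

lemma mat_alg_entries [simp]:
  assumes "i < k" "j < k"
  shows "(X \<otimes>\<^bsub>mat_alg k A\<^esub> Y) $$ (i, j) = finsum A (\<lambda>l. X $$ (i, l) \<otimes>\<^bsub>A\<^esub> Y $$ (l, j)) {..<k}"
    and "\<one>\<^bsub>mat_alg k A\<^esub> $$ (i, j) = (if i = j then \<one>\<^bsub>A\<^esub> else \<zero>\<^bsub>A\<^esub>)"
    and "\<zero>\<^bsub>mat_alg k A\<^esub> $$ (i, j) = \<zero>\<^bsub>A\<^esub>"
    and "(X \<oplus>\<^bsub>mat_alg k A\<^esub> Y) $$ (i, j) = X $$ (i, j) \<oplus>\<^bsub>A\<^esub> Y $$ (i, j)"
    and "(c \<odot>\<^bsub>mat_alg k A\<^esub> X) $$ (i, j) = c \<odot>\<^bsub>A\<^esub> X $$ (i, j)"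
    and "adj (mat_alg k A) X $$ (i, j) = adj A (X $$ (j, i))"
  using assms by (simp_all add: mat_alg_def)

lemma mat_alg_ops_dim [simp]:
  "X \<otimes>\<^bsub>mat_alg k A\<^esub> Y \<in> carrier_mat k k"
  "\<one>\<^bsub>mat_alg k A\<^esub> \<in> carrier_mat k k"
  "\<zero>\<^bsub>mat_alg k A\<^esub> \<in> carrier_mat k k"
  "X \<oplus>\<^bsub>mat_alg k A\<^esub> Y \<in> carrier_mat k k"
  "c \<odot>\<^bsub>mat_alg k A\<^esub> X \<in> carrier_mat k k"
  "adj (mat_alg k A) X \<in> carrier_mat k k"
  by (simp_all add: mat_alg_def)

context star_algebra
begin

lemma mat_alg_ops_closed [simp]:
  "X \<in> carrier (mat_alg k A) \<Longrightarrow> Y \<in> carrier (mat_alg k A) \<Longrightarrow>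
    X \<otimes>\<^bsub>mat_alg k A\<^esub> Y \<in> carrier (mat_alg k A)"
  "\<one>\<^bsub>mat_alg k A\<^esub> \<in> carrier (mat_alg k A)"
  "\<zero>\<^bsub>mat_alg k A\<^esub> \<in> carrier (mat_alg k A)"
  "X \<in> carrier (mat_alg k A) \<Longrightarrow> Y \<in> carrier (mat_alg k A) \<Longrightarrow>
    X \<oplus>\<^bsub>mat_alg k A\<^esub> Y \<in> carrier (mat_alg k A)"
  "X \<in> carrier (mat_alg k A) \<Longrightarrow> c \<odot>\<^bsub>mat_alg k A\<^esub> X \<in> carrier (mat_alg k A)"
  "X \<in> carrier (mat_alg k A) \<Longrightarrow> adj (mat_alg k A) X \<in> carrier (mat_alg k A)"
  by (auto intro!: mat_alg_carrierI finsum_closed simp: mat_alg_entry adj_closed)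

lemma mat_alg_assoc:
  assumes X: "X \<in> carrier (mat_alg k A)" and Y: "Y \<in> carrier (mat_alg k A)"
    and Z: "Z \<in> carrier (mat_alg k A)"
  shows "(X \<otimes>\<^bsub>mat_alg k A\<^esub> Y) \<otimes>\<^bsub>mat_alg k A\<^esub> Z = X \<otimes>\<^bsub>mat_alg k A\<^esub> (Y \<otimes>\<^bsub>mat_alg k A\<^esub> Z)"
proof (rule mat_alg_eqI[where k=k and A=A])
  fix i j assume ij: "i < k" "j < k"
  note e = mat_alg_entry[OF X] mat_alg_entry[OF Y] mat_alg_entry[OF Z]
  have "((X \<otimes>\<^bsub>mat_alg k A\<^esub> Y) \<otimes>\<^bsub>mat_alg k A\<^esub> Z) $$ (i, j)
      = finsum A (\<lambda>l. finsum A (\<lambda>m. X $$ (i, m) \<otimes> (Y $$ (m, l) \<otimes> Z $$ (l, j))) {..<k}) {..<k}"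
    using ij e by (auto simp: finsum_ldistr m_assoc Pi_iff intro!: finsum_closed finsum_cong')
  also have "\<dots> = finsum A (\<lambda>m. finsum A (\<lambda>l. X $$ (i, m) \<otimes> (Y $$ (m, l) \<otimes> Z $$ (l, j))) {..<k}) {..<k}"
    using ij e by (intro finsum_swap) auto
  also have "\<dots> = (X \<otimes>\<^bsub>mat_alg k A\<^esub> (Y \<otimes>\<^bsub>mat_alg k A\<^esub> Z)) $$ (i, j)"
    using ij e by (auto simp: finsum_rdistr Pi_iff intro!: finsum_cong' finsum_closed)
  finally show "((X \<otimes>\<^bsub>mat_alg k A\<^esub> Y) \<otimes>\<^bsub>mat_alg k A\<^esub> Z) $$ (i, j)
    = (X \<otimes>\<^bsub>mat_alg k A\<^esub> (Y \<otimes>\<^bsub>mat_alg k A\<^esub> Z)) $$ (i, j)" .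
qed (use assms in simp_all)

theorem star_algebra_mat_alg: "star_algebra (mat_alg k A)"
proof (rule star_algebraI)
  let ?M = "mat_alg k A"
  show "\<And>X Y Z. X \<in> carrier ?M \<Longrightarrow> Y \<in> carrier ?M \<Longrightarrow> Z \<in> carrier ?M \<Longrightarrow>
    X \<otimes>\<^bsub>?M\<^esub> Y \<otimes>\<^bsub>?M\<^esub> Z = X \<otimes>\<^bsub>?M\<^esub> (Y \<otimes>\<^bsub>?M\<^esub> Z)" by (rule mat_alg_assoc)
  fix X assume X: "X \<in> carrier ?M"
  note e = mat_alg_entry[OF X]
  show "\<one>\<^bsub>?M\<^esub> \<otimes>\<^bsub>?M\<^esub> X = X"
  proof (rule mat_alg_eqI[where k=k and A=A])
    fix i j assume ij: "i < k" "j < k"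
    have "finsum A (\<lambda>l. \<one>\<^bsub>?M\<^esub> $$ (i, l) \<otimes> X $$ (l, j)) {..<k} = \<one>\<^bsub>?M\<^esub> $$ (i, i) \<otimes> X $$ (i, j)"
      using ij e by (intro finsum_single) auto
    then show "(\<one>\<^bsub>?M\<^esub> \<otimes>\<^bsub>?M\<^esub> X) $$ (i, j) = X $$ (i, j)" using ij e by simp
  qed (use X in simp_all)
  show "X \<otimes>\<^bsub>?M\<^esub> \<one>\<^bsub>?M\<^esub> = X"
  proof (rule mat_alg_eqI[where k=k and A=A])
    fix i j assume ij: "i < k" "j < k"
    have "finsum A (\<lambda>l. X $$ (i, l) \<otimes> \<one>\<^bsub>?M\<^esub> $$ (l, j)) {..<k} = X $$ (i, j) \<otimes> \<one>\<^bsub>?M\<^esub> $$ (j, j)"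
      using ij e by (intro finsum_single) auto
    then show "(X \<otimes>\<^bsub>?M\<^esub> \<one>\<^bsub>?M\<^esub>) $$ (i, j) = X $$ (i, j)" using ij e by simp
  qed (use X in simp_all)
  fix Y assume Y: "Y \<in> carrier ?M"
  note f = mat_alg_entry[OF Y]
  show "c \<odot>\<^bsub>?M\<^esub> X \<otimes>\<^bsub>?M\<^esub> Y = c \<odot>\<^bsub>?M\<^esub> (X \<otimes>\<^bsub>?M\<^esub> Y)" for c
    by (rule mat_alg_eqI[where k=k and A=A])
      (use X Y in \<open>auto simp: finsum_smult smult_mult_left e f Pi_iff intro!: finsum_cong'\<close>)
  show "X \<otimes>\<^bsub>?M\<^esub> (c \<odot>\<^bsub>?M\<^esub> Y) = c \<odot>\<^bsub>?M\<^esub> (X \<otimes>\<^bsub>?M\<^esub> Y)" for c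
    by (rule mat_alg_eqI[where k=k and A=A])
      (use X Y in \<open>auto simp: finsum_smult smult_mult_right e f Pi_iff intro!: finsum_cong'\<close>)
  show "adj ?M (X \<otimes>\<^bsub>?M\<^esub> Y) = adj ?M Y \<otimes>\<^bsub>?M\<^esub> adj ?M X"
    by (rule mat_alg_eqI[where k=k and A=A])
      (use X Y in \<open>auto simp: finsum_adj adj_mult adj_closed e f Pi_iff intro!: finsum_cong'\<close>)
  show "X \<oplus>\<^bsub>?M\<^esub> Y = Y \<oplus>\<^bsub>?M\<^esub> X"
    by (rule mat_alg_eqI[where k=k and A=A]) (use X Y in \<open>auto simp: e f a_comm\<close>)
  fix Z assume Z: "Z \<in> carrier ?M"
  note g = mat_alg_entry[OF Z]
  show "(X \<oplus>\<^bsub>?M\<^esub> Y) \<otimes>\<^bsub>?M\<^esub> Z = X \<otimes>\<^bsub>?M\<^esub> Z \<oplus>\<^bsub>?M\<^esub> Y \<otimes>\<^bsub>?M\<^esub> Z"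
    by (rule mat_alg_eqI[where k=k and A=A])
      (use X Y Z in \<open>auto simp del: finsum_addf simp: finsum_addf[symmetric] l_distr e f g Pi_iff intro!: finsum_cong'\<close>)
  show "Z \<otimes>\<^bsub>?M\<^esub> (X \<oplus>\<^bsub>?M\<^esub> Y) = Z \<otimes>\<^bsub>?M\<^esub> X \<oplus>\<^bsub>?M\<^esub> Z \<otimes>\<^bsub>?M\<^esub> Y"
    by (rule mat_alg_eqI[where k=k and A=A])
      (use X Y Z in \<open>auto simp del: finsum_addf simp: finsum_addf[symmetric] r_distr e f g Pi_iff intro!: finsum_cong'\<close>)
  show "(X \<oplus>\<^bsub>?M\<^esub> Y) \<oplus>\<^bsub>?M\<^esub> Z = X \<oplus>\<^bsub>?M\<^esub> (Y \<oplus>\<^bsub>?M\<^esub> Z)"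
    by (rule mat_alg_eqI[where k=k and A=A]) (use X Y Z in \<open>auto simp: e f g a_assoc\<close>)
qed (auto simp: mat_alg_entry smult_add_left smult_add_right
    smult_smult adj_adj adj_add adj_smult intro!: mat_alg_eqI[where k=k and A=A])

end

section \<open>The C*-norm of a matrix algebra\<close>

lemma (in star_algebra) bounds_zero: "0 \<le> t \<Longrightarrow> t \<in> bounds \<zero>"
  using sos_rsc[of "t\<^sup>2"] by (simp add: bounds_def a_minus_def)

lemma (in star_algebra) bounds_finsum:
  assumes e: "0 < e"
  shows "finite S \<Longrightarrow> (\<And>i. i \<in> S \<Longrightarrow> g i \<in> carrier A \<and> 0 < r i \<and> r i \<in> bounds (g i)) \<Longrightarrow>
    e + sum r S \<in> bounds (finsum A g S)"
proof (induction S rule: finite_induct)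
  case empty
  then show ?case using e by (simp add: bounds_zero)
next
  case (insert i S)
  have "0 \<le> sum r S" using insert.prems by (intro sum_nonneg) force
  then have "r i + (e + sum r S) \<in> bounds (g i \<oplus> finsum A g S)"
    using insert e by (intro bounds_add finsum_closed) auto
  then show ?case using insert by (simp add: Pi_iff add.left_commute)
qed

definition mat_at :: "('a, 'x) star_alg_scheme \<Rightarrow> nat \<Rightarrow> nat \<Rightarrow> nat \<Rightarrow> 'a \<Rightarrow> 'a mat" where
  "mat_at A k i j b = mat k k (\<lambda>p. if p = (i, j) then b else \<zero>\<^bsub>A\<^esub>)"

lemma mat_at_entry [simp]:
  "a < k \<Longrightarrow> c < k \<Longrightarrow> mat_at A k i j b $$ (a, c) = (if a = i \<and> c = j then b else \<zero>\<^bsub>A\<^esub>)"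
  by (simp add: mat_at_def)

lemma (in star_algebra) mat_at_closed [simp]:
  "b \<in> carrier A \<Longrightarrow> mat_at A k i j b \<in> carrier (mat_alg k A)"
  by (auto simp: mat_alg_carrier) (simp add: mat_at_def)

lemma (in star_algebra) mat_alg_finsum_entry:
  assumes "finite S" "g \<in> S \<rightarrow> carrier (mat_alg k A)" "i < k" "j < k"
  shows "finsum (mat_alg k A) g S $$ (i, j) = finsum A (\<lambda>p. g p $$ (i, j)) S"
proof -
  interpret M: star_algebra "mat_alg k A" by (rule star_algebra_mat_alg)
  show ?thesis
    by (rule finsum_hom[OF M.abelian_monoid_A abelian_monoid_A])
      (use assms in \<open>auto simp: mat_alg_entry\<close>)
qed

lemma (in star_algebra) mat_alg_decompose:
  assumes X: "X \<in> carrier (mat_alg k A)"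
  shows "finsum (mat_alg k A) (\<lambda>(i, j). mat_at A k i j (X $$ (i, j))) ({..<k} \<times> {..<k}) = X"
proof -
  interpret M: star_algebra "mat_alg k A" by (rule star_algebra_mat_alg)
  let ?g = "\<lambda>(i, j). mat_at A k i j (X $$ (i, j))"
  have g: "?g \<in> {..<k} \<times> {..<k} \<rightarrow> carrier (mat_alg k A)"
    using mat_alg_entry[OF X] by auto
  show ?thesis
  proof (rule mat_alg_eqI[where k=k and A=A])
    fix a b assume ab: "a < k" "b < k"
    have "finsum (mat_alg k A) ?g ({..<k} \<times> {..<k}) $$ (a, b)
        = finsum A (\<lambda>p. ?g p $$ (a, b)) ({..<k} \<times> {..<k})"
      using ab g by (intro mat_alg_finsum_entry) simp_all
    also have "\<dots> = ?g (a, b) $$ (a, b)"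
      using ab mat_alg_entry[OF X] by (intro finsum_single) (auto split: prod.splits)
    finally show "finsum (mat_alg k A) ?g ({..<k} \<times> {..<k}) $$ (a, b) = X $$ (a, b)"
      using ab by simp
  qed (use X g in \<open>simp_all add: M.finsum_closed\<close>)
qed

context cstar_norm
begin

lemma npos_finsum:
  "finite S \<Longrightarrow> (\<And>i. i \<in> S \<Longrightarrow> npos (g i)) \<Longrightarrow> npos (finsum A g S)"
proof (induction S rule: finite_induct)
  case (insert i S)
  then have "npos (g i \<oplus> finsum A g S)" by (intro npos_add) auto
  then show ?case using insert by (simp add: Pi_iff)
qed simp

text \<open>
  The diagonal entries of \<open>X\<^sup>* X\<close> are \<open>\<Sum>\<^sub>l X\<^sub>l\<^sub>j\<^sup>* X\<^sub>l\<^sub>j\<close>. This is how information about sums of squares of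
  matrices returns to the entries.
\<close>

lemma mat_sos_diag_npos:
  assumes j: "j < k"
  shows "S \<in> star_algebra.sos (mat_alg k A) \<Longrightarrow> npos (S $$ (j, j))"
proof -
  interpret M: star_algebra "mat_alg k A" by (rule star_algebra_mat_alg)
  show "S \<in> M.sos \<Longrightarrow> npos (S $$ (j, j))"
  proof (induction rule: M.sos.induct)
    case (sos_step X S)
    have "npos (finsum A (\<lambda>l. adj A (X $$ (l, j)) \<otimes> X $$ (l, j)) {..<k})"
      using mat_alg_entry[OF sos_step(1)] j by (intro npos_finsum npos_star_square) auto
    moreover have "finsum A (\<lambda>l. adj (mat_alg k A) X $$ (j, l) \<otimes> X $$ (l, j)) {..<k}
        = finsum A (\<lambda>l. adj A (X $$ (l, j)) \<otimes> X $$ (l, j)) {..<k}"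
      using mat_alg_entry[OF sos_step(1)] j by (intro finsum_cong') (auto simp: adj_closed)
    ultimately show ?case using j sos_step by (simp add: npos_add)
  qed (use j in simp)
qed

text \<open>
  The \<open>(j, j)\<close> entry of \<open>t\<^sup>2 - X\<^sup>* X\<close> shows that \<open>t\<^sup>2 - X\<^sub>i\<^sub>j\<^sup>* X\<^sub>i\<^sub>j\<close> is positive.
\<close>

lemma mat_bounds_entry:
  assumes X: "X \<in> carrier (mat_alg k A)" and t: "t \<in> star_algebra.bounds (mat_alg k A) X"
    and ij: "i < k" "j < k"
  shows "N (X $$ (i, j)) \<le> t"
proof -
  interpret M: star_algebra "mat_alg k A" by (rule star_algebra_mat_alg)
  note e = mat_alg_entry[OF X]
  let ?q = "\<lambda>l. adj A (X $$ (l, j)) \<otimes> X $$ (l, j)"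
  have q: "?q l \<in> carrier A" if "l < k" for l using e that ij by (simp add: adj_closed)
  have t0: "0 \<le> t" and sos: "M.rsc (t\<^sup>2) \<ominus>\<^bsub>mat_alg k A\<^esub> adj (mat_alg k A) X \<otimes>\<^bsub>mat_alg k A\<^esub> X \<in> M.sos"
    using t by (simp_all add: M.bounds_def)
  define R where "R = finsum A ?q ({..<k} - {i})"
  have "finsum A (\<lambda>l. adj (mat_alg k A) X $$ (j, l) \<otimes> X $$ (l, j)) {..<k} = finsum A ?q {..<k}"
    using q ij by (intro finsum_cong') auto
  also have "\<dots> = finsum A ?q (insert i ({..<k} - {i}))" using ij by (simp add: insert_absorb)
  also have "\<dots> = ?q i \<oplus> R"
    unfolding R_def using q ij by (intro finsum_insert) auto
  finally have sum: "finsum A (\<lambda>l. adj (mat_alg k A) X $$ (j, l) \<otimes> X $$ (l, j)) {..<k} = ?q i \<oplus> R" .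
  have R: "npos R" unfolding R_def using e ij by (intro npos_finsum npos_star_square) auto
  have "npos (rsc (t\<^sup>2) \<oplus> (-1) \<odot> (?q i \<oplus> R))"
    using mat_sos_diag_npos[OF ij(2) sos] ij X by (simp add: M.a_minus_smult sum)
  then have "npos ((rsc (t\<^sup>2) \<oplus> (-1) \<odot> (?q i \<oplus> R)) \<oplus> R)" using R by (rule npos_add)
  moreover have "(rsc (t\<^sup>2) \<oplus> (-1) \<odot> (?q i \<oplus> R)) \<oplus> R = rsc (t\<^sup>2) \<ominus> ?q i"
    by (rule nc_identity[where vs="[X $$ (i, j), adj A (X $$ (i, j)), R]"], (rule nc_rules)+)
      (simp_all add: e ij adj_closed R)
  ultimately have "N (?q i) \<le> \<bar>t\<^sup>2\<bar>"
    using e ij by (intro npos_nrm_le npos_star_square) simp_all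
  then have "(N (X $$ (i, j)))\<^sup>2 \<le> t\<^sup>2" using cstar_identity[OF e[OF ij]] by simp
  then show ?thesis using t0 by (rule power2_le_imp_le)
qed

text \<open>
  Only the \<open>(j, j)\<close> entry of \<open>X\<^sup>* X\<close> is nonzero, and it is \<open>b\<^sup>* b\<close>. So \<open>t\<^sup>2 - X\<^sup>* X\<close> is diagonal, hence the square of
  the diagonal matrix \<open>Y\<close> with a root of \<open>t\<^sup>2 - b\<^sup>* b\<close> at position \<open>j\<close> and \<open>t\<close> elsewhere.
\<close>

lemma mat_at_bounds:
  assumes b: "b \<in> carrier A" and ij: "i < k" "j < k" and t: "N b \<le> t"
  shows "t \<in> star_algebra.bounds (mat_alg k A) (mat_at A k i j b)"
proof -
  let ?M = "mat_alg k A"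
  interpret M: star_algebra ?M by (rule star_algebra_mat_alg)
  have t0: "0 \<le> t" using nrm_nonneg[OF b] t by simp
  have bb: "adj A b \<otimes> b \<in> carrier A" using b by (simp add: adj_closed)
  have "npos (rsc (t\<^sup>2) \<ominus> adj A b \<otimes> b)"
    using b t nrm_nonneg[OF b] power_mono[of "N b" t 2]
    by (intro npos_rsc_minus) (simp_all add: cstar_identity adj_mult adj_adj adj_closed)
  then obtain c where c: "npos c" "c \<otimes> c = rsc (t\<^sup>2) \<ominus> adj A b \<otimes> b" using npos_sqrt by blast
  define X where "X = mat_at A k i j b"
  define d where "d l = (if l = j then c else rsc t)" for l
  have d: "d l \<in> carrier A" for l using c by (simp add: d_def)
  define Y where "Y = mat k k (\<lambda>(l, m). if l = m then d l else \<zero>)"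
  have X: "X \<in> carrier ?M" using b by (simp add: X_def)
  have Y: "Y \<in> carrier ?M" using d by (auto simp: Y_def mat_alg_carrier)
  have "M.rsc (t\<^sup>2) \<ominus>\<^bsub>?M\<^esub> adj ?M X \<otimes>\<^bsub>?M\<^esub> X = adj ?M Y \<otimes>\<^bsub>?M\<^esub> Y"
  proof (rule mat_alg_eqI[where k=k and A=A])
    fix l m assume lm: "l < k" "m < k"
    have "finsum A (\<lambda>p. adj ?M X $$ (l, p) \<otimes> X $$ (p, m)) {..<k} = adj ?M X $$ (l, i) \<otimes> X $$ (i, m)"
      using lm ij b by (intro finsum_single) (auto simp: X_def adj_closed)
    then have xx: "finsum A (\<lambda>p. adj ?M X $$ (l, p) \<otimes> X $$ (p, m)) {..<k}
        = (if l = j \<and> m = j then adj A b \<otimes> b else \<zero>)"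
      using lm ij b by (auto simp: X_def adj_closed)
    have "finsum A (\<lambda>p. adj ?M Y $$ (l, p) \<otimes> Y $$ (p, m)) {..<k} = adj ?M Y $$ (l, l) \<otimes> Y $$ (l, m)"
      using lm d by (intro finsum_single) (auto simp: Y_def adj_closed)
    then have yy: "finsum A (\<lambda>p. adj ?M Y $$ (l, p) \<otimes> Y $$ (p, m)) {..<k}
        = (if l = m then adj A (d l) \<otimes> d l else \<zero>)"
      using lm d by (auto simp: Y_def adj_closed)
    have dd: "adj A (d l) \<otimes> d l = (if l = j then rsc (t\<^sup>2) \<ominus> adj A b \<otimes> b else rsc (t\<^sup>2))" for l
      using c by (simp add: d_def npos_sa smult_mult_left smult_smult power2_eq_square)
    show "(M.rsc (t\<^sup>2) \<ominus>\<^bsub>?M\<^esub> adj ?M X \<otimes>\<^bsub>?M\<^esub> X) $$ (l, m) = (adj ?M Y \<otimes>\<^bsub>?M\<^esub> Y) $$ (l, m)"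
      using lm X bb by (simp add: M.a_minus_smult xx yy dd a_minus_smult)
  qed (use X Y in simp_all)
  then show ?thesis using M.sos_square[OF Y] t0 by (simp add: M.bounds_def X_def)
qed

text \<open>
  \<open>X\<close> is the sum of its \<open>k\<^sup>2\<close> entries placed in zero matrices, each bounded by \<open>d\<close>. The additional \<open>d\<close> keeps the
  bound positive when \<open>k = 0\<close>.
\<close>

lemma mat_bounds_entrywise:
  assumes X: "X \<in> carrier (mat_alg k A)" and d: "0 < d"
    and le: "\<And>i j. i < k \<Longrightarrow> j < k \<Longrightarrow> N (X $$ (i, j)) \<le> d"
  shows "(1 + real (k * k)) * d \<in> star_algebra.bounds (mat_alg k A) X"
proof -
  interpret M: star_algebra "mat_alg k A" by (rule star_algebra_mat_alg)
  have "d + (\<Sum>p\<in>{..<k} \<times> {..<k}. d) \<in> M.bounds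
      (finsum (mat_alg k A) (\<lambda>(i, j). mat_at A k i j (X $$ (i, j))) ({..<k} \<times> {..<k}))"
    using d le mat_alg_entry[OF X] by (intro M.bounds_finsum) (auto intro: mat_at_bounds)
  then show ?thesis unfolding mat_alg_decompose[OF X]
    by (simp add: algebra_simps)
qed

lemma archimedean_mat_alg: "archimedean_star_algebra (mat_alg k A)"
proof -
  interpret M: star_algebra "mat_alg k A" by (rule star_algebra_mat_alg)
  show ?thesis
  proof
    fix X assume X: "X \<in> carrier (mat_alg k A)"
    note e = mat_alg_entry[OF X]
    define d where "d = 1 + (\<Sum>p\<in>{..<k} \<times> {..<k}. N (X $$ p))"
    have nonneg: "0 \<le> N (X $$ p)" if "p \<in> {..<k} \<times> {..<k}" for p
      using that by (cases p) (simp add: nrm_nonneg[OF e])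
    have le: "N (X $$ (i, j)) \<le> d" if "i < k" "j < k" for i j
    proof -
      have "N (X $$ (i, j)) \<le> (\<Sum>p\<in>{..<k} \<times> {..<k}. N (X $$ p))"
        by (rule member_le_sum) (use that nonneg in simp_all)
      then show ?thesis by (simp add: d_def)
    qed
    have "0 \<le> (\<Sum>p\<in>{..<k} \<times> {..<k}. N (X $$ p))"
      by (rule sum_nonneg) (rule nonneg)
    then have "0 < d" by (simp add: d_def)
    then have "(1 + real (k * k)) * d \<in> M.bounds X" using le by (intro mat_bounds_entrywise X)
    then show "M.bounds X \<noteq> {}" by blast
    assume all: "\<And>t. 0 < t \<Longrightarrow> t \<in> M.bounds X"
    have small: "N (X $$ (i, j)) \<le> t" if "0 < t" "i < k" "j < k" for i j t
      by (rule mat_bounds_entry[OF X _ that(2,3)]) (rule all[OF that(1)])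
    have "X $$ (i, j) = \<zero>" if ij: "i < k" "j < k" for i j
    proof -
      have "N (X $$ (i, j)) \<le> 0" by (rule dense_ge) (rule small[OF _ ij])
      then show ?thesis using nrm_nonneg[OF e[OF ij]] nrm_eq_0[OF e[OF ij]] by simp
    qed
    then show "X = \<zero>\<^bsub>mat_alg k A\<^esub>" by (intro mat_alg_eqI[where A=A and k=k] X) simp_all
  qed
qed

text \<open>
  The estimates between \<open>sos_norm\<close> and the norms of the entries reduce completeness to that of \<open>A\<close>.
\<close>

theorem cstar_norm_mat_alg:
  "cstar_norm (mat_alg k A) (star_algebra.sos_norm (mat_alg k A))"
proof -
  interpret M: archimedean_star_algebra "mat_alg k A" by (rule archimedean_mat_alg)
  show ?thesis
  proof (rule M.cstar_norm_sos_norm)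
    fix X :: "nat \<Rightarrow> 'a mat"
    assume X: "\<And>n. X n \<in> carrier (mat_alg k A)"
      and cauchy: "\<And>e. e > 0 \<Longrightarrow> \<exists>M. \<forall>i\<ge>M. \<forall>j\<ge>M. M.sos_norm (X i \<ominus>\<^bsub>mat_alg k A\<^esub> X j) < e"
    note e = mat_alg_entry[OF X]
    have entry_minus: "(Y \<ominus>\<^bsub>mat_alg k A\<^esub> Z) $$ (i, j) = Y $$ (i, j) \<ominus> Z $$ (i, j)"
      if "Y \<in> carrier (mat_alg k A)" "Z \<in> carrier (mat_alg k A)" "i < k" "j < k" for Y Z i j
      using that by (simp add: M.a_minus_smult a_minus_smult mat_alg_entry)
    have ex: "\<exists>l\<in>carrier A. (\<lambda>n. N (X n $$ (i, j) \<ominus> l)) \<longlonglongrightarrow> 0" if ij: "i < k" "j < k" for i j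
    proof (rule complete)
      show "X n $$ (i, j) \<in> carrier A" for n using e ij by simp
      fix r :: real assume "r > 0"
      then obtain M where M: "\<And>m n. m \<ge> M \<Longrightarrow> n \<ge> M \<Longrightarrow>
          M.sos_norm (X m \<ominus>\<^bsub>mat_alg k A\<^esub> X n) < r / 2" using cauchy[of "r / 2"] by auto
      have "N (X m $$ (i, j) \<ominus> X n $$ (i, j)) < r" if "m \<ge> M" "n \<ge> M" for m n
      proof -
        have "r / 2 \<in> M.bounds (X m \<ominus>\<^bsub>mat_alg k A\<^esub> X n)"
          using M[OF that] X by (intro M.bounds_if_sos_norm_less) simp_all
        then have "N ((X m \<ominus>\<^bsub>mat_alg k A\<^esub> X n) $$ (i, j)) \<le> r / 2"
          using X ij by (intro mat_bounds_entry) simp_all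
        then show ?thesis using \<open>r > 0\<close> X ij by (simp add: entry_minus)
      qed
      then show "\<exists>M. \<forall>m\<ge>M. \<forall>n\<ge>M. N (X m $$ (i, j) \<ominus> X n $$ (i, j)) < r" by blast
    qed
    define l where "l i j = (SOME l. l \<in> carrier A \<and> (\<lambda>n. N (X n $$ (i, j) \<ominus> l)) \<longlonglongrightarrow> 0)" for i j
    have "l i j \<in> carrier A \<and> (\<lambda>n. N (X n $$ (i, j) \<ominus> l i j)) \<longlonglongrightarrow> 0" if "i < k" "j < k" for i j
      unfolding l_def by (rule someI_ex) (use ex[OF that] in blast)
    then have l: "\<And>i j. i < k \<Longrightarrow> j < k \<Longrightarrow> l i j \<in> carrier A"
      and lim: "\<And>i j. i < k \<Longrightarrow> j < k \<Longrightarrow> (\<lambda>n. N (X n $$ (i, j) \<ominus> l i j)) \<longlonglongrightarrow> 0"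
      by blast+
    define L where "L = mat k k (\<lambda>(i, j). l i j)"
    have L: "L \<in> carrier (mat_alg k A)" using l by (auto simp: L_def mat_alg_carrier)
    have "(\<lambda>n. M.sos_norm (X n \<ominus>\<^bsub>mat_alg k A\<^esub> L)) \<longlonglongrightarrow> 0"
    proof (rule LIMSEQ_I)
      fix r :: real assume r: "0 < r"
      define c where "c = 1 + real (k * k)"
      have c: "0 < c" unfolding c_def by (rule add_pos_nonneg) simp_all
      define d where "d = r / (2 * c)"
      have d: "0 < d" "(1 + real (k * k)) * d < r"
        using r c unfolding c_def[symmetric] by (simp_all add: d_def)
      have "\<forall>\<^sub>F n in sequentially. \<forall>p\<in>{..<k} \<times> {..<k}. N (X n $$ p \<ominus> l (fst p) (snd p)) < d"
      proof (rule eventually_ball_finite)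
        show "\<forall>p\<in>{..<k} \<times> {..<k}. \<forall>\<^sub>F n in sequentially. N (X n $$ p \<ominus> l (fst p) (snd p)) < d"
          using order_tendstoD(2)[OF lim d(1)] by auto
      qed simp
      then obtain n0 where "\<forall>n\<ge>n0. \<forall>p\<in>{..<k} \<times> {..<k}. N (X n $$ p \<ominus> l (fst p) (snd p)) < d"
        unfolding eventually_sequentially by blast
      then have n0: "\<And>n i j. n \<ge> n0 \<Longrightarrow> i < k \<Longrightarrow> j < k \<Longrightarrow> N (X n $$ (i, j) \<ominus> l i j) < d"
        by force
      have "M.sos_norm (X n \<ominus>\<^bsub>mat_alg k A\<^esub> L) < r" if "n \<ge> n0" for n
      proof -
        have "(1 + real (k * k)) * d \<in> M.bounds (X n \<ominus>\<^bsub>mat_alg k A\<^esub> L)"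
        proof (rule mat_bounds_entrywise)
          show "N ((X n \<ominus>\<^bsub>mat_alg k A\<^esub> L) $$ (i, j)) \<le> d" if "i < k" "j < k" for i j
            using n0[OF \<open>n \<ge> n0\<close> that] X L that by (simp add: entry_minus) (simp add: L_def)
        qed (use X L d in simp_all)
        then show ?thesis using M.sos_norm_le d(2) by force
      qed
      then show "\<exists>n0. \<forall>n\<ge>n0. norm (M.sos_norm (X n \<ominus>\<^bsub>mat_alg k A\<^esub> L) - 0) < r"
        using M.sos_norm_nonneg X L by (intro exI[of _ n0]) simp
    qed
    then show "\<exists>L\<in>carrier (mat_alg k A). (\<lambda>n. M.sos_norm (X n \<ominus>\<^bsub>mat_alg k A\<^esub> L)) \<longlonglongrightarrow> 0"
      using L by blast
  qed
qed

end

lemma cstar_norm_complex: "cstar_norm complex_alg cmod"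
proof -
  have star: "star_algebra complex_alg"
    by (rule star_algebraI) (simp_all add: algebra_simps)
  interpret C: star_algebra complex_alg by (rule star)
  have minus: "x \<ominus>\<^bsub>complex_alg\<^esub> y = x - y" for x y
    by (simp add: C.a_minus_smult)
  show ?thesis
  proof
    fix x :: "nat \<Rightarrow> complex"
    assume "\<And>e. e > 0 \<Longrightarrow> \<exists>M. \<forall>i\<ge>M. \<forall>j\<ge>M. cmod (x i \<ominus>\<^bsub>complex_alg\<^esub> x j) < e"
    then have "Cauchy x" unfolding Cauchy_def minus dist_norm by blast
    then obtain l where "x \<longlonglongrightarrow> l" using Cauchy_convergent_iff convergent_def by blast
    then have "(\<lambda>i. cmod (x i - l)) \<longlonglongrightarrow> 0" by (intro tendsto_norm_zero LIM_zero)
    then show "\<exists>l\<in>carrier complex_alg. (\<lambda>i. cmod (x i \<ominus>\<^bsub>complex_alg\<^esub> l)) \<longlonglongrightarrow> 0"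
      by (auto simp: minus)
  qed (simp_all add: norm_triangle_ineq norm_mult power2_eq_square)
qed

section \<open>Copies along an injection\<close>

text \<open>
  Transport of the structure along an injective \<open>h\<close>, with a norm added. It turns a normed *-algebra into
  a C*-algebra record on a prescribed type; the operations are given by their values on the
  range of \<open>h\<close>.
\<close>

definition normed_copy ::
  "('a \<Rightarrow> 'c) \<Rightarrow> ('a \<Rightarrow> real) \<Rightarrow> ('a, 'x) star_alg_scheme \<Rightarrow> 'c normed_star_alg" where
  "normed_copy h N A =
     \<lparr>carrier = h ` carrier A,
      monoid.mult = (\<lambda>x y. h (inv_into UNIV h x \<otimes>\<^bsub>A\<^esub> inv_into UNIV h y)),
      one = h \<one>\<^bsub>A\<^esub>,
      ring.zero = h \<zero>\<^bsub>A\<^esub>,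
      add = (\<lambda>x y. h (inv_into UNIV h x \<oplus>\<^bsub>A\<^esub> inv_into UNIV h y)),
      smult = (\<lambda>c x. h (c \<odot>\<^bsub>A\<^esub> inv_into UNIV h x)),
      adj = (\<lambda>x. h (adj A (inv_into UNIV h x))),
      nrm = (\<lambda>x. N (inv_into UNIV h x))\<rparr>"

lemma normed_copy_simps:
  assumes "inj h"
  shows "carrier (normed_copy h N A) = h ` carrier A"
    and "h x \<otimes>\<^bsub>normed_copy h N A\<^esub> h y = h (x \<otimes>\<^bsub>A\<^esub> y)"
    and "\<one>\<^bsub>normed_copy h N A\<^esub> = h \<one>\<^bsub>A\<^esub>"
    and "\<zero>\<^bsub>normed_copy h N A\<^esub> = h \<zero>\<^bsub>A\<^esub>"
    and "h x \<oplus>\<^bsub>normed_copy h N A\<^esub> h y = h (x \<oplus>\<^bsub>A\<^esub> y)"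
    and "c \<odot>\<^bsub>normed_copy h N A\<^esub> h x = h (c \<odot>\<^bsub>A\<^esub> x)"
    and "adj (normed_copy h N A) (h x) = h (adj A x)"
    and "nrm (normed_copy h N A) (h x) = N x"
  using assms by (simp_all add: normed_copy_def)

lemma (in cstar_norm) unital_cstar_algebra_copy:
  fixes h :: "'a \<Rightarrow> 'c"
  assumes h: "inj h"
  shows "unital_cstar_algebra (normed_copy h N A)"
proof -
  let ?C = "normed_copy h N A"
  note s = normed_copy_simps[OF h]
  have star: "star_algebra ?C"
    by (rule star_algebraI)
      (auto simp: s a_assoc m_assoc l_distr r_distr smult_add_left smult_add_right
        smult_smult smult_mult_left smult_mult_right adj_closed adj_adj adj_add adj_smult adj_mult
        intro!: arg_cong[of _ _ h] a_comm)
  interpret C: star_algebra ?C by (rule star)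
  have minus: "h x \<ominus>\<^bsub>?C\<^esub> h y = h (x \<ominus> y)" if "x \<in> carrier A" "y \<in> carrier A" for x y
    using that by (simp add: C.a_minus_smult a_minus_smult s)
  have "cstar_norm ?C (nrm ?C)"
  proof
    fix x :: "nat \<Rightarrow> 'c"
    assume x: "\<And>i. x i \<in> carrier ?C"
      and cauchy: "\<And>e. e > 0 \<Longrightarrow> \<exists>M. \<forall>i\<ge>M. \<forall>j\<ge>M. nrm ?C (x i \<ominus>\<^bsub>?C\<^esub> x j) < e"
    from x have "\<forall>i. \<exists>y\<in>carrier A. x i = h y" by (auto simp: s)
    then obtain y where y: "\<And>i. y i \<in> carrier A" "\<And>i. x i = h (y i)" by metis
    have "\<exists>l\<in>carrier A. (\<lambda>i. N (y i \<ominus> l)) \<longlonglongrightarrow> 0"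
      using cauchy by (intro complete) (simp_all add: y minus s)
    then show "\<exists>l\<in>carrier ?C. (\<lambda>i. nrm ?C (x i \<ominus>\<^bsub>?C\<^esub> l)) \<longlonglongrightarrow> 0"
      by (auto simp: y minus s)
  qed (auto simp: s nrm_nonneg nrm_eq_0 nrm_triangle nrm_smult nrm_mult cstar_identity inj_eq[OF h])
  then show ?thesis by (simp add: unital_cstar_algebra_iff)
qed

section \<open>Pairings of *-algebras\<close>

lemma (in abelian_monoid) finsum_cartesian:
  assumes "finite S" "finite T" "\<And>i j. i \<in> S \<Longrightarrow> j \<in> T \<Longrightarrow> f (i, j) \<in> carrier G"
  shows "finsum G f (S \<times> T) = finsum G (\<lambda>i. finsum G (\<lambda>j. f (i, j)) T) S"
  using assms(1,3)
proof (induction S rule: finite_induct)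
  case (insert a S)
  have "insert a S \<times> T = Pair a ` T \<union> S \<times> T" by auto
  then have "finsum G f (insert a S \<times> T) = finsum G f (Pair a ` T) \<oplus> finsum G f (S \<times> T)"
    using insert assms(2) by (simp only:) (intro finsum_Un_disjoint, auto)
  also have "finsum G f (Pair a ` T) = finsum G (\<lambda>j. f (a, j)) T"
    using insert by (intro finsum_reindex) (auto intro: inj_onI)
  also have "finsum G f (S \<times> T) = finsum G (\<lambda>i. finsum G (\<lambda>j. f (i, j)) T) S"
    using insert by simp
  finally show ?case using insert by (simp add: Pi_iff)
qed simp

text \<open>
  \<open>\<Sum>\<^sub>i\<^sub>j\<^sub>p w\<^sub>p\<^sub>i\<^sup>* w\<^sub>p\<^sub>j = \<Sum>\<^sub>p (\<Sum>\<^sub>i w\<^sub>p\<^sub>i)\<^sup>* (\<Sum>\<^sub>j w\<^sub>p\<^sub>j)\<close>, by interchanging the sums.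
\<close>

lemma (in star_algebra) finsum_gram:
  assumes P: "finite P" and J: "finite J" and w: "\<And>p i. p \<in> P \<Longrightarrow> i \<in> J \<Longrightarrow> w p i \<in> carrier A"
  shows "finsum A (\<lambda>i. finsum A (\<lambda>j. finsum A (\<lambda>p. adj A (w p i) \<otimes> w p j) P) J) J
    = finsum A (\<lambda>p. adj A (finsum A (w p) J) \<otimes> finsum A (w p) J) P"
proof -
  have c: "adj A (w p i) \<otimes> w p j \<in> carrier A" if "p \<in> P" "i \<in> J" "j \<in> J" for p i j
    using w that by (simp add: adj_closed)
  have "finsum A (\<lambda>i. finsum A (\<lambda>j. finsum A (\<lambda>p. adj A (w p i) \<otimes> w p j) P) J) J
      = finsum A (\<lambda>i. finsum A (\<lambda>p. finsum A (\<lambda>j. adj A (w p i) \<otimes> w p j) J) P) J"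
    using P J c by (intro finsum_cong' finsum_swap) (auto intro!: finsum_closed)
  also have "\<dots> = finsum A (\<lambda>p. finsum A (\<lambda>i. finsum A (\<lambda>j. adj A (w p i) \<otimes> w p j) J) J) P"
    using P J c by (intro finsum_swap) (auto intro!: finsum_closed)
  also have "\<dots> = finsum A (\<lambda>p. adj A (finsum A (w p) J) \<otimes> finsum A (w p) J) P"
  proof (rule finsum_cong')
    fix p assume p: "p \<in> P"
    have wp: "w p \<in> J \<rightarrow> carrier A" "(\<lambda>i. adj A (w p i)) \<in> J \<rightarrow> carrier A"
      using w p by (auto simp: adj_closed)
    have "adj A (finsum A (w p) J) \<otimes> finsum A (w p) J
        = finsum A (\<lambda>i. adj A (w p i) \<otimes> finsum A (w p) J) J"
      using J wp by (simp add: finsum_adj finsum_ldistr finsum_closed)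
    also have "\<dots> = finsum A (\<lambda>i. finsum A (\<lambda>j. adj A (w p i) \<otimes> w p j) J) J"
      using J wp c p by (intro finsum_cong') (auto simp: finsum_rdistr Pi_iff intro!: finsum_closed)
    finally show "finsum A (\<lambda>i. finsum A (\<lambda>j. adj A (w p i) \<otimes> w p j) J) J
      = adj A (finsum A (w p) J) \<otimes> finsum A (w p) J" by simp
  qed (use w in \<open>auto simp: adj_closed intro!: finsum_closed\<close>)
  finally show ?thesis .
qed

text \<open>
  Equivalently, a *-homomorphism from the algebraic tensor product of \<open>A\<close> and \<open>B\<close> to \<open>C\<close>.
\<close>

locale star_pairing = A: star_algebra A + B: star_algebra B + C: star_algebra C
  for A :: "('a, 'x) star_alg_scheme" and B :: "('b, 'y) star_alg_scheme"
    and C :: "('c, 'z) star_alg_scheme" +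
  fixes \<beta> :: "'a \<Rightarrow> 'b \<Rightarrow> 'c"
  assumes closed: "a \<in> carrier A \<Longrightarrow> b \<in> carrier B \<Longrightarrow> \<beta> a b \<in> carrier C"
    and add_left: "a \<in> carrier A \<Longrightarrow> a' \<in> carrier A \<Longrightarrow> b \<in> carrier B \<Longrightarrow>
      \<beta> (a \<oplus>\<^bsub>A\<^esub> a') b = \<beta> a b \<oplus>\<^bsub>C\<^esub> \<beta> a' b"
    and add_right: "a \<in> carrier A \<Longrightarrow> b \<in> carrier B \<Longrightarrow> b' \<in> carrier B \<Longrightarrow>
      \<beta> a (b \<oplus>\<^bsub>B\<^esub> b') = \<beta> a b \<oplus>\<^bsub>C\<^esub> \<beta> a b'"
    and smult_left: "a \<in> carrier A \<Longrightarrow> b \<in> carrier B \<Longrightarrow> \<beta> (c \<odot>\<^bsub>A\<^esub> a) b = c \<odot>\<^bsub>C\<^esub> \<beta> a b"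
    and smult_right: "a \<in> carrier A \<Longrightarrow> b \<in> carrier B \<Longrightarrow> \<beta> a (c \<odot>\<^bsub>B\<^esub> b) = c \<odot>\<^bsub>C\<^esub> \<beta> a b"
    and mult: "a \<in> carrier A \<Longrightarrow> a' \<in> carrier A \<Longrightarrow> b \<in> carrier B \<Longrightarrow> b' \<in> carrier B \<Longrightarrow>
      \<beta> (a \<otimes>\<^bsub>A\<^esub> a') (b \<otimes>\<^bsub>B\<^esub> b') = \<beta> a b \<otimes>\<^bsub>C\<^esub> \<beta> a' b'"
    and adj: "a \<in> carrier A \<Longrightarrow> b \<in> carrier B \<Longrightarrow> \<beta> (adj A a) (adj B b) = adj C (\<beta> a b)"
begin

lemma finsum_left:
  assumes "finite S" "g \<in> S \<rightarrow> carrier A" "b \<in> carrier B"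
  shows "\<beta> (finsum A g S) b = finsum C (\<lambda>i. \<beta> (g i) b) S"
proof (rule finsum_hom[OF A.abelian_monoid_A C.abelian_monoid_A])
  show "\<beta> \<zero>\<^bsub>A\<^esub> b = \<zero>\<^bsub>C\<^esub>"
    using smult_left[of "\<zero>\<^bsub>A\<^esub>" b 0] assms by (simp add: closed)
qed (use assms in \<open>auto simp: add_left closed\<close>)

lemma finsum_right:
  assumes "finite S" "g \<in> S \<rightarrow> carrier B" "a \<in> carrier A"
  shows "\<beta> a (finsum B g S) = finsum C (\<lambda>i. \<beta> a (g i)) S"
proof (rule finsum_hom[OF B.abelian_monoid_A C.abelian_monoid_A])
  show "\<beta> a \<zero>\<^bsub>B\<^esub> = \<zero>\<^bsub>C\<^esub>"
    using smult_right[of a "\<zero>\<^bsub>B\<^esub>" 0] assms by (simp add: closed)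
qed (use assms in \<open>auto simp: add_right closed\<close>)

definition contract :: "nat \<Rightarrow> 'a mat \<Rightarrow> 'b mat \<Rightarrow> 'c" where
  "contract n R P = finsum C (\<lambda>(i, j). \<beta> (R $$ (i, j)) (P $$ (i, j))) ({..<n} \<times> {..<n})"

text \<open>
  \<open>\<beta>(S\<^sub>k\<^sub>i\<^sup>* S\<^sub>k\<^sub>j, T\<^sub>l\<^sub>i\<^sup>* T\<^sub>l\<^sub>j) = \<beta>(S\<^sub>k\<^sub>i, T\<^sub>l\<^sub>i)\<^sup>* \<beta>(S\<^sub>k\<^sub>j, T\<^sub>l\<^sub>j)\<close>, so the sum over \<open>i\<close>, \<open>j\<close> and \<open>(k, l)\<close> has the form of
  \<open>finsum_gram\<close>.
\<close>

lemma contract_star_squares: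
  assumes S: "S \<in> carrier (mat_alg n A)" and T: "T \<in> carrier (mat_alg n B)"
  defines "w \<equiv> \<lambda>(k, l) i. \<beta> (S $$ (k, i)) (T $$ (l, i))"
  shows "contract n (adj (mat_alg n A) S \<otimes>\<^bsub>mat_alg n A\<^esub> S) (adj (mat_alg n B) T \<otimes>\<^bsub>mat_alg n B\<^esub> T)
    = finsum C (\<lambda>p. adj C (finsum C (w p) {..<n}) \<otimes>\<^bsub>C\<^esub> finsum C (w p) {..<n}) ({..<n} \<times> {..<n})"
proof -
  note s = mat_alg_entry[OF S] and t = mat_alg_entry[OF T]
  let ?R = "adj (mat_alg n A) S \<otimes>\<^bsub>mat_alg n A\<^esub> S" and ?P = "adj (mat_alg n B) T \<otimes>\<^bsub>mat_alg n B\<^esub> T"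
  have w: "w p i \<in> carrier C" if "p \<in> {..<n} \<times> {..<n}" "i < n" for p i
    using that s t by (auto simp: w_def intro!: closed)
  have entry: "\<beta> (?R $$ (i, j)) (?P $$ (i, j)) = finsum C (\<lambda>p. adj C (w p i) \<otimes>\<^bsub>C\<^esub> w p j) ({..<n} \<times> {..<n})"
    if ij: "i < n" "j < n" for i j
  proof -
    have R: "?R $$ (i, j) = finsum A (\<lambda>k. adj A (S $$ (k, i)) \<otimes>\<^bsub>A\<^esub> S $$ (k, j)) {..<n}"
      using ij s by (auto intro!: A.finsum_cong' simp: A.adj_closed)
    have P: "?P $$ (i, j) = finsum B (\<lambda>l. adj B (T $$ (l, i)) \<otimes>\<^bsub>B\<^esub> T $$ (l, j)) {..<n}"
      using ij t by (auto intro!: B.finsum_cong' simp: B.adj_closed)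
    have Pc: "?P $$ (i, j) \<in> carrier B"
      unfolding P using ij t by (auto intro!: B.finsum_closed simp: B.adj_closed)
    have "\<beta> (?R $$ (i, j)) (?P $$ (i, j))
      = finsum C (\<lambda>k. \<beta> (adj A (S $$ (k, i)) \<otimes>\<^bsub>A\<^esub> S $$ (k, j)) (?P $$ (i, j))) {..<n}"
      unfolding R using ij s Pc by (intro finsum_left) (auto simp: A.adj_closed)
    also have "\<dots> = finsum C (\<lambda>k. finsum C (\<lambda>l. adj C (w (k, l) i) \<otimes>\<^bsub>C\<^esub> w (k, l) j) {..<n}) {..<n}"
    proof (rule C.finsum_cong')
      fix k assume k: "k \<in> {..<n}"
      have "\<beta> (adj A (S $$ (k, i)) \<otimes>\<^bsub>A\<^esub> S $$ (k, j)) (?P $$ (i, j))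
        = finsum C (\<lambda>l. \<beta> (adj A (S $$ (k, i)) \<otimes>\<^bsub>A\<^esub> S $$ (k, j))
            (adj B (T $$ (l, i)) \<otimes>\<^bsub>B\<^esub> T $$ (l, j))) {..<n}"
        unfolding P using ij k s t by (intro finsum_right) (auto simp: A.adj_closed B.adj_closed)
      also have "\<dots> = finsum C (\<lambda>l. adj C (w (k, l) i) \<otimes>\<^bsub>C\<^esub> w (k, l) j) {..<n}"
        using ij k s t w
        by (intro C.finsum_cong') (auto simp: w_def mult adj A.adj_closed B.adj_closed C.adj_closed closed)
      finally show "\<beta> (adj A (S $$ (k, i)) \<otimes>\<^bsub>A\<^esub> S $$ (k, j)) (?P $$ (i, j))
        = finsum C (\<lambda>l. adj C (w (k, l) i) \<otimes>\<^bsub>C\<^esub> w (k, l) j) {..<n}" .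
    qed (use ij w in \<open>auto intro!: C.finsum_closed simp: C.adj_closed\<close>)
    also have "\<dots> = finsum C (\<lambda>p. adj C (w p i) \<otimes>\<^bsub>C\<^esub> w p j) ({..<n} \<times> {..<n})"
      using ij w by (intro C.finsum_cartesian[symmetric]) (auto simp: C.adj_closed)
    finally show ?thesis .
  qed
  have wc: "finsum C (\<lambda>p. adj C (w p i) \<otimes>\<^bsub>C\<^esub> w p j) ({..<n} \<times> {..<n}) \<in> carrier C" if "i < n" "j < n" for i j
    using w that by (intro C.finsum_closed) (auto simp: C.adj_closed)
  have "contract n ?R ?P
    = finsum C (\<lambda>i. finsum C (\<lambda>j. \<beta> (?R $$ (i, j)) (?P $$ (i, j))) {..<n}) {..<n}"
    unfolding contract_def using entry wc by (subst C.finsum_cartesian) (auto split: prod.splits)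
  also have "\<dots> = finsum C (\<lambda>i. finsum C (\<lambda>j.
      finsum C (\<lambda>p. adj C (w p i) \<otimes>\<^bsub>C\<^esub> w p j) ({..<n} \<times> {..<n})) {..<n}) {..<n}"
    using wc entry by (intro C.finsum_cong') (auto simp del: mat_alg_entries intro!: C.finsum_closed)
  also have "\<dots> = finsum C (\<lambda>p. adj C (finsum C (w p) {..<n}) \<otimes>\<^bsub>C\<^esub> finsum C (w p) {..<n}) ({..<n} \<times> {..<n})"
    using w by (intro C.finsum_gram) auto
  finally show ?thesis .
qed

theorem contract_positive:
  assumes A: "cstar_norm A NA" and B: "cstar_norm B NB" and C: "cstar_norm C NC"
    and R: "positive_elt (mat_alg n A) R" and P: "positive_elt (mat_alg n B) P"
  shows "positive_elt C (contract n R P)"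
proof -
  interpret C': cstar_norm C NC by (rule C)
  interpret MA: cstar_norm "mat_alg n A" "star_algebra.sos_norm (mat_alg n A)"
    by (rule cstar_norm.cstar_norm_mat_alg[OF A])
  interpret MB: cstar_norm "mat_alg n B" "star_algebra.sos_norm (mat_alg n B)"
    by (rule cstar_norm.cstar_norm_mat_alg[OF B])
  obtain S where S: "S \<in> carrier (mat_alg n A)" "R = adj (mat_alg n A) S \<otimes>\<^bsub>mat_alg n A\<^esub> S"
    using R unfolding MA.positive_elt_iff_star_square by blast
  obtain T where T: "T \<in> carrier (mat_alg n B)" "P = adj (mat_alg n B) T \<otimes>\<^bsub>mat_alg n B\<^esub> T"
    using P unfolding MB.positive_elt_iff_star_square by blast
  show ?thesis
    unfolding C'.positive_elt_iff_npos S(2) T(2) contract_star_squares[OF S(1) T(1)]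
    using mat_alg_entry[OF S(1)] mat_alg_entry[OF T(1)]
    by (intro C'.npos_finsum C'.npos_star_square C.finsum_closed) (auto intro!: closed)
qed

end

section \<open>Scalar matrices with coefficients in an algebra\<close>

lemma star_algebra_complex: "star_algebra complex_alg"
  by (rule cstar_norm.axioms[OF cstar_norm_complex])

lemma finsum_complex_alg: "finite S \<Longrightarrow> finsum complex_alg f S = sum f S"
proof (induction S rule: finite_induct)
  interpret star_algebra complex_alg by (rule star_algebra_complex)
  case empty
  then show ?case by simp
next
  interpret star_algebra complex_alg by (rule star_algebra_complex)
  case (insert i S)
  then show ?case by simp
qed

lemma (in star_algebra) finsum_smult_left:
  assumes "finite S" "x \<in> carrier A"
  shows "(\<Sum>i\<in>S. c i) \<odot> x = finsum A (\<lambda>i. c i \<odot> x) S"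
proof -
  interpret C: star_algebra complex_alg by (rule star_algebra_complex)
  have "finsum complex_alg c S \<odot> x = finsum A (\<lambda>i. c i \<odot> x) S"
    by (rule finsum_hom[OF C.abelian_monoid_A abelian_monoid_A])
      (use assms in \<open>auto simp: smult_add_left\<close>)
  then show ?thesis by (simp add: finsum_complex_alg assms)
qed

definition mat_scale :: "('b, 'y) star_alg_scheme \<Rightarrow> nat \<Rightarrow> complex mat \<Rightarrow> 'b \<Rightarrow> 'b mat" where
  "mat_scale B k a b = mat k k (\<lambda>p. a $$ p \<odot>\<^bsub>B\<^esub> b)"

lemma mat_scale_entry [simp]:
  "i < k \<Longrightarrow> j < k \<Longrightarrow> mat_scale B k a b $$ (i, j) = a $$ (i, j) \<odot>\<^bsub>B\<^esub> b"
  by (simp add: mat_scale_def)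

lemma (in star_algebra) mat_scale_closed [simp]:
  "b \<in> carrier A \<Longrightarrow> mat_scale A k a b \<in> carrier (mat_alg k A)"
  by (rule mat_alg_carrierI) (simp_all, simp add: mat_scale_def)

theorem (in star_algebra) star_pairing_mat_scale:
  "star_pairing (cmat_alg k) A (mat_alg k A) (mat_scale A k)"
proof -
  interpret MC: star_algebra "cmat_alg k"
    by (rule star_algebra.star_algebra_mat_alg[OF star_algebra_complex])
  interpret M: star_algebra "mat_alg k A" by (rule star_algebra_mat_alg)
  show ?thesis
  proof
    fix a a' :: "complex mat" and b b' :: 'a
    assume a: "a \<in> carrier (cmat_alg k)" "a' \<in> carrier (cmat_alg k)"
      and b: "b \<in> carrier A" "b' \<in> carrier A"
    show "mat_scale A k (a \<otimes>\<^bsub>cmat_alg k\<^esub> a') (b \<otimes> b')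
      = mat_scale A k a b \<otimes>\<^bsub>mat_alg k A\<^esub> mat_scale A k a' b'"
    proof (rule mat_alg_eqI[where A=A and k=k])
      fix i j assume ij: "i < k" "j < k"
      have "finsum A (\<lambda>l. mat_scale A k a b $$ (i, l) \<otimes> mat_scale A k a' b' $$ (l, j)) {..<k}
        = finsum A (\<lambda>l. (a $$ (i, l) * a' $$ (l, j)) \<odot> (b \<otimes> b')) {..<k}"
        using b ij by (intro finsum_cong') (auto simp: smult_mult_left smult_mult_right smult_smult mult.commute)
      then show "mat_scale A k (a \<otimes>\<^bsub>cmat_alg k\<^esub> a') (b \<otimes> b') $$ (i, j)
        = (mat_scale A k a b \<otimes>\<^bsub>mat_alg k A\<^esub> mat_scale A k a' b') $$ (i, j)"
        using ij b by (simp add: finsum_complex_alg finsum_smult_left)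
    qed (use b in simp_all)
  qed (auto intro!: mat_alg_eqI[where A=A and k=k]
      simp: smult_add_left smult_add_right smult_smult adj_smult mult.commute adj_closed)
qed

section \<open>The algebraic tensor product\<close>

lemma lookup_free_scale [simp]: "Poly_Mapping.lookup (free_scale c f) x = c * Poly_Mapping.lookup f x"
  by (simp add: free_scale_def map.rep_eq when_def)

lemma free_scale_add: "free_scale c (f + g) = free_scale c f + free_scale c g"
  by (rule poly_mapping_eqI) (simp add: lookup_add algebra_simps)

lemma free_scale_diff: "free_scale c (f - g) = free_scale c f - free_scale c g"
  by (rule poly_mapping_eqI) (simp add: lookup_minus algebra_simps)

lemma free_scale_single [simp]: "free_scale c (Poly_Mapping.single x d) = Poly_Mapping.single x (c * d)"
  by (rule poly_mapping_eqI) (simp add: lookup_single when_def)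

lemma free_scale_minus_one: "free_scale (-1) f = - f"
  by (rule poly_mapping_eqI) simp

lemma free_scale_one [simp]: "free_scale 1 f = f"
  by (rule poly_mapping_eqI) simp

lemma free_scale_zero [simp]: "free_scale c 0 = 0"
  by (rule poly_mapping_eqI) simp

lemma poly_mapping_sum_single:
  "f = (\<Sum>s\<in>Poly_Mapping.keys f. Poly_Mapping.single s (Poly_Mapping.lookup f s))"
  by (rule poly_mapping_eqI)
    (auto simp: lookup_sum lookup_single when_def not_in_keys_iff_lookup_eq_zero)

lemma tensor_free_iff:
  "f \<in> tensor_free A B \<longleftrightarrow> (\<forall>s. s \<notin> carrier A \<times> carrier B \<longrightarrow> Poly_Mapping.lookup f s = 0)"
  by (auto simp: tensor_free_def in_keys_iff subset_iff simp del: mem_Sigma_iff)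

lemma tensor_free_zero [simp]: "0 \<in> tensor_free A B"
  and tensor_free_add: "f \<in> tensor_free A B \<Longrightarrow> g \<in> tensor_free A B \<Longrightarrow> f + g \<in> tensor_free A B"
  and tensor_free_minus: "f \<in> tensor_free A B \<Longrightarrow> g \<in> tensor_free A B \<Longrightarrow> f - g \<in> tensor_free A B"
  and tensor_free_scale: "f \<in> tensor_free A B \<Longrightarrow> free_scale c f \<in> tensor_free A B"
  by (simp_all add: tensor_free_iff lookup_add lookup_minus)

lemma tensor_free_single:
  "a \<in> carrier A \<Longrightarrow> b \<in> carrier B \<Longrightarrow> Poly_Mapping.single (a, b) c \<in> tensor_free A B"
  by (auto simp: tensor_free_iff lookup_single when_def)

lemma tensor_free_induct [consumes 1, case_names zero single add]:
  assumes f: "f \<in> tensor_free A B" and zero: "P 0"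
    and single: "\<And>a b c. a \<in> carrier A \<Longrightarrow> b \<in> carrier B \<Longrightarrow> P (Poly_Mapping.single (a, b) c)"
    and add: "\<And>f g. \<lbrakk>f \<in> tensor_free A B; g \<in> tensor_free A B; P f; P g\<rbrakk> \<Longrightarrow> P (f + g)"
  shows "P f"
proof -
  define g where "g s = Poly_Mapping.single s (Poly_Mapping.lookup f s)" for s
  have "sum g S \<in> tensor_free A B \<and> P (sum g S)" if "finite S" "S \<subseteq> carrier A \<times> carrier B" for S
    using that
  proof (induction S rule: finite_induct)
    case empty
    then show ?case using zero by simp
  next
    case (insert s S)
    obtain a b where s: "s = (a, b)" by force
    have "g s \<in> tensor_free A B" "P (g s)"
      using insert.prems s by (simp_all add: g_def tensor_free_single single)
    then show ?case using insert by (simp add: add tensor_free_add)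
  qed
  from this[of "Poly_Mapping.keys f"] have "P (sum g (Poly_Mapping.keys f))"
    using f by (simp add: tensor_free_def)
  then show ?thesis using poly_mapping_sum_single[of f] by (simp add: g_def)
qed

subsection \<open>Multiplication and adjoint on representatives\<close>

lemma free_mult_zero [simp]: "free_mult A B 0 g = 0" "free_mult A B f 0 = 0"
  by (simp_all add: free_mult_def)

lemma free_mult_single:
  "free_mult A B (Poly_Mapping.single (a, b) c) (Poly_Mapping.single (a', b') d)
    = Poly_Mapping.single (a \<otimes>\<^bsub>A\<^esub> a', b \<otimes>\<^bsub>B\<^esub> b') (c * d)"
  by (cases "c = 0"; cases "d = 0") (simp_all add: free_mult_def)

lemma free_mult_add_left: "free_mult A B (f + f') g = free_mult A B f g + free_mult A B f' g"
  unfolding free_mult_def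
  by (rule setsum_keys_plus_distrib[where f="\<lambda>s c. \<Sum>t\<in>Poly_Mapping.keys g.
        Poly_Mapping.single (fst s \<otimes>\<^bsub>A\<^esub> fst t, snd s \<otimes>\<^bsub>B\<^esub> snd t) (c * Poly_Mapping.lookup g t)"])
    (simp_all add: distrib_right single_add sum.distrib)

lemma free_mult_add_right: "free_mult A B f (g + g') = free_mult A B f g + free_mult A B f g'"
  unfolding free_mult_def sum.distrib[symmetric]
  by (rule sum.cong[OF refl], rule setsum_keys_plus_distrib)
    (simp_all add: distrib_left single_add)

lemma free_adj_zero [simp]: "free_adj A B 0 = 0"
  by (simp add: free_adj_def)

lemma free_adj_single:
  "free_adj A B (Poly_Mapping.single (a, b) c) = Poly_Mapping.single (adj A a, adj B b) (cnj c)"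
  by (cases "c = 0") (simp_all add: free_adj_def)

lemma free_adj_add: "free_adj A B (f + g) = free_adj A B f + free_adj A B g"
  unfolding free_adj_def by (rule setsum_keys_plus_distrib) (simp_all add: single_add)

lemma additive_diff:
  fixes F :: "'u::ab_group_add \<Rightarrow> 'v::ab_group_add"
  assumes "\<And>f g. F (f + g) = F f + F g"
  shows "F (f - g) = F f - F g"
  using assms[of "f - g" g] by (simp add: algebra_simps)

lemmas free_mult_diff_left = additive_diff[where F="\<lambda>f. free_mult A B f g" for A B g, OF free_mult_add_left]
lemmas free_mult_diff_right = additive_diff[where F="free_mult A B f" for A B f, OF free_mult_add_right]
lemmas free_adj_diff = additive_diff[where F="free_adj A B" for A B, OF free_adj_add]

locale star_algebra_pair = A: star_algebra A + B: star_algebra B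
  for A :: "('a, 'x) star_alg_scheme" and B :: "('b, 'y) star_alg_scheme"
begin

abbreviation "free \<equiv> tensor_free A B"
abbreviation "null \<equiv> tensor_null A B"
abbreviation "sing a b c \<equiv> Poly_Mapping.single (a, b) (c :: complex)"

lemma null_free: "f \<in> null \<Longrightarrow> f \<in> free"
  by (induction rule: tensor_null.induct)
    (auto intro!: tensor_free_add tensor_free_minus tensor_free_scale tensor_free_single)

lemma null_uminus: "f \<in> null \<Longrightarrow> - f \<in> null"
  using tensor_null.scale[of f A B "-1"] by (simp add: free_scale_minus_one)

lemma null_diff: "f \<in> null \<Longrightarrow> g \<in> null \<Longrightarrow> f - g \<in> null"
  using tensor_null.plus[OF _ null_uminus, of f g] by simp

lemma free_mult_free: "f \<in> free \<Longrightarrow> g \<in> free \<Longrightarrow> free_mult A B f g \<in> free"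
proof (induction f rule: tensor_free_induct)
  case (single a b c)
  from single(3) show ?case
    by (induction g rule: tensor_free_induct)
      (use single in \<open>auto simp: free_mult_single free_mult_add_right intro: tensor_free_add tensor_free_single\<close>)
qed (auto simp: free_mult_add_left intro: tensor_free_add)

lemma free_adj_free: "f \<in> free \<Longrightarrow> free_adj A B f \<in> free"
  by (induction f rule: tensor_free_induct)
    (auto simp: free_adj_single free_adj_add A.adj_closed B.adj_closed
      intro: tensor_free_add tensor_free_single)

lemma free_mult_scale_left:
  "f \<in> free \<Longrightarrow> g \<in> free \<Longrightarrow> free_mult A B (free_scale c f) g = free_scale c (free_mult A B f g)"
proof (induction f rule: tensor_free_induct)
  case (single a b d)
  from single(3) show ?case
    by (induction g rule: tensor_free_induct)
      (auto simp: free_mult_single free_mult_add_right free_scale_add mult.assoc)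
qed (auto simp: free_mult_add_left free_scale_add)

lemma free_mult_scale_right:
  "f \<in> free \<Longrightarrow> g \<in> free \<Longrightarrow> free_mult A B f (free_scale c g) = free_scale c (free_mult A B f g)"
proof (induction f rule: tensor_free_induct)
  case (single a b d)
  from single(3) show ?case
    by (induction g rule: tensor_free_induct)
      (auto simp: free_mult_single free_mult_add_right free_scale_add mult.left_commute)
qed (auto simp: free_mult_add_left free_scale_add)

lemma free_adj_scale: "f \<in> free \<Longrightarrow> free_adj A B (free_scale c f) = free_scale (cnj c) (free_adj A B f)"
  by (induction f rule: tensor_free_induct) (auto simp: free_adj_single free_adj_add free_scale_add)

lemma null_scaled:
  "\<lbrakk>a \<in> carrier A; a' \<in> carrier A; b \<in> carrier B\<rbrakk> \<Longrightarrow> sing (a \<oplus>\<^bsub>A\<^esub> a') b c - sing a b c - sing a' b c \<in> null"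
  "\<lbrakk>a \<in> carrier A; b \<in> carrier B; b' \<in> carrier B\<rbrakk> \<Longrightarrow> sing a (b \<oplus>\<^bsub>B\<^esub> b') c - sing a b c - sing a b' c \<in> null"
  "\<lbrakk>a \<in> carrier A; b \<in> carrier B\<rbrakk> \<Longrightarrow> sing (d \<odot>\<^bsub>A\<^esub> a) b c - sing a b (c * d) \<in> null"
  "\<lbrakk>a \<in> carrier A; b \<in> carrier B\<rbrakk> \<Longrightarrow> sing a (d \<odot>\<^bsub>B\<^esub> b) c - sing a b (c * d) \<in> null"
  using tensor_null.scale[OF tensor_null.add_left[of a A a' b B], of c]
    tensor_null.scale[OF tensor_null.add_right[of a A b B b'], of c]
    tensor_null.scale[OF tensor_null.smult_left[of a A b B d], of c]
    tensor_null.scale[OF tensor_null.smult_right[of a A b B d], of c]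
  by (simp_all add: free_scale_diff)

text \<open>
  The null space is a two-sided ideal, invariant under the adjoint: multiplication by a generator maps
  each bilinearity relation to a relation of the same kind.
\<close>

lemma null_mult_single_left:
  assumes "f \<in> null" and ab: "a \<in> carrier A" "b \<in> carrier B"
  shows "free_mult A B f (sing a b c) \<in> null"
  using assms(1)
proof (induction f rule: tensor_null.induct)
  case (scale f d)
  then show ?case using null_free tensor_free_single[OF ab]
    by (simp add: free_mult_scale_left tensor_null.scale)
qed (use ab in \<open>simp_all add: free_mult_diff_left free_mult_add_left free_mult_single A.l_distr B.l_distr
  A.smult_mult_left B.smult_mult_left tensor_null.zero tensor_null.plus null_scaled
  null_scaled(3,4)[where c=c, simplified mult.commute[of c]]\<close>)

lemma null_mult_single_right:
  assumes "f \<in> null" and ab: "a \<in> carrier A" "b \<in> carrier B"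
  shows "free_mult A B (sing a b c) f \<in> null"
  using assms(1)
proof (induction f rule: tensor_null.induct)
  case (scale f d)
  then show ?case using null_free tensor_free_single[OF ab]
    by (simp add: free_mult_scale_right tensor_null.scale)
qed (use ab in \<open>simp_all add: free_mult_diff_right free_mult_add_right free_mult_single A.r_distr B.r_distr
  A.smult_mult_right B.smult_mult_right tensor_null.zero tensor_null.plus null_scaled\<close>)

lemma null_mult_left: "f \<in> null \<Longrightarrow> g \<in> free \<Longrightarrow> free_mult A B f g \<in> null"
  by (rotate_tac, induction g rule: tensor_free_induct)
    (auto simp: null_mult_single_left free_mult_add_right tensor_null.zero tensor_null.plus)

lemma null_mult_right: "f \<in> null \<Longrightarrow> g \<in> free \<Longrightarrow> free_mult A B g f \<in> null"
  by (rotate_tac, induction g rule: tensor_free_induct)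
    (auto simp: null_mult_single_right free_mult_add_left tensor_null.zero tensor_null.plus)

lemma null_adj: "f \<in> null \<Longrightarrow> free_adj A B f \<in> null"
proof (induction f rule: tensor_null.induct)
  case (scale f d)
  then show ?case using null_free by (simp add: free_adj_scale tensor_null.scale)
qed (simp_all add: free_adj_diff free_adj_add free_adj_single A.adj_add B.adj_add A.adj_smult B.adj_smult
  A.adj_closed B.adj_closed tensor_null.zero tensor_null.plus tensor_null.add_left tensor_null.add_right
  tensor_null.smult_left tensor_null.smult_right)

subsection \<open>Operations on classes\<close>

abbreviation "cls \<equiv> tensor_class A B"
abbreviation "T \<equiv> tensor_alg A B"

lemma in_cls: "f \<in> free \<Longrightarrow> f \<in> cls f"
  by (simp add: tensor_class_def tensor_null.zero)

lemma cls_eq_iff: "f \<in> free \<Longrightarrow> g \<in> free \<Longrightarrow> cls f = cls g \<longleftrightarrow> f - g \<in> null"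
proof
  assume f: "f \<in> free" and "cls f = cls g"
  then have "f \<in> cls g" using in_cls[OF f] by simp
  then show "f - g \<in> null" by (simp add: tensor_class_def)
next
  assume fg: "f - g \<in> null"
  have "h - f \<in> null \<longleftrightarrow> h - g \<in> null" for h
  proof
    assume "h - f \<in> null"
    then have "(h - f) + (f - g) \<in> null" using fg by (rule tensor_null.plus)
    then show "h - g \<in> null" by simp
  next
    assume "h - g \<in> null"
    then have "(h - g) - (f - g) \<in> null" using fg by (rule null_diff)
    then show "h - f \<in> null" by simp
  qed
  then show "cls f = cls g" by (simp add: tensor_class_def)
qed

lemma cls_memD: "h \<in> cls f \<Longrightarrow> h \<in> free \<and> h - f \<in> null"
  by (simp add: tensor_class_def)

text \<open>
  An operation on representatives that respects the null space is computed on classes by any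
  representative.
\<close>

lemma UN_cls:
  assumes f: "f \<in> free" and F: "\<And>h. h \<in> free \<Longrightarrow> F h \<in> free"
    and resp: "\<And>h. h \<in> free \<Longrightarrow> h - f \<in> null \<Longrightarrow> F h - F f \<in> null"
  shows "(\<Union>h\<in>cls f. cls (F h)) = cls (F f)"
proof -
  have eq: "cls (F h) = cls (F f)" if "h \<in> cls f" for h
    using cls_memD[OF that] cls_eq_iff[OF F F[OF f]] resp by blast
  have "(\<Union>h\<in>cls f. cls (F h)) = (\<Union>h\<in>cls f. cls (F f))"
    by (rule SUP_cong[OF refl eq])
  also have "\<dots> = cls (F f)" using in_cls[OF f] by blast
  finally show ?thesis .
qed

lemma UN_cls2:
  assumes f: "f \<in> free" and g: "g \<in> free"
    and F: "\<And>h k. h \<in> free \<Longrightarrow> k \<in> free \<Longrightarrow> F h k \<in> free"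
    and resp: "\<And>h k. h \<in> free \<Longrightarrow> h - f \<in> null \<Longrightarrow> k \<in> free \<Longrightarrow> k - g \<in> null \<Longrightarrow> F h k - F f g \<in> null"
  shows "(\<Union>h\<in>cls f. \<Union>k\<in>cls g. cls (F h k)) = cls (F f g)"
proof -
  have eq: "cls (F h k) = cls (F f g)" if "h \<in> cls f" "k \<in> cls g" for h k
    using cls_memD[OF that(1)] cls_memD[OF that(2)] f g F resp by (simp add: cls_eq_iff)
  have "(\<Union>h\<in>cls f. \<Union>k\<in>cls g. cls (F h k)) = (\<Union>h\<in>cls f. cls (F f g))"
    by (intro SUP_cong refl SUP_eq_const) (use in_cls[OF g] eq in auto)
  also have "\<dots> = cls (F f g)" using in_cls[OF f] by auto
  finally show ?thesis .
qed

lemma tensor_alg_carrier: "carrier T = cls ` free"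
  and tensor_alg_zero: "\<zero>\<^bsub>T\<^esub> = cls 0"
  by (simp_all add: tensor_alg_def)

lemma tensor_alg_add: "f \<in> free \<Longrightarrow> g \<in> free \<Longrightarrow> cls f \<oplus>\<^bsub>T\<^esub> cls g = cls (f + g)"
proof -
  assume fg: "f \<in> free" "g \<in> free"
  have "(\<Union>h\<in>cls f. \<Union>k\<in>cls g. cls (h + k)) = cls (f + g)"
  proof (rule UN_cls2[OF fg])
    fix h k assume "h - f \<in> null" "k - g \<in> null"
    then have "(h - f) + (k - g) \<in> null" by (rule tensor_null.plus)
    then show "h + k - (f + g) \<in> null" by (simp add: algebra_simps)
  qed (rule tensor_free_add)
  then show ?thesis by (simp add: tensor_alg_def)
qed

lemma tensor_alg_smult: "f \<in> free \<Longrightarrow> c \<odot>\<^bsub>T\<^esub> cls f = cls (free_scale c f)"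
proof -
  assume f: "f \<in> free"
  have "(\<Union>h\<in>cls f. cls (free_scale c h)) = cls (free_scale c f)"
    by (rule UN_cls[OF f]) (auto simp: free_scale_diff[symmetric] tensor_free_scale tensor_null.scale)
  then show ?thesis by (simp add: tensor_alg_def)
qed

lemma tensor_alg_adj: "f \<in> free \<Longrightarrow> adj T (cls f) = cls (free_adj A B f)"
proof -
  assume f: "f \<in> free"
  have "(\<Union>h\<in>cls f. cls (free_adj A B h)) = cls (free_adj A B f)"
    by (rule UN_cls[OF f]) (auto simp: free_adj_diff[symmetric] free_adj_free null_adj)
  then show ?thesis by (simp add: tensor_alg_def)
qed

lemma tensor_alg_mult: "f \<in> free \<Longrightarrow> g \<in> free \<Longrightarrow> cls f \<otimes>\<^bsub>T\<^esub> cls g = cls (free_mult A B f g)"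
proof -
  assume fg: "f \<in> free" "g \<in> free"
  have "(\<Union>h\<in>cls f. \<Union>k\<in>cls g. cls (free_mult A B h k)) = cls (free_mult A B f g)"
  proof (rule UN_cls2[OF fg])
    fix h k assume "h \<in> free" "h - f \<in> null" "k \<in> free" "k - g \<in> null"
    then have "free_mult A B (h - f) k + free_mult A B f (k - g) \<in> null"
      using fg by (intro tensor_null.plus null_mult_left null_mult_right)
    then show "free_mult A B h k - free_mult A B f g \<in> null"
      by (simp add: free_mult_diff_left free_mult_diff_right)
  qed (rule free_mult_free)
  then show ?thesis by (simp add: tensor_alg_def)
qed

lemma abelian_monoid_tensor_alg: "abelian_monoid T"
  by (rule abelian_monoidI)
    (auto simp: tensor_alg_carrier tensor_alg_zero tensor_alg_add tensor_free_add add_ac)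

lemma pure_tensor_closed: "a \<in> carrier A \<Longrightarrow> b \<in> carrier B \<Longrightarrow> pure_tensor A B a b \<in> carrier T"
  by (auto simp: tensor_alg_carrier pure_tensor_def intro: tensor_free_single)

lemma pure_tensor_add_left:
  assumes "a \<in> carrier A" "a' \<in> carrier A" "b \<in> carrier B"
  shows "pure_tensor A B (a \<oplus>\<^bsub>A\<^esub> a') b = pure_tensor A B a b \<oplus>\<^bsub>T\<^esub> pure_tensor A B a' b"
  using assms null_scaled(1)[of a a' b 1]
  by (simp add: pure_tensor_def tensor_alg_add cls_eq_iff tensor_free_single tensor_free_add
      diff_diff_add)

lemma pure_tensor_add_right:
  assumes "a \<in> carrier A" "b \<in> carrier B" "b' \<in> carrier B"
  shows "pure_tensor A B a (b \<oplus>\<^bsub>B\<^esub> b') = pure_tensor A B a b \<oplus>\<^bsub>T\<^esub> pure_tensor A B a b'"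
  using assms null_scaled(2)[of a b b' 1]
  by (simp add: pure_tensor_def tensor_alg_add cls_eq_iff tensor_free_single tensor_free_add
      diff_diff_add)

lemma pure_tensor_smult_left:
  "a \<in> carrier A \<Longrightarrow> b \<in> carrier B \<Longrightarrow> pure_tensor A B (c \<odot>\<^bsub>A\<^esub> a) b = c \<odot>\<^bsub>T\<^esub> pure_tensor A B a b"
  using null_scaled(3)[of a b c 1]
  by (simp add: pure_tensor_def tensor_alg_smult cls_eq_iff tensor_free_single)

lemma pure_tensor_smult_right:
  "a \<in> carrier A \<Longrightarrow> b \<in> carrier B \<Longrightarrow> pure_tensor A B a (c \<odot>\<^bsub>B\<^esub> b) = c \<odot>\<^bsub>T\<^esub> pure_tensor A B a b"
  using null_scaled(4)[of a b c 1]
  by (simp add: pure_tensor_def tensor_alg_smult cls_eq_iff tensor_free_single)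

lemma pure_tensor_mult:
  "a \<in> carrier A \<Longrightarrow> a' \<in> carrier A \<Longrightarrow> b \<in> carrier B \<Longrightarrow> b' \<in> carrier B \<Longrightarrow>
   pure_tensor A B (a \<otimes>\<^bsub>A\<^esub> a') (b \<otimes>\<^bsub>B\<^esub> b') = pure_tensor A B a b \<otimes>\<^bsub>T\<^esub> pure_tensor A B a' b'"
  by (simp add: pure_tensor_def tensor_alg_mult tensor_free_single free_mult_single)

lemma pure_tensor_adj:
  "a \<in> carrier A \<Longrightarrow> b \<in> carrier B \<Longrightarrow> pure_tensor A B (adj A a) (adj B b) = adj T (pure_tensor A B a b)"
  by (simp add: pure_tensor_def tensor_alg_adj tensor_free_single free_adj_single)

lemma star_pairing_embedding:
  assumes C: "star_algebra C" and \<iota>: "star_embedding T C \<iota>"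
  shows "star_pairing A B C (\<lambda>a b. \<iota> (pure_tensor A B a b))"
proof -
  interpret C: star_algebra C by (rule C)
  have maps: "\<And>x. x \<in> carrier T \<Longrightarrow> \<iota> x \<in> carrier C"
    and add: "\<And>x y. x \<in> carrier T \<Longrightarrow> y \<in> carrier T \<Longrightarrow> \<iota> (x \<oplus>\<^bsub>T\<^esub> y) = \<iota> x \<oplus>\<^bsub>C\<^esub> \<iota> y"
    and smult: "\<And>c x. x \<in> carrier T \<Longrightarrow> \<iota> (c \<odot>\<^bsub>T\<^esub> x) = c \<odot>\<^bsub>C\<^esub> \<iota> x"
    and mult: "\<And>x y. x \<in> carrier T \<Longrightarrow> y \<in> carrier T \<Longrightarrow> \<iota> (x \<otimes>\<^bsub>T\<^esub> y) = \<iota> x \<otimes>\<^bsub>C\<^esub> \<iota> y"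
    and adj: "\<And>x. x \<in> carrier T \<Longrightarrow> \<iota> (adj T x) = adj C (\<iota> x)"
    using \<iota> by (simp_all add: star_embedding_def linear_on_def Pi_iff)
  show ?thesis
    by unfold_locales
      (simp_all add: maps add smult mult adj pure_tensor_closed pure_tensor_add_left
        pure_tensor_add_right pure_tensor_smult_left pure_tensor_smult_right pure_tensor_mult
        pure_tensor_adj)
qed

end

section \<open>The map induced by a pairing\<close>

context star_pairing
begin

sublocale star_algebra_pair A B ..

definition ext :: "('a \<times> 'b \<Rightarrow>\<^sub>0 complex) \<Rightarrow> 'c" where
  "ext f = finsum C (\<lambda>s. Poly_Mapping.lookup f s \<odot>\<^bsub>C\<^esub> \<beta> (fst s) (snd s)) (Poly_Mapping.keys f)"

lemma ext_superset:
  assumes "finite S" "Poly_Mapping.keys f \<subseteq> S" "S \<subseteq> carrier A \<times> carrier B"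
  shows "ext f = finsum C (\<lambda>s. Poly_Mapping.lookup f s \<odot>\<^bsub>C\<^esub> \<beta> (fst s) (snd s)) S"
  unfolding ext_def using assms closed
  by (intro C.add.finprod_mono_neutral_cong_left) (auto simp: in_keys_iff)

lemma ext_closed [simp]: "f \<in> free \<Longrightarrow> ext f \<in> carrier C"
  unfolding ext_def tensor_free_def by (intro C.finsum_closed) (auto intro!: C.scale_closed closed)

lemma ext_zero [simp]: "ext 0 = \<zero>\<^bsub>C\<^esub>"
  by (simp add: ext_def)

lemma ext_single:
  "a \<in> carrier A \<Longrightarrow> b \<in> carrier B \<Longrightarrow> ext (sing a b c) = c \<odot>\<^bsub>C\<^esub> \<beta> a b"
  by (subst ext_superset[where S="{(a, b)}"]) (auto simp: closed)

lemma ext_add: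
  assumes "f \<in> free" "g \<in> free"
  shows "ext (f + g) = ext f \<oplus>\<^bsub>C\<^esub> ext g"
proof -
  let ?S = "Poly_Mapping.keys f \<union> Poly_Mapping.keys g"
  have S: "finite ?S" "?S \<subseteq> carrier A \<times> carrier B"
    using assms by (auto simp: tensor_free_def)
  have b: "\<beta> (fst s) (snd s) \<in> carrier C" if "s \<in> ?S" for s
    using S(2) that by (auto intro!: closed)
  have "ext (f + g) = finsum C (\<lambda>s. Poly_Mapping.lookup (f + g) s \<odot>\<^bsub>C\<^esub> \<beta> (fst s) (snd s)) ?S"
    using S keys_add by (intro ext_superset)
  also have "\<dots> = finsum C (\<lambda>s. Poly_Mapping.lookup f s \<odot>\<^bsub>C\<^esub> \<beta> (fst s) (snd s) \<oplus>\<^bsub>C\<^esub>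
      Poly_Mapping.lookup g s \<odot>\<^bsub>C\<^esub> \<beta> (fst s) (snd s)) ?S"
    using b by (intro C.finsum_cong') (auto simp: lookup_add C.smult_add_left)
  also have "\<dots> = finsum C (\<lambda>s. Poly_Mapping.lookup f s \<odot>\<^bsub>C\<^esub> \<beta> (fst s) (snd s)) ?S \<oplus>\<^bsub>C\<^esub>
      finsum C (\<lambda>s. Poly_Mapping.lookup g s \<odot>\<^bsub>C\<^esub> \<beta> (fst s) (snd s)) ?S"
    using b by (intro C.finsum_addf) auto
  also have "\<dots> = ext f \<oplus>\<^bsub>C\<^esub> ext g" using S by (simp add: ext_superset[where S="?S"])
  finally show ?thesis .
qed

lemma ext_scale: "f \<in> free \<Longrightarrow> ext (free_scale c f) = c \<odot>\<^bsub>C\<^esub> ext f"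
  by (induction f rule: tensor_free_induct)
    (auto simp: ext_single closed C.smult_smult free_scale_add ext_add tensor_free_scale C.smult_add_right)

lemma ext_diff:
  assumes "f \<in> free" "g \<in> free"
  shows "ext (f - g) = ext f \<ominus>\<^bsub>C\<^esub> ext g"
proof -
  have "ext (f - g) = ext (f + free_scale (-1) g)" by (simp add: free_scale_minus_one)
  also have "\<dots> = ext f \<oplus>\<^bsub>C\<^esub> (-1) \<odot>\<^bsub>C\<^esub> ext g"
    using assms by (simp only: ext_add tensor_free_scale ext_scale)
  finally show ?thesis using assms by (simp add: C.a_minus_smult)
qed

lemma ext_mult: "f \<in> free \<Longrightarrow> g \<in> free \<Longrightarrow> ext (free_mult A B f g) = ext f \<otimes>\<^bsub>C\<^esub> ext g"
proof (induction f rule: tensor_free_induct)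
  case (single a b c)
  from single(3) show ?case
    by (induction g rule: tensor_free_induct)
      (use single in \<open>simp_all add: free_mult_single ext_single closed mult C.smult_mult_left
        C.smult_mult_right C.smult_smult free_mult_add_right ext_add free_mult_free
        tensor_free_single C.r_distr mult.commute\<close>)
qed (simp_all add: free_mult_add_left ext_add free_mult_free C.l_distr)

lemma ext_adj: "f \<in> free \<Longrightarrow> ext (free_adj A B f) = adj C (ext f)"
  by (induction f rule: tensor_free_induct)
    (simp_all add: free_adj_single ext_single A.adj_closed B.adj_closed adj C.adj_smult closed
      free_adj_add ext_add free_adj_free C.adj_add)

lemmas bilinear = add_left add_right smult_left smult_right

lemma ext_null: "f \<in> null \<Longrightarrow> ext f = \<zero>\<^bsub>C\<^esub>"
proof (induction f rule: tensor_null.induct)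
  case (plus f g)
  then show ?case using null_free by (simp add: ext_add)
next
  case (scale f c)
  then show ?case using null_free by (simp add: ext_scale)
next
  case (add_left a a' b)
  have "ext (sing (a \<oplus>\<^bsub>A\<^esub> a') b 1 - sing a b 1 - sing a' b 1)
    = (\<beta> a b \<oplus>\<^bsub>C\<^esub> \<beta> a' b) \<ominus>\<^bsub>C\<^esub> \<beta> a b \<ominus>\<^bsub>C\<^esub> \<beta> a' b"
    using add_left by (simp add: ext_diff tensor_free_minus tensor_free_single ext_single bilinear closed)
  also have "\<dots> = \<zero>\<^bsub>C\<^esub>"
    by (rule C.nc_identity[where vs="[\<beta> a b, \<beta> a' b]"], (rule C.nc_rules)+)
      (use add_left in \<open>simp_all add: closed\<close>)
  finally show ?case .
next
  case (add_right a b b')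
  have "ext (sing a (b \<oplus>\<^bsub>B\<^esub> b') 1 - sing a b 1 - sing a b' 1)
    = (\<beta> a b \<oplus>\<^bsub>C\<^esub> \<beta> a b') \<ominus>\<^bsub>C\<^esub> \<beta> a b \<ominus>\<^bsub>C\<^esub> \<beta> a b'"
    using add_right by (simp add: ext_diff tensor_free_minus tensor_free_single ext_single bilinear closed)
  also have "\<dots> = \<zero>\<^bsub>C\<^esub>"
    by (rule C.nc_identity[where vs="[\<beta> a b, \<beta> a b']"], (rule C.nc_rules)+)
      (use add_right in \<open>simp_all add: closed\<close>)
  finally show ?case .
next
  case (smult_left a b c)
  then show ?case
    by (simp add: ext_diff tensor_free_single ext_single bilinear closed a_minus_def C.r_neg)
next
  case (smult_right a b c)
  then show ?case
    by (simp add: ext_diff tensor_free_single ext_single bilinear closed a_minus_def C.r_neg)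
qed simp

text \<open>
  \<open>ext\<close> vanishes on the null space, so the chosen representative does not matter.
\<close>

definition induced :: "('a \<times> 'b \<Rightarrow>\<^sub>0 complex) set \<Rightarrow> 'c" where
  "induced X = ext (SOME f. f \<in> X)"

lemma induced_cls: "f \<in> free \<Longrightarrow> induced (cls f) = ext f"
proof -
  assume f: "f \<in> free"
  define g where "g = (SOME g. g \<in> cls f)"
  have "g \<in> cls f" unfolding g_def using in_cls[OF f] by (rule someI)
  then have g: "g \<in> free" "g - f \<in> null" using cls_memD by auto
  then have "ext g \<ominus>\<^bsub>C\<^esub> ext f = \<zero>\<^bsub>C\<^esub>" using ext_null[OF g(2)] f by (simp add: ext_diff)
  then have "ext g = ext f" using g f C.eq_if_minus_zero by simp
  then show ?thesis by (simp add: induced_def g_def)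
qed

lemma induced_pure_tensor:
  "a \<in> carrier A \<Longrightarrow> b \<in> carrier B \<Longrightarrow> induced (pure_tensor A B a b) = \<beta> a b"
  by (simp add: pure_tensor_def induced_cls tensor_free_single ext_single closed)

lemma star_embedding_induced:
  assumes inj: "\<And>f. f \<in> free \<Longrightarrow> ext f = \<zero>\<^bsub>C\<^esub> \<Longrightarrow> f \<in> null"
  shows "star_embedding T C induced"
proof -
  have "inj_on induced (carrier T)"
  proof (rule inj_onI)
    fix X Y assume "X \<in> carrier T" "Y \<in> carrier T" and eq: "induced X = induced Y"
    then obtain f g where fg: "f \<in> free" "g \<in> free" "X = cls f" "Y = cls g"
      by (auto simp: tensor_alg_carrier)
    then have "ext (f - g) = \<zero>\<^bsub>C\<^esub>"
      using eq by (simp add: induced_cls ext_diff a_minus_def C.r_neg)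
    then show "X = Y" using inj[of "f - g"] fg by (simp add: cls_eq_iff tensor_free_minus)
  qed
  then show ?thesis
    unfolding star_embedding_def linear_on_def
    by (auto simp: tensor_alg_carrier induced_cls tensor_alg_add tensor_alg_smult tensor_alg_mult
        tensor_alg_adj ext_add ext_scale ext_mult ext_adj tensor_free_add tensor_free_scale
        free_mult_free free_adj_free)
qed

end

context star_algebra_pair
begin

lemma sing_zero_null: "a \<in> carrier A \<Longrightarrow> sing a \<zero>\<^bsub>B\<^esub> c \<in> null"
  using null_scaled(4)[of a "\<zero>\<^bsub>B\<^esub>" 0 c] by simp

lemma zero_sing_null: "b \<in> carrier B \<Longrightarrow> sing \<zero>\<^bsub>A\<^esub> b c \<in> null"
  using null_scaled(3)[of "\<zero>\<^bsub>A\<^esub>" b 0 c] by simp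

lemma null_sum: "finite S \<Longrightarrow> (\<And>i. i \<in> S \<Longrightarrow> f i \<in> null) \<Longrightarrow> sum f S \<in> null"
  by (induction S rule: finite_induct) (simp_all add: tensor_null.zero tensor_null.plus)

lemma sum_sing_null:
  assumes "finite J" "\<And>p. p \<in> J \<Longrightarrow> u p \<in> carrier A" and b: "b \<in> carrier B"
  shows "(\<Sum>p\<in>J. sing (u p) (d p \<odot>\<^bsub>B\<^esub> b) 1) - sing (finsum A (\<lambda>p. d p \<odot>\<^bsub>A\<^esub> u p) J) b 1 \<in> null"
  using assms(1,2)
proof (induction J rule: finite_induct)
  case empty
  then show ?case using null_uminus[OF zero_sing_null[OF b]] by simp
next
  case (insert p J)
  let ?F = "finsum A (\<lambda>p. d p \<odot>\<^bsub>A\<^esub> u p) J"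
  have F: "?F \<in> carrier A" and p: "u p \<in> carrier A"
    using insert.prems by (auto intro!: A.finsum_closed)
  have sum: "finsum A (\<lambda>p. d p \<odot>\<^bsub>A\<^esub> u p) (insert p J) = d p \<odot>\<^bsub>A\<^esub> u p \<oplus>\<^bsub>A\<^esub> ?F"
    using insert by (intro A.finsum_insert) auto
  have 1: "(\<Sum>p\<in>J. sing (u p) (d p \<odot>\<^bsub>B\<^esub> b) 1) - sing ?F b 1 \<in> null"
    using insert by simp
  have 2: "sing (d p \<odot>\<^bsub>A\<^esub> u p \<oplus>\<^bsub>A\<^esub> ?F) b 1 - sing (d p \<odot>\<^bsub>A\<^esub> u p) b 1 - sing ?F b 1 \<in> null"
    using p F b by (intro null_scaled) simp_all
  have 3: "sing (u p) (d p \<odot>\<^bsub>B\<^esub> b) 1 - sing (u p) b (1 * d p) \<in> null"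
    using p b by (rule null_scaled(4))
  have 4: "sing (d p \<odot>\<^bsub>A\<^esub> u p) b 1 - sing (u p) b (1 * d p) \<in> null"
    using p b by (rule null_scaled(3))
  show ?case unfolding sum
    using tensor_null.plus[OF null_diff[OF 1 2] null_diff[OF 3 4]] insert.hyps
    by (simp add: algebra_simps)
qed

end

text \<open>
  If each \<open>a\<close> is \<open>\<Sum>\<^sub>p a\<^sub>p u\<^sub>p\<close> with \<open>J\<close> finite, then \<open>a \<otimes> b = \<Sum>\<^sub>p u\<^sub>p \<otimes> a\<^sub>p b\<close>. Hence if the elements \<open>a\<^sub>p b\<close> can be
  recovered from \<open>\<beta>(a, b)\<close> by additive maps \<open>r\<^sub>p\<close>, the map \<open>G(x) = \<Sum>\<^sub>p u\<^sub>p \<otimes> r\<^sub>p(x)\<close> is a left inverse of \<open>ext\<close> modulo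
  the null space. This applies to matrix units \<open>u\<^sub>p\<close> and the entries \<open>r\<^sub>p\<close> of a matrix over \<open>B\<close>.
\<close>

lemma (in star_pairing) ext_injective:
  assumes J: "finite J" and u: "\<And>p. p \<in> J \<Longrightarrow> u p \<in> carrier A"
    and coord: "\<And>a. a \<in> carrier A \<Longrightarrow> finsum A (\<lambda>p. coord a p \<odot>\<^bsub>A\<^esub> u p) J = a"
    and r_closed: "\<And>p x. p \<in> J \<Longrightarrow> x \<in> carrier C \<Longrightarrow> r p x \<in> carrier B"
    and r_add: "\<And>p x y. p \<in> J \<Longrightarrow> x \<in> carrier C \<Longrightarrow> y \<in> carrier C \<Longrightarrow> r p (x \<oplus>\<^bsub>C\<^esub> y) = r p x \<oplus>\<^bsub>B\<^esub> r p y"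
    and r_\<beta>: "\<And>p a b. p \<in> J \<Longrightarrow> a \<in> carrier A \<Longrightarrow> b \<in> carrier B \<Longrightarrow> r p (\<beta> a b) = coord a p \<odot>\<^bsub>B\<^esub> b"
    and f: "f \<in> free" and ext0: "ext f = \<zero>\<^bsub>C\<^esub>"
  shows "f \<in> null"
proof -
  define G where "G x = (\<Sum>p\<in>J. sing (u p) (r p x) 1)" for x
  have r_zero: "r p \<zero>\<^bsub>C\<^esub> = \<zero>\<^bsub>B\<^esub>" if "p \<in> J" for p
    using r_add[OF that, of "\<zero>\<^bsub>C\<^esub>" "\<zero>\<^bsub>C\<^esub>"] r_closed[OF that, of "\<zero>\<^bsub>C\<^esub>"]
    by (metis B.add.r_cancel_one' C.l_zero C.zero_closed)
  have G0: "G \<zero>\<^bsub>C\<^esub> \<in> null"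
    unfolding G_def using J u by (intro null_sum) (auto simp: r_zero sing_zero_null)
  have "G (ext f) - f \<in> null" using f
  proof (induction f rule: tensor_free_induct)
    case zero
    then show ?case using G0 by simp
  next
    case (single a b c)
    have "G (ext (sing a b c)) = G (\<beta> a (c \<odot>\<^bsub>B\<^esub> b))" using single by (simp add: ext_single smult_right)
    also have "\<dots> = (\<Sum>p\<in>J. sing (u p) (coord a p \<odot>\<^bsub>B\<^esub> (c \<odot>\<^bsub>B\<^esub> b)) 1)"
      unfolding G_def using single by (intro sum.cong) (simp_all add: r_\<beta>)
    finally have "G (ext (sing a b c)) - sing (finsum A (\<lambda>p. coord a p \<odot>\<^bsub>A\<^esub> u p) J) (c \<odot>\<^bsub>B\<^esub> b) 1 \<in> null"
      using sum_sing_null[OF J u, where b="c \<odot>\<^bsub>B\<^esub> b" and d="coord a"] single by simp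
    then have "(G (ext (sing a b c)) - sing a (c \<odot>\<^bsub>B\<^esub> b) 1) + (sing a (c \<odot>\<^bsub>B\<^esub> b) 1 - sing a b (1 * c)) \<in> null"
      using single by (intro tensor_null.plus null_scaled) (simp_all add: coord)
    then show ?case by simp
  next
    case (add f g)
    have "G (ext (f + g)) - G (ext f) - G (ext g)
      = (\<Sum>p\<in>J. sing (u p) (r p (ext f) \<oplus>\<^bsub>B\<^esub> r p (ext g)) 1 - sing (u p) (r p (ext f)) 1 - sing (u p) (r p (ext g)) 1)"
      using add by (simp add: G_def ext_add r_add sum_subtractf)
    also have "\<dots> \<in> null" using add J u r_closed by (intro null_sum null_scaled) simp_all
    finally have "(G (ext (f + g)) - G (ext f) - G (ext g)) + ((G (ext f) - f) + (G (ext g) - g)) \<in> null"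
      using add by (intro tensor_null.plus)
    then show ?case by (simp add: algebra_simps)
  qed
  then have "G \<zero>\<^bsub>C\<^esub> - (G (ext f) - f) \<in> null" by (rule null_diff[OF G0])
  then show ?thesis by (simp add: ext0)
qed

section \<open>Choi matrices\<close>

lemma map_mat_entry:
  "X \<in> carrier_mat k k \<Longrightarrow> i < k \<Longrightarrow> j < k \<Longrightarrow> map_mat f X $$ (i, j) = f (X $$ (i, j))"
  by simp

lemma linear_onD:
  assumes "linear_on A B f"
  shows "x \<in> carrier A \<Longrightarrow> f x \<in> carrier B"
    and "x \<in> carrier A \<Longrightarrow> y \<in> carrier A \<Longrightarrow> f (x \<oplus>\<^bsub>A\<^esub> y) = f x \<oplus>\<^bsub>B\<^esub> f y"
    and "x \<in> carrier A \<Longrightarrow> f (c \<odot>\<^bsub>A\<^esub> x) = c \<odot>\<^bsub>B\<^esub> f x"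
  using assms by (simp_all add: linear_on_def Pi_iff)

lemma linear_on_finsum:
  assumes A: "star_algebra A" and B: "star_algebra B" and f: "linear_on A B f"
    and "finite S" "g \<in> S \<rightarrow> carrier A"
  shows "f (finsum A g S) = finsum B (\<lambda>i. f (g i)) S"
proof -
  interpret A: star_algebra A by (rule A)
  interpret B: star_algebra B by (rule B)
  note l = linear_onD[OF f]
  show ?thesis
  proof (rule finsum_hom[OF A.abelian_monoid_A B.abelian_monoid_A])
    show "f \<zero>\<^bsub>A\<^esub> = \<zero>\<^bsub>B\<^esub>" using l(3)[of "\<zero>\<^bsub>A\<^esub>" 0] l(1) by simp
  qed (use assms l in auto)
qed

lemma matrix_unit_eq: "matrix_unit n i j = mat_at complex_alg n i j 1"
  by (simp add: matrix_unit_def mat_at_def cong: if_cong)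

lemma star_algebra_cmat: "star_algebra (cmat_alg n)"
  by (rule star_algebra.star_algebra_mat_alg[OF star_algebra_complex])

lemma matrix_unit_closed [simp]: "matrix_unit n i j \<in> carrier (cmat_alg n)"
  unfolding matrix_unit_eq by (rule star_algebra.mat_at_closed[OF star_algebra_complex]) simp

lemma matrix_unit_entry [simp]:
  "a < n \<Longrightarrow> b < n \<Longrightarrow> matrix_unit n i j $$ (a, b) = (if a = i \<and> b = j then 1 else 0)"
  by (simp add: matrix_unit_eq)

lemma matrix_unit_decompose:
  assumes X: "X \<in> carrier (cmat_alg n)"
  shows "finsum (cmat_alg n) (\<lambda>p. X $$ p \<odot>\<^bsub>cmat_alg n\<^esub> case_prod (matrix_unit n) p) ({..<n} \<times> {..<n}) = X"
proof -
  interpret M: star_algebra "cmat_alg n" by (rule star_algebra_cmat)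
  have at: "mat_at complex_alg n i j c = c \<odot>\<^bsub>cmat_alg n\<^esub> matrix_unit n i j" for i j c
    by (rule mat_alg_eqI[where k=n and A=complex_alg])
      (use star_algebra.mat_at_closed[OF star_algebra_complex] in simp_all)
  have "finsum (cmat_alg n) (\<lambda>p. X $$ p \<odot>\<^bsub>cmat_alg n\<^esub> case_prod (matrix_unit n) p) ({..<n} \<times> {..<n})
    = finsum (cmat_alg n) (\<lambda>(i, j). mat_at complex_alg n i j (X $$ (i, j))) ({..<n} \<times> {..<n})"
    by (intro M.finsum_cong') (auto simp: at)
  then show ?thesis using star_algebra.mat_alg_decompose[OF star_algebra_complex X] by simp
qed

lemma matrix_unit_mult:
  assumes "j < n"
  shows "matrix_unit n i j \<otimes>\<^bsub>cmat_alg n\<^esub> matrix_unit n j l = matrix_unit n i l"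
proof -
  interpret M: star_algebra "cmat_alg n" by (rule star_algebra_cmat)
  show ?thesis
  proof (rule mat_alg_eqI[where k=n and A=complex_alg])
    fix a b assume ab: "a < n" "b < n"
    have "(\<Sum>m<n. matrix_unit n i j $$ (a, m) * matrix_unit n j l $$ (m, b))
      = (\<Sum>m<n. if m = j then (if a = i \<and> b = l then 1 else 0) else 0)"
      using ab by (intro sum.cong) auto
    then show "(matrix_unit n i j \<otimes>\<^bsub>cmat_alg n\<^esub> matrix_unit n j l) $$ (a, b) = matrix_unit n i l $$ (a, b)"
      using ab assms by (simp add: finsum_complex_alg)
  qed simp_all
qed

lemma matrix_unit_adj: "adj (cmat_alg n) (matrix_unit n i j) = matrix_unit n j i"
proof -
  interpret M: star_algebra "cmat_alg n" by (rule star_algebra_cmat)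
  show ?thesis
    by (rule mat_alg_eqI[where k=n and A=complex_alg]) (auto simp: M.adj_closed)
qed

text \<open>
  \<open>e\<^sub>i\<^sub>j = e\<^sub>0\<^sub>i\<^sup>* e\<^sub>0\<^sub>j\<close>, so \<open>[e\<^sub>i\<^sub>j] = S\<^sup>* S\<close> for a matrix \<open>S\<close> with a single nonzero row.
\<close>

lemma (in star_algebra) matrix_of_units_star_square:
  assumes n: "1 \<le> n" and e: "\<And>i j. e i j \<in> carrier A"
    and adj: "\<And>i j. adj A (e i j) = e j i" and mult: "\<And>i l. e i 0 \<otimes> e 0 l = e i l"
  defines "S \<equiv> mat n n (\<lambda>(i, j). if i = 0 then e 0 j else \<zero>)"
  shows "S \<in> carrier (mat_alg n A)"
    and "mat n n (\<lambda>(i, j). e i j) = adj (mat_alg n A) S \<otimes>\<^bsub>mat_alg n A\<^esub> S"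
proof -
  show S: "S \<in> carrier (mat_alg n A)" using e by (auto simp: S_def mat_alg_carrier)
  show "mat n n (\<lambda>(i, j). e i j) = adj (mat_alg n A) S \<otimes>\<^bsub>mat_alg n A\<^esub> S"
  proof (rule mat_alg_eqI[where k=n and A=A])
    fix i j assume ij: "i < n" "j < n"
    have "finsum A (\<lambda>l. adj (mat_alg n A) S $$ (i, l) \<otimes> S $$ (l, j)) {..<n}
      = adj (mat_alg n A) S $$ (i, 0) \<otimes> S $$ (0, j)"
      using ij n e by (intro finsum_single) (auto simp: S_def adj_closed)
    then show "mat n n (\<lambda>(i, j). e i j) $$ (i, j) = (adj (mat_alg n A) S \<otimes>\<^bsub>mat_alg n A\<^esub> S) $$ (i, j)"
      using ij n by (simp add: S_def adj mult)
  qed (use S e in \<open>auto simp: mat_alg_carrier[of "mat _ _ _"]\<close>)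
qed

text \<open>
  The identification of \<open>M\<^sub>k(M\<^sub>n(A))\<close> with \<open>M\<^sub>n(M\<^sub>k(A))\<close>.
\<close>

definition flip_mat :: "nat \<Rightarrow> nat \<Rightarrow> 'a mat mat \<Rightarrow> 'a mat mat" where
  "flip_mat n k X = mat n n (\<lambda>(i, j). mat k k (\<lambda>(p, q). X $$ (p, q) $$ (i, j)))"

lemma flip_mat_entry [simp]:
  "i < n \<Longrightarrow> j < n \<Longrightarrow> p < k \<Longrightarrow> q < k \<Longrightarrow> flip_mat n k X $$ (i, j) $$ (p, q) = X $$ (p, q) $$ (i, j)"
  by (simp add: flip_mat_def)

context star_algebra
begin

lemma flip_mat_closed:
  assumes X: "X \<in> carrier (mat_alg k (mat_alg n A))"
  shows "flip_mat n k X \<in> carrier (mat_alg n (mat_alg k A))"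
proof (rule mat_alg_carrierI)
  fix i j assume ij: "i < n" "j < n"
  show "flip_mat n k X $$ (i, j) \<in> carrier (mat_alg k A)"
  proof (rule mat_alg_carrierI)
    fix p q assume "p < k" "q < k"
    then show "flip_mat n k X $$ (i, j) $$ (p, q) \<in> carrier A"
      using mat_alg_entry[OF mat_alg_entry[OF X]] ij by simp
  qed (use ij in \<open>simp add: flip_mat_def\<close>)
qed (simp add: flip_mat_def)

lemma flip_mat_star_square:
  assumes Y: "Y \<in> carrier (mat_alg k (mat_alg n A))"
  shows "flip_mat n k (adj (mat_alg k (mat_alg n A)) Y \<otimes>\<^bsub>mat_alg k (mat_alg n A)\<^esub> Y)
    = adj (mat_alg n (mat_alg k A)) (flip_mat n k Y) \<otimes>\<^bsub>mat_alg n (mat_alg k A)\<^esub> flip_mat n k Y"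
    (is "flip_mat n k ?L = ?R")
proof -
  interpret N: star_algebra "mat_alg n A" by (rule star_algebra_mat_alg)
  interpret K: star_algebra "mat_alg k A" by (rule star_algebra_mat_alg)
  interpret KN: star_algebra "mat_alg k (mat_alg n A)" by (rule N.star_algebra_mat_alg)
  interpret NK: star_algebra "mat_alg n (mat_alg k A)" by (rule K.star_algebra_mat_alg)
  note F = flip_mat_closed[OF Y]
  have L: "?L \<in> carrier (mat_alg k (mat_alg n A))" using Y by (simp add: KN.adj_closed)
  have R: "?R \<in> carrier (mat_alg n (mat_alg k A))" using F by (simp add: NK.adj_closed)
  have y: "Y $$ (p, q) $$ (i, j) \<in> carrier A" if "p < k" "q < k" "i < n" "j < n" for p q i j
    using mat_alg_entry[OF mat_alg_entry[OF Y that(1,2)] that(3,4)] .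
  show ?thesis
  proof (rule mat_alg_eqI[where k=n and A="mat_alg k A"])
    fix i j assume ij: "i < n" "j < n"
    show "flip_mat n k ?L $$ (i, j) = ?R $$ (i, j)"
    proof (rule mat_alg_eqI[where k=k and A=A])
      fix p q assume pq: "p < k" "q < k"
      have "flip_mat n k ?L $$ (i, j) $$ (p, q)
        = finsum A (\<lambda>r. finsum A (\<lambda>m. adj A (Y $$ (r, p) $$ (m, i)) \<otimes> Y $$ (r, q) $$ (m, j)) {..<n}) {..<k}"
      proof -
        have "?L $$ (p, q) = finsum (mat_alg n A)
            (\<lambda>r. adj (mat_alg n A) (Y $$ (r, p)) \<otimes>\<^bsub>mat_alg n A\<^esub> Y $$ (r, q)) {..<k}"
          using pq mat_alg_entry[OF Y] by (auto intro!: N.finsum_cong' simp: N.adj_closed)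
        then have "flip_mat n k ?L $$ (i, j) $$ (p, q) = finsum (mat_alg n A)
            (\<lambda>r. adj (mat_alg n A) (Y $$ (r, p)) \<otimes>\<^bsub>mat_alg n A\<^esub> Y $$ (r, q)) {..<k} $$ (i, j)"
          using pq ij by (simp del: mat_alg_entries)
        also have "\<dots> = finsum A
            (\<lambda>r. (adj (mat_alg n A) (Y $$ (r, p)) \<otimes>\<^bsub>mat_alg n A\<^esub> Y $$ (r, q)) $$ (i, j)) {..<k}"
          using pq ij mat_alg_entry[OF Y] by (intro mat_alg_finsum_entry) (auto simp: N.adj_closed)
        also have "\<dots> = finsum A (\<lambda>r. finsum A (\<lambda>m. adj A (Y $$ (r, p) $$ (m, i)) \<otimes> Y $$ (r, q) $$ (m, j)) {..<n}) {..<k}"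
          using pq ij y by (auto intro!: finsum_cong' finsum_closed simp: adj_closed)
        finally show ?thesis .
      qed
      also have "\<dots> = finsum A (\<lambda>m. finsum A (\<lambda>r. adj A (Y $$ (r, p) $$ (m, i)) \<otimes> Y $$ (r, q) $$ (m, j)) {..<k}) {..<n}"
        using pq ij y by (intro finsum_swap) (auto simp: adj_closed)
      also have "\<dots> = ?R $$ (i, j) $$ (p, q)"
      proof -
        have "?R $$ (i, j) = finsum (mat_alg k A) (\<lambda>m. adj (mat_alg k A) (flip_mat n k Y $$ (m, i))
            \<otimes>\<^bsub>mat_alg k A\<^esub> flip_mat n k Y $$ (m, j)) {..<n}"
          using ij mat_alg_entry[OF F] by (auto intro!: K.finsum_cong' simp: K.adj_closed)
        then have "?R $$ (i, j) $$ (p, q) = finsum (mat_alg k A) (\<lambda>m. adj (mat_alg k A) (flip_mat n k Y $$ (m, i))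
            \<otimes>\<^bsub>mat_alg k A\<^esub> flip_mat n k Y $$ (m, j)) {..<n} $$ (p, q)" by (rule arg_cong)
        also have "\<dots> = finsum A (\<lambda>m. (adj (mat_alg k A) (flip_mat n k Y $$ (m, i))
            \<otimes>\<^bsub>mat_alg k A\<^esub> flip_mat n k Y $$ (m, j)) $$ (p, q)) {..<n}"
          using pq ij mat_alg_entry[OF F] by (intro mat_alg_finsum_entry) (auto simp: K.adj_closed)
        also have "\<dots> = finsum A (\<lambda>m. finsum A (\<lambda>r. adj A (Y $$ (r, p) $$ (m, i)) \<otimes> Y $$ (r, q) $$ (m, j)) {..<k}) {..<n}"
          using pq ij y by (auto intro!: finsum_cong' finsum_closed simp: adj_closed)
        finally show ?thesis by (rule sym)
      qed
      finally show "flip_mat n k ?L $$ (i, j) $$ (p, q) = ?R $$ (i, j) $$ (p, q)" .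
    qed (rule mat_alg_entry[OF flip_mat_closed[OF L] ij], rule mat_alg_entry[OF R ij])
  qed (rule flip_mat_closed[OF L], rule R)
qed

end

section \<open>The equivalences\<close>

locale linear_map_on_matrices = B: cstar_norm B NB
  for B :: "('b, 'y) star_alg_scheme" and NB +
  fixes n :: nat and \<phi> :: "complex mat \<Rightarrow> 'b"
  assumes n: "1 \<le> n" and linear: "linear_on (cmat_alg n) B \<phi>"
begin

definition choi :: "'b mat" where
  "choi = mat n n (\<lambda>(i, j). \<phi> (matrix_unit n i j))"

lemma choi_closed: "choi \<in> carrier (mat_alg n B)"
  using linear_onD(1)[OF linear matrix_unit_closed] by (auto simp: choi_def intro!: mat_alg_carrierI)

lemma choi_entry [simp]: "i < n \<Longrightarrow> j < n \<Longrightarrow> choi $$ (i, j) = \<phi> (matrix_unit n i j)"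
  by (simp add: choi_def)

lemma map_eq_choi:
  assumes X: "X \<in> carrier (cmat_alg n)"
  shows "\<phi> X = finsum B (\<lambda>(i, j). X $$ (i, j) \<odot>\<^bsub>B\<^esub> choi $$ (i, j)) ({..<n} \<times> {..<n})"
proof -
  interpret M: star_algebra "cmat_alg n" by (rule star_algebra_cmat)
  note l = linear_onD[OF linear]
  have "\<phi> X = \<phi> (finsum (cmat_alg n) (\<lambda>p. X $$ p \<odot>\<^bsub>cmat_alg n\<^esub> case_prod (matrix_unit n) p) ({..<n} \<times> {..<n}))"
    by (simp add: matrix_unit_decompose[OF X])
  also have "\<dots> = finsum B (\<lambda>p. \<phi> (X $$ p \<odot>\<^bsub>cmat_alg n\<^esub> case_prod (matrix_unit n) p)) ({..<n} \<times> {..<n})"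
    by (intro linear_on_finsum[OF star_algebra_cmat _ linear]) (auto intro: B.star_algebra_axioms)
  also have "\<dots> = finsum B (\<lambda>(i, j). X $$ (i, j) \<odot>\<^bsub>B\<^esub> choi $$ (i, j)) ({..<n} \<times> {..<n})"
    by (intro B.finsum_cong') (auto simp: l)
  finally show ?thesis .
qed

lemma linear_on_map_mat: "linear_on (mat_alg k (cmat_alg n)) (mat_alg k B) (map_mat \<phi>)"
proof -
  interpret M: star_algebra "cmat_alg n" by (rule star_algebra_cmat)
  note l = linear_onD[OF linear]
  have closed: "map_mat \<phi> X \<in> carrier (mat_alg k B)" if "X \<in> carrier (mat_alg k (cmat_alg n))" for X
    using that l(1) by (auto simp: mat_alg_carrier[of _ k])
  show ?thesis
    unfolding linear_on_def
    by (auto simp: closed l mat_alg_entry map_mat_entry[where k=k] intro!: mat_alg_eqI[where k=k and A=B])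
qed

text \<open>
  The \<open>(p, q)\<close> entry of the amplification at \<open>X\<close> is \<open>\<phi>(X\<^sub>p\<^sub>q) = \<Sum>\<^sub>i\<^sub>j (X\<^sub>p\<^sub>q)\<^sub>i\<^sub>j \<phi>(E\<^sub>i\<^sub>j)\<close>, which is the contraction of the flipped
  \<open>X\<close> with the Choi matrix under the pairing \<open>[a\<^sub>p\<^sub>q b]\<close>.
\<close>

theorem completely_positive_if_choi_positive:
  assumes P: "positive_elt (mat_alg n B) choi"
  shows "completely_positive (cmat_alg n) B \<phi>"
  unfolding completely_positive_def positive_map_def
proof (intro allI impI conjI linear_on_map_mat)
  fix k :: nat and X
  assume X: "positive_elt (mat_alg k (cmat_alg n)) X"
  have Cn: "cstar_norm (cmat_alg n) (star_algebra.sos_norm (cmat_alg n))"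
    and Ck: "cstar_norm (cmat_alg k) (star_algebra.sos_norm (cmat_alg k))"
    by (rule cstar_norm.cstar_norm_mat_alg[OF cstar_norm_complex])+
  interpret KN: cstar_norm "mat_alg k (cmat_alg n)" "star_algebra.sos_norm (mat_alg k (cmat_alg n))"
    by (rule cstar_norm.cstar_norm_mat_alg[OF Cn])
  interpret NK: cstar_norm "mat_alg n (cmat_alg k)" "star_algebra.sos_norm (mat_alg n (cmat_alg k))"
    by (rule cstar_norm.cstar_norm_mat_alg[OF Ck])
  have Xc: "X \<in> carrier (mat_alg k (cmat_alg n))" using X by (simp add: positive_elt_def)
  obtain Y where Y: "Y \<in> carrier (mat_alg k (cmat_alg n))"
      "X = adj (mat_alg k (cmat_alg n)) Y \<otimes>\<^bsub>mat_alg k (cmat_alg n)\<^esub> Y"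
    using X unfolding KN.positive_elt_iff_star_square by blast
  have R: "positive_elt (mat_alg n (cmat_alg k)) (flip_mat n k X)"
    unfolding NK.positive_elt_iff_star_square Y(2)
      star_algebra.flip_mat_star_square[OF star_algebra_complex Y(1)]
    using star_algebra.flip_mat_closed[OF star_algebra_complex Y(1)] by blast
  interpret S: star_pairing "cmat_alg k" B "mat_alg k B" "mat_scale B k"
    by (rule B.star_pairing_mat_scale)
  have "map_mat \<phi> X = S.contract n (flip_mat n k X) choi"
  proof (rule mat_alg_eqI[where k=k and A=B])
    show "map_mat \<phi> X \<in> carrier (mat_alg k B)" using linear_onD(1)[OF linear_on_map_mat Xc] .
    show "S.contract n (flip_mat n k X) choi \<in> carrier (mat_alg k B)"
      unfolding S.contract_def using mat_alg_entry[OF choi_closed]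
      by (intro S.C.finsum_closed) auto
    fix p q assume pq: "p < k" "q < k"
    have "S.contract n (flip_mat n k X) choi $$ (p, q)
      = finsum B (\<lambda>t. (case t of (i, j) \<Rightarrow> mat_scale B k (flip_mat n k X $$ (i, j)) (choi $$ (i, j))) $$ (p, q))
         ({..<n} \<times> {..<n})"
      unfolding S.contract_def using pq mat_alg_entry[OF choi_closed]
      by (intro B.mat_alg_finsum_entry) auto
    also have "\<dots> = finsum B (\<lambda>(i, j). X $$ (p, q) $$ (i, j) \<odot>\<^bsub>B\<^esub> choi $$ (i, j)) ({..<n} \<times> {..<n})"
      using pq mat_alg_entry[OF choi_closed] by (intro B.finsum_cong') (auto simp del: choi_entry)
    also have "\<dots> = \<phi> (X $$ (p, q))"
      using pq mat_alg_entry[OF Xc] by (simp add: map_eq_choi)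
    finally show "map_mat \<phi> X $$ (p, q) = S.contract n (flip_mat n k X) choi $$ (p, q)"
      using pq Xc by simp
  qed
  then show "positive_elt (mat_alg k B) (map_mat \<phi> X)"
    using S.contract_positive[OF Ck B.cstar_norm_axioms B.cstar_norm_mat_alg R P] by simp
qed

theorem choi_positive_if_completely_positive:
  assumes cp: "completely_positive (cmat_alg n) B \<phi>"
  shows "positive_elt (mat_alg n B) choi"
proof -
  have Cn: "cstar_norm (cmat_alg n) (star_algebra.sos_norm (cmat_alg n))"
    by (rule cstar_norm.cstar_norm_mat_alg[OF cstar_norm_complex])
  interpret N: cstar_norm "cmat_alg n" "star_algebra.sos_norm (cmat_alg n)" by (rule Cn)
  interpret NN: cstar_norm "mat_alg n (cmat_alg n)" "star_algebra.sos_norm (mat_alg n (cmat_alg n))"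
    by (rule cstar_norm.cstar_norm_mat_alg[OF Cn])
  have "positive_elt (mat_alg n (cmat_alg n)) (mat n n (\<lambda>(i, j). matrix_unit n i j))"
    unfolding NN.positive_elt_iff_star_square
    using N.matrix_of_units_star_square[OF n, of "matrix_unit n"] n
    by (auto simp: matrix_unit_adj matrix_unit_mult)
  then have "positive_elt (mat_alg n B) (map_mat \<phi> (mat n n (\<lambda>(i, j). matrix_unit n i j)))"
    using cp n unfolding completely_positive_def positive_map_def by blast
  also have "map_mat \<phi> (mat n n (\<lambda>(i, j). matrix_unit n i j)) = choi"
    by (rule eq_matI) (auto simp: choi_def)
  finally show ?thesis .
qed

lemma embedded_id_tensor:
  assumes A: "star_algebra A" and C: "star_algebra C" and \<iota>: "star_embedding (tensor_alg A B) C \<iota>"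
    and R: "R \<in> carrier (mat_alg n A)"
  shows "\<iota> (id_tensor A B n \<phi> R) = finsum C (\<lambda>(i, j).
    \<iota> (pure_tensor A B (R $$ (i, j)) (choi $$ (i, j)))) ({..<n} \<times> {..<n})"
proof -
  interpret C: star_algebra C by (rule C)
  interpret star_algebra_pair A B by (intro star_algebra_pair.intro A B.star_algebra_axioms)
  interpret S: star_pairing A B C "\<lambda>a b. \<iota> (pure_tensor A B a b)"
    by (rule star_pairing_embedding[OF C \<iota>])
  have lin: "linear_on T C \<iota>" using \<iota> by (simp add: star_embedding_def)
  note l = linear_onD[OF lin]
  let ?g = "\<lambda>(i, j). pure_tensor A B (R $$ (i, j)) (\<phi> (matrix_unit n i j))"
  have g: "?g \<in> {..<n} \<times> {..<n} \<rightarrow> carrier T"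
    using mat_alg_entry[OF R] linear_onD(1)[OF linear] by (auto intro!: pure_tensor_closed)
  have "\<iota> (finsum T ?g ({..<n} \<times> {..<n})) = finsum C (\<lambda>p. \<iota> (?g p)) ({..<n} \<times> {..<n})"
  proof (rule finsum_hom[OF abelian_monoid_tensor_alg C.abelian_monoid_A])
    have "\<zero>\<^bsub>T\<^esub> = 0 \<odot>\<^bsub>T\<^esub> \<zero>\<^bsub>T\<^esub>"
      by (simp add: tensor_alg_zero tensor_alg_smult)
    moreover have "\<zero>\<^bsub>T\<^esub> \<in> carrier T" by (auto simp: tensor_alg_zero tensor_alg_carrier)
    ultimately show "\<iota> \<zero>\<^bsub>T\<^esub> = \<zero>\<^bsub>C\<^esub>" using l(1)[of "\<zero>\<^bsub>T\<^esub>"] l(3)[of "\<zero>\<^bsub>T\<^esub>" 0] by simp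
  qed (use l g in auto)
  also have "\<dots> = finsum C (\<lambda>(i, j). \<iota> (pure_tensor A B (R $$ (i, j)) (choi $$ (i, j)))) ({..<n} \<times> {..<n})"
    using g l(1) mat_alg_entry[OF R] mat_alg_entry[OF choi_closed]
    by (intro C.finsum_cong') (auto intro!: l(1) pure_tensor_closed)
  finally show ?thesis by (simp add: id_tensor_def)
qed

text \<open>
  The image of \<open>R\<close> is the contraction of \<open>R\<close> with the Choi matrix under the pairing \<open>a \<otimes> b\<close>.
\<close>

theorem positive_on_tensors_if_choi_positive:
  assumes P: "positive_elt (mat_alg n B) choi"
    and A: "cstar_norm A NA" and C: "cstar_norm C NC" and \<iota>: "star_embedding (tensor_alg A B) C \<iota>"
  shows "positive_map (mat_alg n A) C (\<iota> \<circ> id_tensor A B n \<phi>)"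
proof -
  interpret A: cstar_norm A NA by (rule A)
  interpret C: cstar_norm C NC by (rule C)
  interpret star_algebra_pair A B ..
  interpret S: star_pairing A B C "\<lambda>a b. \<iota> (pure_tensor A B a b)"
    by (rule star_pairing_embedding[OF C.star_algebra_axioms \<iota>])
  have eq: "\<iota> (id_tensor A B n \<phi> R) = S.contract n R choi" if "R \<in> carrier (mat_alg n A)" for R
    using embedded_id_tensor[OF A.star_algebra_axioms C.star_algebra_axioms \<iota> that]
    by (simp add: S.contract_def)
  have entry: "(\<lambda>(i, j). \<iota> (pure_tensor A B (R $$ (i, j)) (choi $$ (i, j)))) \<in> {..<n} \<times> {..<n} \<rightarrow> carrier C"
    if "R \<in> carrier (mat_alg n A)" for R
    using mat_alg_entry[OF that] mat_alg_entry[OF choi_closed] by (auto intro!: S.closed simp del: choi_entry)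
  have "linear_on (mat_alg n A) C (\<iota> \<circ> id_tensor A B n \<phi>)"
    unfolding linear_on_def comp_def
  proof (intro conjI ballI allI Pi_I)
    fix R assume R: "R \<in> carrier (mat_alg n A)"
    show "\<iota> (id_tensor A B n \<phi> R) \<in> carrier C"
      unfolding eq[OF R] S.contract_def by (rule C.finsum_closed[OF entry[OF R]])
    show "\<iota> (id_tensor A B n \<phi> (c \<odot>\<^bsub>mat_alg n A\<^esub> R)) = c \<odot>\<^bsub>C\<^esub> \<iota> (id_tensor A B n \<phi> R)" for c
    proof -
      have "S.contract n (c \<odot>\<^bsub>mat_alg n A\<^esub> R) choi = c \<odot>\<^bsub>C\<^esub> S.contract n R choi"
        unfolding S.contract_def C.finsum_smult[OF _ entry[OF R], simplified]
        using entry[OF R] mat_alg_entry[OF R] mat_alg_entry[OF choi_closed]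
        by (intro C.finsum_cong') (auto simp: S.smult_left S.closed simp del: choi_entry)
      then show ?thesis using R by (simp add: eq)
    qed
    fix R' assume R': "R' \<in> carrier (mat_alg n A)"
    show "\<iota> (id_tensor A B n \<phi> (R \<oplus>\<^bsub>mat_alg n A\<^esub> R')) = \<iota> (id_tensor A B n \<phi> R) \<oplus>\<^bsub>C\<^esub> \<iota> (id_tensor A B n \<phi> R')"
    proof -
      have "S.contract n (R \<oplus>\<^bsub>mat_alg n A\<^esub> R') choi = S.contract n R choi \<oplus>\<^bsub>C\<^esub> S.contract n R' choi"
        unfolding S.contract_def C.finsum_addf[OF entry[OF R] entry[OF R'], symmetric]
        using entry[OF R] entry[OF R'] mat_alg_entry[OF R] mat_alg_entry[OF R'] mat_alg_entry[OF choi_closed]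
        by (intro C.finsum_cong') (auto simp: S.add_left S.closed simp del: choi_entry)
      then show ?thesis using R R' by (simp add: eq)
    qed
  qed
  moreover have "positive_elt C ((\<iota> \<circ> id_tensor A B n \<phi>) R)" if R: "positive_elt (mat_alg n A) R" for R
  proof -
    have "R \<in> carrier (mat_alg n A)" using R by (simp add: positive_elt_def)
    then show ?thesis
      using S.contract_positive[OF A B.cstar_norm_axioms C R P] by (simp add: eq)
  qed
  ultimately show ?thesis by (simp add: positive_map_def)
qed

end

lemma star_pairing_copy:
  assumes \<beta>: "star_pairing D B E \<beta>" and D: "cstar_norm D ND" and E: "cstar_norm E NE"
    and f: "inj f" and g: "inj g"
  shows "star_pairing (normed_copy f ND D) B (normed_copy g NE E) (\<lambda>a b. g (\<beta> (inv_into UNIV f a) b))"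
proof -
  interpret \<beta>: star_pairing D B E \<beta> by (rule \<beta>)
  interpret D': unital_cstar_algebra "normed_copy f ND D"
    by (rule cstar_norm.unital_cstar_algebra_copy[OF D f])
  interpret E': unital_cstar_algebra "normed_copy g NE E"
    by (rule cstar_norm.unital_cstar_algebra_copy[OF E g])
  have "star_algebra (normed_copy f ND D)" "star_algebra (normed_copy g NE E)"
    using D'.unital_cstar_algebra_axioms E'.unital_cstar_algebra_axioms
    by (simp_all add: unital_cstar_algebra_iff cstar_norm_def)
  then show ?thesis
    by (intro star_pairing.intro star_pairing_axioms.intro \<beta>.B.star_algebra_axioms)
      (auto simp: normed_copy_simps f g \<beta>.closed \<beta>.bilinear \<beta>.mult \<beta>.adj)
qed

lemma (in cstar_norm) positive_elt_copy_iff: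
  fixes h :: "'a \<Rightarrow> 'c"
  assumes h: "inj h" and x: "x \<in> carrier A"
  shows "positive_elt (normed_copy h N A) (h x) \<longleftrightarrow> positive_elt A x"
proof -
  interpret C: cstar_norm "normed_copy h N A" "nrm (normed_copy h N A)"
    using unital_cstar_algebra_copy[OF h] by (simp add: unital_cstar_algebra_iff)
  show ?thesis
    unfolding positive_elt_iff_star_square C.positive_elt_iff_star_square
    using inj_eq[OF h] by (auto simp: normed_copy_simps h)
qed

context linear_map_on_matrices
begin

text \<open>
  \<open>A\<close> and \<open>C\<close> are \<open>M\<^sub>n\<close> and \<open>M\<^sub>n(B)\<close>, carried over to the given types. The pairing \<open>[a\<^sub>p\<^sub>q b]\<close> embeds \<open>M\<^sub>n \<otimes> B\<close> into \<open>M\<^sub>n(B)\<close>,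
  and \<open>id \<otimes> \<phi>\<close> maps the positive matrix \<open>[E\<^sub>i\<^sub>j]\<close> to \<open>\<Sum>\<^sub>i\<^sub>j [\<delta>\<^sub>p\<^sub>i \<delta>\<^sub>q\<^sub>j \<phi>(E\<^sub>i\<^sub>j)]\<^sub>p\<^sub>q\<close>, the Choi matrix.
\<close>

theorem choi_positive_from_copy:
  fixes f :: "complex mat \<Rightarrow> 'd" and g :: "'b mat \<Rightarrow> 'e"
  assumes f: "inj f" and g: "inj g"
  defines "A \<equiv> normed_copy f (star_algebra.sos_norm (cmat_alg n)) (cmat_alg n)"
    and "C \<equiv> normed_copy g (star_algebra.sos_norm (mat_alg n B)) (mat_alg n B)"
  shows "unital_cstar_algebra A" and "unital_cstar_algebra C"
    and "\<exists>\<iota>. star_embedding (tensor_alg A B) C \<iota> \<and>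
      (positive_map (mat_alg n A) C (\<iota> \<circ> id_tensor A B n \<phi>) \<longrightarrow> positive_elt (mat_alg n B) choi)"
proof -
  let ?J = "{..<n} \<times> {..<n}"
  have Cn: "cstar_norm (cmat_alg n) (star_algebra.sos_norm (cmat_alg n))"
    by (rule cstar_norm.cstar_norm_mat_alg[OF cstar_norm_complex])
  interpret N: cstar_norm "cmat_alg n" "star_algebra.sos_norm (cmat_alg n)" by (rule Cn)
  interpret E: cstar_norm "mat_alg n B" "star_algebra.sos_norm (mat_alg n B)"
    by (rule B.cstar_norm_mat_alg)
  show A: "unital_cstar_algebra A" and C: "unital_cstar_algebra C"
    unfolding A_def C_def
    by (rule N.unital_cstar_algebra_copy[OF f], rule E.unital_cstar_algebra_copy[OF g])
  interpret A: cstar_norm A "nrm A" using A by (simp add: unital_cstar_algebra_iff)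
  interpret C: cstar_norm C "nrm C" using C by (simp add: unital_cstar_algebra_iff)
  interpret MA: cstar_norm "mat_alg n A" "star_algebra.sos_norm (mat_alg n A)"
    by (rule A.cstar_norm_mat_alg)
  note fs = normed_copy_simps[OF f, of "star_algebra.sos_norm (cmat_alg n)" "cmat_alg n", folded A_def]
  note gs = normed_copy_simps[OF g, of "star_algebra.sos_norm (mat_alg n B)" "mat_alg n B", folded C_def]
  define \<beta> where "\<beta> a b = g (mat_scale B n (inv_into UNIV f a) b)" for a b
  interpret \<beta>: star_pairing A B C \<beta>
    unfolding \<beta>_def A_def C_def
    by (rule star_pairing_copy[OF B.star_pairing_mat_scale Cn B.cstar_norm_mat_alg f g])
  have \<beta>_f: "\<beta> (f a) b = g (mat_scale B n a b)" for a b
    using f by (simp add: \<beta>_def)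
  define u where "u p = f (case_prod (matrix_unit n) p)" for p
  define coord where "coord a p = inv_into UNIV f a $$ p" for a and p :: "nat \<times> nat"
  define r where "r p x = inv_into UNIV g x $$ p" for x and p :: "nat \<times> nat"
  have inj: "h \<in> \<beta>.null" if "h \<in> \<beta>.free" "\<beta>.ext h = \<zero>\<^bsub>C\<^esub>" for h
  proof (rule \<beta>.ext_injective[where J="?J" and u=u and coord=coord and r=r])
    show "u p \<in> carrier A" for p by (cases p) (simp add: u_def fs)
    show "finsum A (\<lambda>p. coord a p \<odot>\<^bsub>A\<^esub> u p) ?J = a" if a: "a \<in> carrier A" for a
    proof -
      obtain X where X: "X \<in> carrier (cmat_alg n)" "a = f X" using a by (auto simp: fs)
      have unit: "case_prod (matrix_unit n) p \<in> carrier (cmat_alg n)" for p by (cases p) simp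
      have "f (finsum (cmat_alg n) (\<lambda>p. X $$ p \<odot>\<^bsub>cmat_alg n\<^esub> case_prod (matrix_unit n) p) ?J)
        = finsum A (\<lambda>p. f (X $$ p \<odot>\<^bsub>cmat_alg n\<^esub> case_prod (matrix_unit n) p)) ?J"
        by (rule finsum_hom[OF N.abelian_monoid_A A.abelian_monoid_A]) (use unit in \<open>auto simp: fs\<close>)
      moreover have "finsum A (\<lambda>p. coord a p \<odot>\<^bsub>A\<^esub> u p) ?J
        = finsum A (\<lambda>p. f (X $$ p \<odot>\<^bsub>cmat_alg n\<^esub> case_prod (matrix_unit n) p)) ?J"
        by (rule A.finsum_cong') (use unit f in \<open>auto simp: fs X(2) coord_def u_def\<close>)
      ultimately show ?thesis by (simp add: matrix_unit_decompose[OF X(1)] X(2))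
    qed
    fix p assume "p \<in> ?J"
    then obtain i j where p: "p = (i, j)" "i < n" "j < n" by auto
    show "r p x \<in> carrier B" if "x \<in> carrier C" for x
      using that p g by (auto simp: gs r_def intro: mat_alg_entry)
    show "r p (x \<oplus>\<^bsub>C\<^esub> y) = r p x \<oplus>\<^bsub>B\<^esub> r p y" if "x \<in> carrier C" "y \<in> carrier C" for x y
      using that p g by (auto simp: gs r_def)
    show "r p (\<beta> a b) = coord a p \<odot>\<^bsub>B\<^esub> b" if "a \<in> carrier A" for a b
      using that p f g by (auto simp: fs \<beta>_f r_def coord_def)
  qed (use that in simp_all)
  have emb: "star_embedding (tensor_alg A B) C \<beta>.induced"
    by (rule \<beta>.star_embedding_induced[OF inj])
  have "positive_elt (mat_alg n B) choi"
    if pos: "positive_map (mat_alg n A) C (\<beta>.induced \<circ> id_tensor A B n \<phi>)"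
  proof -
    define R where "R = mat n n (\<lambda>(i, j). f (matrix_unit n i j))"
    have unit: "f (matrix_unit n i j) \<in> carrier A" for i j by (simp add: fs)
    have "positive_elt (mat_alg n A) R"
      unfolding MA.positive_elt_iff_star_square R_def
      using A.matrix_of_units_star_square[OF n, of "\<lambda>i j. f (matrix_unit n i j)"] n unit
      by (auto simp: fs matrix_unit_adj matrix_unit_mult)
    then have "positive_elt C (\<beta>.induced (id_tensor A B n \<phi> R))"
      using pos by (simp add: positive_map_def)
    moreover have "\<beta>.induced (id_tensor A B n \<phi> R) = g choi"
    proof -
      have R: "R \<in> carrier (mat_alg n A)" using unit by (auto simp: R_def intro!: mat_alg_carrierI)
      have at: "mat_scale B n (matrix_unit n i j) b = mat_at B n i j b" if "b \<in> carrier B" for i j b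
        by (rule mat_alg_eqI[where k=n and A=B]) (use that in auto)
      have c: "mat_at B n i j (choi $$ (i, j)) \<in> carrier (mat_alg n B)" if "i < n" "j < n" for i j
        using mat_alg_entry[OF choi_closed that] by (rule B.mat_at_closed)
      have "\<beta>.induced (id_tensor A B n \<phi> R)
        = finsum C (\<lambda>(i, j). \<beta>.induced (pure_tensor A B (R $$ (i, j)) (choi $$ (i, j)))) ?J"
        by (rule embedded_id_tensor[OF A.star_algebra_axioms C.star_algebra_axioms emb R])
      also have "\<dots> = finsum C (\<lambda>p. g (case p of (i, j) \<Rightarrow> mat_at B n i j (choi $$ (i, j)))) ?J"
        using mat_alg_entry[OF choi_closed] unit c
        by (intro C.finsum_cong')
          (auto simp: \<beta>.induced_pure_tensor R_def \<beta>_f at gs simp del: choi_entry)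
      also have "\<dots> = g (finsum (mat_alg n B) (\<lambda>(i, j). mat_at B n i j (choi $$ (i, j))) ?J)"
        by (rule finsum_hom[OF E.abelian_monoid_A C.abelian_monoid_A, symmetric])
          (use c in \<open>auto simp: gs simp del: choi_entry\<close>)
      finally show ?thesis by (simp only: B.mat_alg_decompose[OF choi_closed])
    qed
    ultimately show ?thesis
      using E.positive_elt_copy_iff[OF g choi_closed] by (simp add: C_def)
  qed
  then show "\<exists>\<iota>. star_embedding (tensor_alg A B) C \<iota> \<and>
      (positive_map (mat_alg n A) C (\<iota> \<circ> id_tensor A B n \<phi>) \<longrightarrow> positive_elt (mat_alg n B) choi)"
    using emb by blast
qed

end

theorem corollary1p6:
  fixes n :: nat
    and B :: "'b normed_star_alg"
    and \<phi> :: "complex mat \<Rightarrow> 'b"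
  assumes "n \<ge> 1"
    and "unital_cstar_algebra B"
    and "linear_on (cmat_alg n) B \<phi>"
  shows "(completely_positive (cmat_alg n) B \<phi> \<longleftrightarrow>
            positive_elt (mat_alg n B) (mat n n (\<lambda>(i, j). \<phi> (matrix_unit n i j)))) \<and>
         (completely_positive (cmat_alg n) B \<phi> \<longrightarrow>
            positive_on_tensors TYPE('a) TYPE('c) n B \<phi>) \<and>
         ((\<exists>f :: complex mat \<Rightarrow> 'a. inj f) \<and> (\<exists>g :: 'b mat \<Rightarrow> 'c. inj g) \<longrightarrow>
            (positive_on_tensors TYPE('a) TYPE('c) n B \<phi> \<longleftrightarrow>
               completely_positive (cmat_alg n) B \<phi>))"
proof -
  interpret linear_map_on_matrices B "nrm B" n \<phi>
    using assms by (intro linear_map_on_matrices.intro linear_map_on_matrices_axioms.intro)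
      (simp_all add: unital_cstar_algebra_iff)
  have cp_iff: "completely_positive (cmat_alg n) B \<phi> \<longleftrightarrow> positive_elt (mat_alg n B) choi"
    using completely_positive_if_choi_positive choi_positive_if_completely_positive by blast
  have tensors: "positive_on_tensors TYPE('a) TYPE('c) n B \<phi>" if "positive_elt (mat_alg n B) choi"
    unfolding positive_on_tensors_def
    unfolding unital_cstar_algebra_iff
    by (intro allI impI positive_on_tensors_if_choi_positive[OF that])
  have choi: "positive_elt (mat_alg n B) choi"
    if "inj f" "inj g" "positive_on_tensors TYPE('a) TYPE('c) n B \<phi>"
    for f :: "complex mat \<Rightarrow> 'a" and g :: "'b mat \<Rightarrow> 'c"
    using choi_positive_from_copy[OF that(1,2)] that(3) unfolding positive_on_tensors_def by blast
  show ?thesis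
    unfolding cp_iff choi_def[symmetric] using tensors choi by blast
qed

end
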